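(* Let $\psi\in L^2(\mathbb{R}^3,\mathbb{C}^4)$, $\psi\neq0$, be a Dirac wavefunction localized in a bounded region, let $e\in\mathbb{R}^3$ be a unit vector and $\overline{e}:=-e$. Write $t_e=t_e(\psi)$ and $t_{\overline{e}}=t_{\overline{e}}(\psi)$. Then: (a) $e(\psi_t)\le-\overline{e}(\psi)-|t-t_e|$ for all $t\in\mathbb{R}$. (b) $|t_e|+|t_{\overline{e}}|\le-\overline{e}(\psi)-e(\psi)$. (c) If $t_e=t_{\overline{e}}$, then $2|t_e|<-\overline{e}(\psi)-e(\psi)$. (d) $t_e(\psi_t)=t_e(\psi)-t$ for all $t\in\mathbb{R}$. (e) If $h\,\mathcal{F}\psi$ is bounded on $\mathbb{R}^3$, then the inequalities in (a) and (b) hold even with $<$ in place of $\le$.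
   Context: Fix a mass $m>0$ and Dirac matrices $\alpha_1,\alpha_2,\alpha_3,\beta$: Hermitian $4\times4$ complex matrices with $\alpha_j\alpha_k+\alpha_k\alpha_j=2\delta_{jk}I_4$, $\alpha_k\beta+\beta\alpha_k=0$, $\beta^2=I_4$. The free Dirac operator is the self-adjoint operator $H=\sum_{k=1}^3\alpha_k\frac{1}{\mathrm{i}}\partial_k+\beta m$ in $L^2(\mathbb{R}^3,\mathbb{C}^4)$ (equivalently $H=\mathcal{F}^{-1}h\mathcal{F}$, where $\mathcal{F}$ is the unitary Fourier transform, $(\mathcal{F}\psi)(p)=(2\pi)^{-3/2}\int \mathrm{e}^{-\mathrm{i}px}\psi(x)\,\mathrm{d}^3x$ for integrable $\psi$, and $h$ denotes multiplication by $h(p)=\sum_k\alpha_kp_k+\beta m$). A Dirac wavefunction is an element of $L^2(\mathbb{R}^3,\mathbb{C}^4)$. For a Dirac wavefunction $\psi$ and $t\in\mathbb{R}$ put $\psi_t:=\mathrm{e}^{\mathrm{i}tH}\psi$. A region is a measurable subset $\Delta\subset\mathbb{R}^3$; $\psi$ is localized in $\Delta$ if $1_\Delta\psi=\psi$ a.e. For $x,y\in\mathbb{R}^3$, $xy:=\sum_kx_ky_k$. For a unit vector $e\in\mathbb{R}^3$ and $\psi\neq0$, $e(\psi)\in[-\infty,\infty]$ denotes the maximal $\alpha\in[-\infty,\infty]$ such that $1_{\{x\in\mathbb{R}^3:\,xe\le\alpha\}}\psi=0$ a.e.; $\overline{e}(\psi)$ is the same quantity for the unit vector $\overline{e}=-e$.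 For $\psi\ne0$ localized in a bounded region and a unit vector $e$, $t_e(\psi)\in\mathbb{R}$ denotes the unique real number such that $e(\psi_t)=e(\psi)+|t_e(\psi)|-|t-t_e(\psi)|$ for all $t\in\mathbb{R}$ (such a number exists and is unique). *)

theory Defs
  imports "HOL-Analysis.Analysis"
begin

text \<open>
  Elements of $L^2$ are represented by Borel functions; every notion below that depends on a
  wavefunction is invariant under changing it on a Lebesgue null set. The norm on
  \<open>complex ^ 4\<close> is the Hermitian one.
\<close>

definition dirac_wavefunction :: "(real ^ 3 \<Rightarrow> complex ^ 4) \<Rightarrow> bool" where
  "dirac_wavefunction \<psi> \<longleftrightarrow>
     \<psi> \<in> borel_measurable lborel \<and> integrable lborel (\<lambda>x. (norm (\<psi> x))\<^sup>2)"

definition localized_in :: "(real ^ 3 \<Rightarrow> complex ^ 4) \<Rightarrow> (real ^ 3) set \<Rightarrow> bool" where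
  "localized_in \<psi> \<Delta> \<longleftrightarrow> (AE x in lborel. indicat_real \<Delta> x *\<^sub>R \<psi> x = \<psi> x)"

definition hermitian_matrix :: "complex ^ 4 ^ 4 \<Rightarrow> bool" where
  "hermitian_matrix A \<longleftrightarrow> transpose (map_matrix cnj A) = A"

definition dirac_matrices :: "(3 \<Rightarrow> complex ^ 4 ^ 4) \<Rightarrow> complex ^ 4 ^ 4 \<Rightarrow> bool" where
  "dirac_matrices \<alpha> \<beta> \<longleftrightarrow>
     (\<forall>k. hermitian_matrix (\<alpha> k)) \<and> hermitian_matrix \<beta> \<and>
     (\<forall>j k. \<alpha> j ** \<alpha> k + \<alpha> k ** \<alpha> j = mat (if j = k then 2 else 0)) \<and>
     (\<forall>k. \<alpha> k ** \<beta> + \<beta> ** \<alpha> k = 0) \<and>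
     \<beta> ** \<beta> = mat 1"

definition dirac_symbol ::
  "(3 \<Rightarrow> complex ^ 4 ^ 4) \<Rightarrow> complex ^ 4 ^ 4 \<Rightarrow> real \<Rightarrow> real ^ 3 \<Rightarrow> complex ^ 4 ^ 4" where
  "dirac_symbol \<alpha> \<beta> m p = (\<Sum>k\<in>UNIV. (p $ k) *\<^sub>R \<alpha> k) + m *\<^sub>R \<beta>"

text \<open>
  The library's \<^const>\<open>exp\<close> is not available on \<open>complex ^ 4 ^ 4\<close>, whose type-class
  multiplication is componentwise; hence the exponential series for \<open>**\<close>.
\<close>

definition matrix_exp :: "complex ^ 4 ^ 4 \<Rightarrow> complex ^ 4 ^ 4" where
  "matrix_exp A = (\<Sum>n. inverse (fact n) *\<^sub>R (((**) A ^^ n) (mat 1)))"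

definition fourier_integral :: "(real ^ 3 \<Rightarrow> complex ^ 4) \<Rightarrow> real ^ 3 \<Rightarrow> complex ^ 4" where
  "fourier_integral \<psi> p =
     ((2 * pi) powr (- 3 / 2)) *\<^sub>R
       (LINT x|lborel. exp (- (\<i> * complex_of_real (p \<bullet> x))) *s \<psi> x)"

text \<open>
  The unitary Fourier transform. For integrable functions it is the pointwise integral (so a
  continuous representative is selected); otherwise it is the $L^2$-limit of the integrals
  over the balls \<open>cball 0 n\<close>, a choice up to null sets. The nonnegative integral is used so
  that convergence is not satisfied by a non-integrable difference.
\<close>

definition fourier :: "(real ^ 3 \<Rightarrow> complex ^ 4) \<Rightarrow> real ^ 3 \<Rightarrow> complex ^ 4" where
  "fourier \<psi> =
     (if integrable lborel \<psi> then fourier_integral \<psi>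
      else (SOME \<phi>. dirac_wavefunction \<phi> \<and>
        (\<lambda>n::nat. \<integral>\<^sup>+ p. ennreal ((norm
           (fourier_integral (\<lambda>x. indicat_real (cball 0 (real n)) x *\<^sub>R \<psi> x) p - \<phi> p))\<^sup>2) \<partial>lborel)
          \<longlonglongrightarrow> 0))"

definition inverse_fourier :: "(real ^ 3 \<Rightarrow> complex ^ 4) \<Rightarrow> real ^ 3 \<Rightarrow> complex ^ 4" where
  "inverse_fourier \<phi> =
     (SOME \<psi>. dirac_wavefunction \<psi> \<and> (AE p in lborel. fourier \<psi> p = \<phi> p))"

text \<open>
  Since $H = F^{-1} h F$ with $h$ a multiplication operator, the unitary group is
  $e^{itH} = F^{-1} e^{ith} F$.
\<close>

definition dirac_evolution ::
  "(3 \<Rightarrow> complex ^ 4 ^ 4) \<Rightarrow> complex ^ 4 ^ 4 \<Rightarrow> real \<Rightarrow> real \<Rightarrow>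
   (real ^ 3 \<Rightarrow> complex ^ 4) \<Rightarrow> real ^ 3 \<Rightarrow> complex ^ 4" where
  "dirac_evolution \<alpha> \<beta> m t \<psi> =
     inverse_fourier (\<lambda>p. matrix_exp (mat (\<i> * complex_of_real t) ** dirac_symbol \<alpha> \<beta> m p)
                            *v fourier \<psi> p)"

definition edge :: "real ^ 3 \<Rightarrow> (real ^ 3 \<Rightarrow> complex ^ 4) \<Rightarrow> ereal" where
  "edge e \<psi> =
     (GREATEST a. AE x in lborel. indicat_real {x. ereal (x \<bullet> e) \<le> a} x *\<^sub>R \<psi> x = 0)"

definition edge_time ::
  "(3 \<Rightarrow> complex ^ 4 ^ 4) \<Rightarrow> complex ^ 4 ^ 4 \<Rightarrow> real \<Rightarrow> real ^ 3 \<Rightarrow>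
   (real ^ 3 \<Rightarrow> complex ^ 4) \<Rightarrow> real" where
  "edge_time \<alpha> \<beta> m e \<psi> =
     (THE s. \<forall>t. edge e (dirac_evolution \<alpha> \<beta> m t \<psi>)
                    = edge e \<psi> + ereal \<bar>s\<bar> - ereal \<bar>t - s\<bar>)"

end

theory Submission
  imports Defs "HOL-Probability.Probability" "HOL-Complex_Analysis.Complex_Analysis" "HOL-Real_Asymp.Real_Asymp"
begin

text \<open>
  For a boundedly supported \<open>\<psi>\<close>, Trotter products of the groups $e^{\mathrm{i}t\alpha_kp_k}$, which are
  superpositions of two translations, show that $\psi_t$ has bounded support. Its Fourier transform is therefore
  entire in $z$ at the complex momenta $p+ze$, and a Phragmen--Lindelof argument identifies $E(t)=e(\psi_t)$ with
  the decay rate of $\hat\psi_t(p+\mathrm{i}se)$ as $s\to-\infty$. Since $\psi_{t+\tau}+\psi_{t-\tau}=2\cos(\tau H)\psi_t$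
  and $\cos(\tau\omega(p+\mathrm{i}se))$ grows like $e^{\tau|s|}$, one has $\min(E(t+\tau),E(t-\tau))=E(t)-\tau$ for
  $\tau\ge0$; a function with this property that is bounded above is a tent $E(0)+|t_e|-|t-t_e|$.

  The tensor $\omega^2\hat\psi\otimes\hat\psi-h\hat\psi\otimes h\hat\psi$ is entire in $z$, independent of $t$, and
  not identically zero, because $\omega^2$ has simple zeros. Its growth in the two imaginary directions forces
  $e(\psi_t)+\overline e(\psi_{t'})\le0$ for all $t,t'$; this is (b) for $t=t_e$ and $t'=t_{\overline e}$. If equality held
  with $h\hat\psi$ bounded, the tensor would be $Ce^{-\mathrm{i}cz}$ with constant $C$; at both zeros $z_\pm$ of $\omega^2$
  it is annihilated by $h(p+z_\pm e)$, so $C$ is annihilated by $e\cdot\alpha$, whose square is $1$, and $C=0$.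
\<close>

\<comment> \<open>it competes with the components of vectors\<close>
no_notation fps_nth (infixl \<open>$\<close> 75)

section \<open>The Fourier transform on $L^2$\<close>

text \<open>The evolution is defined through a chosen inverse transform, so nothing is known about
  \<psi>_t until a concrete preimage is exhibited. The Trotter limit is one, and Plancherel's
  identity with a uniqueness statement identifies the chosen function with it; that is all the L^2
  Fourier theory there is. The support radius obtained in this way grows with speed 3, one unit per
  coordinate axis. It serves only to make the transforms entire; the sharp speed 1 comes from the
  growth at complex momenta.

  The obstacle there is that \<omega>(p+ze) branches at the zeros of \<omega>^2, which lie on the
  line Re z = -pe. The evolution formula is therefore continued from the real axis only within a
  half-plane beside that line. This half-plane contains the imaginary axis as long as pe is nonzero,
  and the excluded momenta form a null set.

  Let E' be the edge of \<psi>_t for -e. Part (a) is the chain E(t_e) \<le> -E'(t') \<le> -E'(0) at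
  the peak time t' of E', combined with the tent law. Part (c) compares both edges at one and the
  same time, where two half-spaces with E + E' \<ge> 0 would cover almost all of space. Part (d) is
  the group law together with the uniqueness of the peak.\<close>

abbreviation phase :: "'a::euclidean_space \<Rightarrow> 'a \<Rightarrow> complex" where
  "phase p x \<equiv> exp (- (\<i> * complex_of_real (p \<bullet> x)))"

abbreviation L2_square :: "('a::euclidean_space \<Rightarrow> 'b::real_normed_vector) \<Rightarrow> ennreal" where
  "L2_square f \<equiv> (\<integral>\<^sup>+x. ennreal ((norm (f x))\<^sup>2) \<partial>lborel)"

section \<open>Gaussian integrals\<close>

lemma gaussian_fourier_real:
  fixes \<epsilon> u :: real
  assumes "\<epsilon> > 0"
  shows "integrable lborel (\<lambda>x. exp (- (\<i> * complex_of_real (x * u))) * complex_of_real (exp (- (\<epsilon> * x)\<^sup>2 / 2)))" (is "integrable _ ?f")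
    and "(LINT x|lborel. exp (- (\<i> * complex_of_real (x * u))) * complex_of_real (exp (- (\<epsilon> * x)\<^sup>2 / 2)))
      = complex_of_real (sqrt (2 * pi) / \<epsilon> * exp (- (u / \<epsilon>)\<^sup>2 / 2))"
proof -
  \<comment> \<open>Up to a constant, the integrand is the standard normal density times a character
    of frequency -u/\<epsilon>, rescaled by \<epsilon>. The value is thus the characteristic
    function of the normal law, with the normalising factor sqrt(2 \<pi>) undone.\<close>
  define t where "t = - u / \<epsilon>"
  define g where "g x = std_normal_density x *\<^sub>R iexp (t * x)" for x
  have "integrable lborel g"
    unfolding g_def
    by (rule Bochner_Integration.integrable_bound[of _ std_normal_density])
       (auto simp: normal_density_nonneg)
  then have ig: "integrable lborel (\<lambda>x. g (0 + \<epsilon> * x))"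
    using assms by (subst lborel_integrable_real_affine_iff) auto
  have "complex_of_real (exp (- (t^2) / 2)) = char std_normal_distribution t"
    by (simp add: char_std_normal_distribution)
  also have "\<dots> = integral\<^sup>L lborel g"
    unfolding char_def g_def
    by (subst integral_density) (auto simp: normal_density_nonneg)
  also have "\<dots> = \<bar>\<epsilon>\<bar> *\<^sub>R (LINT x|lborel. g (0 + \<epsilon> * x))"
    using assms by (intro lborel_integral_real_affine) auto
  finally have v: "(LINT x|lborel. g (0 + \<epsilon> * x)) = complex_of_real (exp (- (t^2) / 2) / \<epsilon>)"
    using assms by (simp add: scaleR_conv_of_real field_simps)
  have eq: "?f = (\<lambda>x. complex_of_real (sqrt (2 * pi)) * g (0 + \<epsilon> * x))"
    using assms by (auto simp: fun_eq_iff g_def std_normal_density_def t_def scaleR_conv_of_real field_simps)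
  show "integrable lborel ?f"
    unfolding eq using ig by simp
  show "integral\<^sup>L lborel ?f = complex_of_real (sqrt (2 * pi) / \<epsilon> * exp (- (u / \<epsilon>)\<^sup>2 / 2))"
    unfolding eq using v by (simp add: t_def power_divide)
qed

text \<open>Phase and Gaussian both factor over the coordinates, and \<open>lborel\<close> is the
  image of a product of one-dimensional Lebesgue measures, so the integral is a product of
  \<open>DIM('a)\<close> real ones.\<close>

lemma gaussian_fourier:
  fixes u :: "'a::euclidean_space" and \<epsilon> :: real
  assumes "\<epsilon> > 0"
  shows "integrable lborel (\<lambda>x::'a. phase x u * complex_of_real (exp (- (\<epsilon> * norm x)\<^sup>2 / 2)))" (is "integrable _ ?f")
    and "(LINT x|lborel. phase x u * complex_of_real (exp (- (\<epsilon> * norm x)\<^sup>2 / 2)))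
      = complex_of_real ((sqrt (2 * pi) / \<epsilon>) ^ DIM('a) * exp (- (norm u / \<epsilon>)\<^sup>2 / 2))"
proof -
  interpret product_sigma_finite "\<lambda>_::'a. lborel :: real measure" ..
  define f where "f b y = exp (- (\<i> * complex_of_real (y * (u \<bullet> b)))) * complex_of_real (exp (- (\<epsilon> * y)\<^sup>2 / 2))" for b :: 'a and y :: real
  let ?T = "\<lambda>f. (\<Sum>b\<in>Basis. f b *\<^sub>R b) :: 'a"
  have fm[measurable]: "f b \<in> borel_measurable borel" for b unfolding f_def by measurable
  have n2: "(norm x)\<^sup>2 = (\<Sum>b\<in>Basis. (x \<bullet> b)\<^sup>2)" for x :: 'a
    unfolding power2_norm_eq_inner by (subst euclidean_inner) (simp add: power2_eq_square)
  have eq: "?f x = (\<Prod>b\<in>Basis. f b (x \<bullet> b))" for x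
  proof -
    have "(\<Prod>b\<in>Basis. f b (x \<bullet> b)) = exp (\<Sum>b\<in>Basis. - (\<i> * complex_of_real ((x \<bullet> b) * (u \<bullet> b)))) * exp (\<Sum>b\<in>Basis. complex_of_real (- (\<epsilon> * (x \<bullet> b))\<^sup>2 / 2))"
      unfolding f_def prod.distrib exp_sum[OF finite_Basis] by (simp add: exp_of_real[symmetric])
    also have "(\<Sum>b\<in>Basis. - (\<i> * complex_of_real ((x \<bullet> b) * (u \<bullet> b)))) = - (\<i> * complex_of_real (x \<bullet> u))"
      by (simp add: euclidean_inner[of x u] sum_negf sum_distrib_left)
    also have "(\<Sum>b\<in>Basis. complex_of_real (- (\<epsilon> * (x \<bullet> b))\<^sup>2 / 2)) = complex_of_real (- (\<epsilon> * norm x)\<^sup>2 / 2)"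
      unfolding of_real_sum[symmetric]
      by (simp add: power_mult_distrib n2 sum_distrib_left sum_negf sum_divide_distrib)
    finally show ?thesis by (simp add: exp_of_real[symmetric])
  qed
  have fint: "integrable lborel (f b)" for b
    unfolding f_def by (rule gaussian_fourier_real(1)[OF assms])
  have P1: "integrable (\<Pi>\<^sub>M b\<in>Basis. lborel) (\<lambda>x. \<Prod>b\<in>Basis. f b (x b))"
    by (rule product_integrable_prod) (auto simp: fint)
  have P2: "(LINT x|(\<Pi>\<^sub>M b\<in>Basis. lborel). (\<Prod>b\<in>Basis. f b (x b))) = (\<Prod>b\<in>Basis. integral\<^sup>L lborel (f b))"
    by (rule product_integral_prod) (auto simp: fint)
  have Tb: "(\<Prod>b\<in>Basis. f b (?T x \<bullet> b)) = (\<Prod>b\<in>Basis. f b (x b))" for x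
    by (intro prod.cong) auto
  show "integrable lborel ?f"
    unfolding eq by (subst lborel_eq, subst integrable_distr_eq) (auto simp: Tb P1)
  have "integral\<^sup>L lborel ?f = (\<Prod>b\<in>Basis. integral\<^sup>L lborel (f b))"
    unfolding eq by (subst lborel_eq, subst integral_distr) (auto simp: Tb P2)
  also have "\<dots> = (\<Prod>b\<in>Basis. complex_of_real (sqrt (2 * pi) / \<epsilon> * exp (- ((u \<bullet> b) / \<epsilon>)\<^sup>2 / 2)))"
    unfolding f_def by (intro prod.cong gaussian_fourier_real(2)[OF assms] refl)
  also have "\<dots> = complex_of_real ((sqrt (2 * pi) / \<epsilon>) ^ DIM('a) * exp (\<Sum>b\<in>Basis. - ((u \<bullet> b) / \<epsilon>)\<^sup>2 / 2))"
    unfolding of_real_prod[symmetric] prod.distrib exp_sum[OF finite_Basis] by simp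
  also have "(\<Sum>b\<in>Basis. - ((u \<bullet> b) / \<epsilon>)\<^sup>2 / 2) = - (norm u / \<epsilon>)\<^sup>2 / 2"
    by (simp add: power_divide n2 sum_divide_distrib sum_negf)
  finally show "integral\<^sup>L lborel ?f = complex_of_real ((sqrt (2 * pi) / \<epsilon>) ^ DIM('a) * exp (- (norm u / \<epsilon>)\<^sup>2 / 2))" .
qed

section \<open>Translations and continuous approximation in L^2\<close>

lemma integrable_shift_iff:
  fixes f :: "'a::euclidean_space \<Rightarrow> 'b::{banach, second_countable_topology}"
  assumes [measurable]: "f \<in> borel_measurable borel"
  shows "integrable lborel (\<lambda>x. f (x + v)) \<longleftrightarrow> integrable lborel f"
  by (subst lborel_distr_plus[of v, symmetric], subst integrable_distr_eq) (auto simp: add.commute)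

lemma integral_shift:
  fixes f :: "'a::euclidean_space \<Rightarrow> 'b::{banach, second_countable_topology}"
  assumes [measurable]: "f \<in> borel_measurable borel"
  shows "(LINT x|lborel. f (x + v)) = integral\<^sup>L lborel f"
  by (subst (2) lborel_distr_plus[of v, symmetric], subst integral_distr) (auto simp: add.commute)

lemma norm_triangle_sq2: "(norm (a + b))\<^sup>2 \<le> 2 * (norm a)\<^sup>2 + 2 * (norm (b::'b::real_normed_vector))\<^sup>2"
proof -
  have "(norm (a + b))\<^sup>2 \<le> (norm a + norm b)\<^sup>2"
    by (intro power_mono norm_triangle_ineq) auto
  also have "\<dots> \<le> 2 * (norm a)\<^sup>2 + 2 * (norm b)\<^sup>2"
    using zero_le_power2[of "norm a - norm b"] by (simp add: power2_sum power2_diff)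
  finally show ?thesis .
qed

text \<open>Almost everywhere, f is a limit of continuous functions \<open>G n\<close>, but without
  any domination. Cutting off the values by the nearest-point projection \<open>c k\<close> onto a
  disc and the domain by \<open>\<eta> k\<close> preserves continuity. Dominated convergence brings
  the truncation \<open>F k\<close> of f close to f, and then the same truncation of
  \<open>G n\<close> close to \<open>F k\<close>.\<close>

lemma L2_approx_continuous:
  fixes f :: "'a::euclidean_space \<Rightarrow> complex"
  assumes [measurable]: "f \<in> borel_measurable borel" and f2: "integrable lborel (\<lambda>x. (norm (f x))\<^sup>2)" and "\<delta> > 0"
  obtains g r where "continuous_on UNIV g" "\<And>x. norm x > r \<Longrightarrow> g x = 0" "integrable lborel (\<lambda>x. (norm (f x - g x))\<^sup>2)"
     "(LINT x|lborel. (norm (f x - g x))\<^sup>2) < \<delta>"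
proof -
  have "f measurable_on UNIV"
    by (rule lebesgue_measurable_imp_measurable_on) (auto intro: measurable_completion)
  then obtain N G where N: "negligible N" and G: "\<And>n::nat. continuous_on UNIV (G n)"
    and lim: "\<And>x. x \<notin> N \<Longrightarrow> (\<lambda>n. G n x) \<longlonglongrightarrow> f x"
    unfolding measurable_on_def by auto
  have AEN: "AE x in lborel. x \<notin> N"
    using N[unfolded negligible_iff_null_sets, THEN AE_not_in] by (simp add: AE_completion_iff)
  define c where "c k = closest_point (cball (0::complex) (real k))" for k :: nat
  define \<eta> where "\<eta> k x = max 0 (min 1 (real k + 1 - norm x))" for k :: nat and x :: 'a
  have c_cont: "continuous_on t (c k)" for t k
    unfolding c_def by (rule continuous_on_closest_point) auto
  have c_mem: "norm (c k z) \<le> real k" for k z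
    using closest_point_in_set[of "cball (0::complex) (real k)" z] unfolding c_def by auto
  have c_le: "norm (z - c k z) \<le> norm z" for k z
    using closest_point_le[of "cball (0::complex) (real k)" 0 z] unfolding c_def by (auto simp: dist_norm)
  have c_id: "c k z = z" if "norm z \<le> real k" for k z
    unfolding c_def using that by (intro closest_point_self) auto
  have \<eta>_cont: "continuous_on t (\<eta> k)" for t k
    unfolding \<eta>_def by (intro continuous_intros)
  have \<eta>_bd: "0 \<le> \<eta> k x" "\<eta> k x \<le> 1" for k x unfolding \<eta>_def by auto
  have [measurable]: "c k \<in> borel_measurable borel" "\<eta> k \<in> borel_measurable borel" for k
    using c_cont \<eta>_cont by (auto intro: borel_measurable_continuous_onI)
  define F where "F k x = \<eta> k x *\<^sub>R c k (f x)" for k x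
  have F_le: "norm (f x - F k x) \<le> 2 * norm (f x)" for k x
  proof -
    have "f x - F k x = (1 - \<eta> k x) *\<^sub>R f x + \<eta> k x *\<^sub>R (f x - c k (f x))"
      by (simp add: F_def algebra_simps)
    also have "norm \<dots> \<le> (1 - \<eta> k x) * norm (f x) + \<eta> k x * norm (f x)"
      using \<eta>_bd[of k x] by (intro norm_triangle_le add_mono) (auto intro!: mult_mono c_le)
    finally show ?thesis using \<eta>_bd[of k x] by (simp add: algebra_simps) (smt (verit) norm_ge_zero)
  qed
  have sq2: "norm ((norm (f x - F k x))\<^sup>2) \<le> 4 * (norm (f x))\<^sup>2" for k x
    using power_mono[OF F_le[of x k], of 2] by (simp add: power_mult_distrib)
  have [measurable]: "F k \<in> borel_measurable borel" for k unfolding F_def by measurable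
  have Flim: "(\<lambda>k. F k x) \<longlonglongrightarrow> f x" for x
  proof (rule tendsto_eventually)
    obtain k0 :: nat where k0: "real k0 \<ge> max (norm (f x)) (norm x)" using real_arch_simple by blast
    show "\<forall>\<^sub>F k in sequentially. F k x = f x"
      using eventually_ge_at_top[of k0]
    proof eventually_elim
      case (elim k)
      then have "real k \<ge> max (norm (f x)) (norm x)" using k0 by linarith
      then show ?case by (simp add: F_def \<eta>_def c_id)
    qed
  qed
  have "(\<lambda>k. LINT x|lborel. (norm (f x - F k x))\<^sup>2) \<longlonglongrightarrow> (LINT x|(lborel::'a measure). 0)"
  proof (rule integral_dominated_convergence[where w="\<lambda>x. 4 * (norm (f x))\<^sup>2"])
    show "AE x in lborel. (\<lambda>k. (norm (f x - F k x))\<^sup>2) \<longlonglongrightarrow> 0"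
    proof (rule AE_I2)
      fix x show "(\<lambda>k. (norm (f x - F k x))\<^sup>2) \<longlonglongrightarrow> 0"
        using tendsto_power[OF tendsto_norm[OF tendsto_diff[OF tendsto_const[of "f x"] Flim[of x]]], of 2] by simp
    qed
  qed (use f2 sq2 in auto)
  then have "\<forall>\<^sub>F k in sequentially. (LINT x|lborel. (norm (f x - F k x))\<^sup>2) < \<delta> / 4"
    using \<open>\<delta> > 0\<close> by (intro order_tendstoD(2)) auto
  then obtain k where k: "(LINT x|lborel. (norm (f x - F k x))\<^sup>2) < \<delta> / 4"
    by (meson eventually_happens' sequentially_bot)
  have Fi: "integrable lborel (\<lambda>x. (norm (f x - F k x))\<^sup>2)"
    by (rule Bochner_Integration.integrable_bound[where f="\<lambda>x. 4 * (norm (f x))\<^sup>2"]) (use f2 sq2[of _ k] in auto)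
  define h where "h n x = \<eta> k x *\<^sub>R c k (G n x)" for n x
  have h_cont: "continuous_on UNIV (h n)" for n
    unfolding h_def using G[of n] by (intro continuous_intros \<eta>_cont continuous_on_compose2[OF c_cont]) auto
  have [measurable]: "h n \<in> borel_measurable borel" for n
    by (rule borel_measurable_continuous_onI[OF h_cont])
  have h0: "h n x = 0" if "norm x > real k + 1" for n x
    using that by (simp add: h_def \<eta>_def)
  have F0: "F k x = 0" if "norm x > real k + 1" for x
    using that by (simp add: F_def \<eta>_def)
  have bd: "norm (\<eta> k x *\<^sub>R c k z) \<le> real k" for x z
    using mult_mono[OF \<eta>_bd(2)[of k x] c_mem[of k z]] \<eta>_bd[of k x] by simp
  have hF: "norm ((norm (F k x - h n x))\<^sup>2) \<le> (2 * real k)\<^sup>2 * indicator (cball 0 (real k + 1)) x" for n x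
  proof (cases "x \<in> cball 0 (real k + 1)")
    case True
    have "norm (F k x - h n x) \<le> real k + real k"
      unfolding F_def h_def by (intro norm_triangle_le_diff add_mono bd)
    from power_mono[OF this norm_ge_zero, of 2] show ?thesis using True by simp
  next
    case False then show ?thesis by (auto simp: F0 h0)
  qed
  have wi: "integrable lborel (\<lambda>x::'a. (2 * real k)\<^sup>2 * indicator (cball 0 (real k + 1)) x)"
    by (intro integrable_mult_right integrable_real_indicator) (auto simp: emeasure_lborel_cball_finite[unfolded infinity_ennreal_def])
  have hi: "integrable lborel (\<lambda>x. (norm (F k x - h n x))\<^sup>2)" for n
    by (rule Bochner_Integration.integrable_bound[OF wi]) (use hF[of _ n] in \<open>auto simp: abs_mult\<close>)
  have "(\<lambda>n. LINT x|lborel. (norm (F k x - h n x))\<^sup>2) \<longlonglongrightarrow> (LINT x|(lborel::'a measure). 0)"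
  proof (rule integral_dominated_convergence[where w="\<lambda>x. (2 * real k)\<^sup>2 * indicator (cball 0 (real k + 1)) x"])
    show "AE x in lborel. (\<lambda>n. (norm (F k x - h n x))\<^sup>2) \<longlonglongrightarrow> 0"
      using AEN
    proof eventually_elim
      case (elim x)
      have "(\<lambda>n. c k (G n x)) \<longlonglongrightarrow> c k (f x)"
        by (rule continuous_on_tendsto_compose[OF c_cont[of UNIV k] lim[OF elim]]) auto
      then have "(\<lambda>n. h n x) \<longlonglongrightarrow> F k x"
        unfolding h_def F_def by (intro tendsto_intros)
      from tendsto_power[OF tendsto_norm[OF tendsto_diff[OF tendsto_const[of "F k x"] this]], of 2]
      show ?case by simp
    qed
  qed (use wi hF in auto)
  then have "\<forall>\<^sub>F n in sequentially. (LINT x|lborel. (norm (F k x - h n x))\<^sup>2) < \<delta> / 4"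
    using \<open>\<delta> > 0\<close> by (intro order_tendstoD(2)) auto
  then obtain n where n: "(LINT x|lborel. (norm (F k x - h n x))\<^sup>2) < \<delta> / 4"
    by (meson eventually_happens' sequentially_bot)
  have le: "(norm (f x - h n x))\<^sup>2 \<le> 2 * (norm (f x - F k x))\<^sup>2 + 2 * (norm (F k x - h n x))\<^sup>2" for x
    using norm_triangle_sq2[of "f x - F k x" "F k x - h n x"] by simp
  have si: "integrable lborel (\<lambda>x. 2 * (norm (f x - F k x))\<^sup>2 + 2 * (norm (F k x - h n x))\<^sup>2)"
    using Fi hi by auto
  have ii: "integrable lborel (\<lambda>x. (norm (f x - h n x))\<^sup>2)"
    by (rule Bochner_Integration.integrable_bound[OF si]) (use le in auto)
  have "(LINT x|lborel. (norm (f x - h n x))\<^sup>2) \<le> (LINT x|lborel. 2 * (norm (f x - F k x))\<^sup>2 + 2 * (norm (F k x - h n x))\<^sup>2)"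
    by (rule integral_mono[OF ii si le])
  also have "\<dots> < \<delta>" using k n Fi hi by simp
  finally show ?thesis using that[OF h_cont h0 ii] by blast
qed

lemma L2_translation_continuous:
  fixes f :: "'a::euclidean_space \<Rightarrow> complex"
  assumes [measurable]: "f \<in> borel_measurable borel" and f2: "integrable lborel (\<lambda>x. (norm (f x))\<^sup>2)"
    and v: "v \<longlonglongrightarrow> 0"
  shows "(\<lambda>n. LINT x|lborel. (norm (f (x + v n) - f x))\<^sup>2) \<longlonglongrightarrow> 0"
proof (rule LIMSEQ_I, goal_cases)
  case (1 \<delta>)
  then obtain g r where g: "continuous_on UNIV g" and g0: "\<And>x. norm x > r \<Longrightarrow> g x = 0"
     and gi: "integrable lborel (\<lambda>x. (norm (f x - g x))\<^sup>2)"
     and gl: "(LINT x|lborel. (norm (f x - g x))\<^sup>2) < \<delta> / 16"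
    using L2_approx_continuous[OF assms(1,2), of "\<delta> / 16"] by auto
  have [measurable]: "g \<in> borel_measurable borel" by (rule borel_measurable_continuous_onI[OF g])
  obtain B where B: "\<And>x. norm (g x) \<le> B"
  proof -
    have "bounded (g ` cball 0 r)"
      by (intro compact_imp_bounded compact_continuous_image) (auto intro: continuous_on_subset[OF g])
    then obtain B where "\<forall>z\<in>g ` cball 0 r. norm z \<le> B" unfolding bounded_iff by blast
    then have "\<And>x. norm x \<le> r \<Longrightarrow> norm (g x) \<le> B" by auto
    then have "norm (g x) \<le> max B 0" for x using g0[of x] by (cases "norm x > r") (fastforce simp: le_max_iff_disj)+
    then show ?thesis by (rule that)
  qed
  have gb: "norm ((norm (g (x + w) - g x))\<^sup>2) \<le> (2 * B)\<^sup>2 * indicator (cball 0 (r + 1)) x" if "norm w \<le> 1" for x w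
  proof (cases "x \<in> cball 0 (r + 1)")
    case True
    have "norm (g (x + w) - g x) \<le> B + B" by (intro norm_triangle_le_diff add_mono B)
    from power_mono[OF this norm_ge_zero, of 2] show ?thesis using True by simp
  next
    case False
    then have "norm x > r" "norm (x + w) > r" using that norm_triangle_ineq4[of "x + w" w] by auto
    then show ?thesis by (auto simp: g0)
  qed
  have wi: "integrable lborel (\<lambda>x::'a. (2 * B)\<^sup>2 * indicator (cball 0 (r + 1)) x)"
    by (intro integrable_mult_right integrable_real_indicator) (auto simp: emeasure_lborel_cball_finite[unfolded infinity_ennreal_def])
  have gd: "integrable lborel (\<lambda>x. (norm (g (x + w) - g x))\<^sup>2)" if "norm w \<le> 1" for w
    by (rule Bochner_Integration.integrable_bound[OF wi]) (use gb[OF that] in \<open>auto simp: abs_mult\<close>)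
  obtain n0 where n0: "\<And>n. n \<ge> n0 \<Longrightarrow> norm (v n) \<le> 1"
    using LIMSEQ_D[OF v, of 1] by (auto intro: less_imp_le)
  have "(\<lambda>n. LINT x|lborel. (norm (g (x + v (n + n0)) - g x))\<^sup>2) \<longlonglongrightarrow> (LINT x|(lborel::'a measure). 0)"
  proof (rule integral_dominated_convergence[where w="\<lambda>x. (2 * B)\<^sup>2 * indicator (cball 0 (r + 1)) x"])
    show "AE x in lborel. (\<lambda>n. (norm (g (x + v (n + n0)) - g x))\<^sup>2) \<longlonglongrightarrow> 0"
    proof (rule AE_I2)
      fix x
      have "(\<lambda>n. x + v (n + n0)) \<longlonglongrightarrow> x + 0"
        by (intro tendsto_intros LIMSEQ_ignore_initial_segment v)
      then have "(\<lambda>n. g (x + v (n + n0))) \<longlonglongrightarrow> g x"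
        using continuous_on_tendsto_compose[OF g, of "\<lambda>n. x + v (n + n0)" x] by simp
      from tendsto_power[OF tendsto_norm[OF tendsto_diff[OF this tendsto_const[of "g x"]]], of 2]
      show "(\<lambda>n. (norm (g (x + v (n + n0)) - g x))\<^sup>2) \<longlonglongrightarrow> 0" by simp
    qed
  qed (use wi gb n0 in auto)
  then have "\<forall>\<^sub>F n in sequentially. (LINT x|lborel. (norm (g (x + v (n + n0)) - g x))\<^sup>2) < \<delta> / 16"
    using 1 by (intro order_tendstoD(2)) auto
  then obtain n1 where n1: "\<And>n. n \<ge> n1 \<Longrightarrow> (LINT x|lborel. (norm (g (x + v (n + n0)) - g x))\<^sup>2) < \<delta> / 16"
    by (auto simp: eventually_sequentially)
  show ?case
  proof (intro exI allI impI)
    fix n assume n: "n \<ge> n0 + n1"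
    let ?w = "v n"
    have w: "norm ?w \<le> 1" using n n0 by auto
    have gs: "(LINT x|lborel. (norm (g (x + ?w) - g x))\<^sup>2) < \<delta> / 16"
      using n1[of "n - n0"] n by auto
    have fgs: "integrable lborel (\<lambda>x. (norm (f (x + ?w) - g (x + ?w)))\<^sup>2)"
      "(LINT x|lborel. (norm (f (x + ?w) - g (x + ?w)))\<^sup>2) = (LINT x|lborel. (norm (f x - g x))\<^sup>2)"
      using gi integrable_shift_iff[of "\<lambda>x. (norm (f x - g x))\<^sup>2" ?w] integral_shift[of "\<lambda>x. (norm (f x - g x))\<^sup>2" ?w] by auto
    \<comment> \<open>Squaring the three-term triangle inequality costs a factor of at most 4 per
      term; this is why each approximation was made within \<delta>/16.\<close>
    let ?S = "\<lambda>x. 4 * (norm (f (x + ?w) - g (x + ?w)))\<^sup>2 + 4 * (norm (g (x + ?w) - g x))\<^sup>2 + 4 * (norm (f x - g x))\<^sup>2"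
    have le: "(norm (f (x + ?w) - f x))\<^sup>2 \<le> ?S x" for x
    proof -
      have "(norm (f (x + ?w) - f x))\<^sup>2 \<le> 2 * (norm (f (x + ?w) - g (x + ?w)))\<^sup>2 + 2 * (norm (g (x + ?w) - f x))\<^sup>2"
        using norm_triangle_sq2[of "f (x + ?w) - g (x + ?w)" "g (x + ?w) - f x"] by simp
      moreover have "(norm (g (x + ?w) - f x))\<^sup>2 \<le> 2 * (norm (g (x + ?w) - g x))\<^sup>2 + 2 * (norm (f x - g x))\<^sup>2"
        using norm_triangle_sq2[of "g (x + ?w) - g x" "g x - f x"] by (simp add: norm_minus_commute)
      ultimately show ?thesis using zero_le_power2[of "norm (f (x + ?w) - g (x + ?w))"] by linarith
    qed
    have si: "integrable lborel ?S" using fgs(1) gd[OF w] gi by auto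
    have ii: "integrable lborel (\<lambda>x. (norm (f (x + ?w) - f x))\<^sup>2)"
      by (rule Bochner_Integration.integrable_bound[OF si]) (use le in auto)
    have "(LINT x|lborel. (norm (f (x + ?w) - f x))\<^sup>2) \<le> integral\<^sup>L lborel ?S"
      by (rule integral_mono[OF ii si le])
    also have "\<dots> < \<delta>" using fgs gd[OF w] gi gl gs 1 by simp
    finally show "norm ((LINT x|lborel. (norm (f (x + ?w) - f x))\<^sup>2) - 0) < \<delta>" by simp
  qed
qed

section \<open>The unnormalised scalar transform and its Plancherel identity\<close>

definition ft :: "('a::euclidean_space \<Rightarrow> complex) \<Rightarrow> 'a \<Rightarrow> complex" where
  "ft f p = (LINT x|lborel. phase p x * f x)"

lemma norm_exp_imag [simp]: "norm (exp (- (\<i> * complex_of_real x))) = 1" "norm (exp (\<i> * complex_of_real x)) = 1"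
  by (simp_all add: norm_exp_eq_Re)

lemma borel_measurable_cnj [measurable (raw)]:
  "f \<in> borel_measurable M \<Longrightarrow> (\<lambda>x. cnj (f x)) \<in> borel_measurable M"
  by (rule borel_measurable_continuous_on[OF continuous_on_cnj]) (auto intro: continuous_on_id)

lemma ft_measurable [measurable]:
  assumes [measurable]: "f \<in> borel_measurable borel"
  shows "ft f \<in> borel_measurable borel"
proof -
  have "(\<lambda>p. LINT x|lborel. phase p x * f x) \<in> borel_measurable borel"
    by measurable
  then show ?thesis unfolding ft_def[abs_def] .
qed

text \<open>The substitution y = x + \<epsilon>u, whose Jacobian cancels the powers of \<epsilon> in
  the prefactor. Afterwards \<epsilon> occurs only in the argument of f, where it can tend to
  0.\<close>

lemma integral_gaussian_scale:
  fixes f :: "'a::euclidean_space \<Rightarrow> complex"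
  assumes [measurable]: "f \<in> borel_measurable borel" and "\<epsilon> > 0"
  shows "(LINT y|lborel. f y * complex_of_real ((sqrt (2 * pi) / \<epsilon>) ^ DIM('a) * exp (- (norm (x - y) / \<epsilon>)\<^sup>2 / 2)))
    = complex_of_real ((sqrt (2 * pi)) ^ DIM('a)) * (LINT u|lborel. f (x + \<epsilon> *\<^sub>R u) * complex_of_real (exp (- (norm u)\<^sup>2 / 2)))"
proof -
  define F where "F y = f y * complex_of_real ((sqrt (2 * pi) / \<epsilon>) ^ DIM('a) * exp (- (norm (x - y) / \<epsilon>)\<^sup>2 / 2))" for y
  have [measurable]: "F \<in> borel_measurable borel" unfolding F_def by measurable
  have "integral\<^sup>L lborel F = (LINT u|lborel. (\<epsilon> ^ DIM('a)) *\<^sub>R F (x + \<epsilon> *\<^sub>R u))"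
    using \<open>\<epsilon> > 0\<close>
    by (subst lborel_affine[of \<epsilon> x], simp, subst integral_density) (auto simp: integral_distr)
  also have "\<dots> = (LINT u|lborel. complex_of_real ((sqrt (2 * pi)) ^ DIM('a)) * (f (x + \<epsilon> *\<^sub>R u) * complex_of_real (exp (- (norm u)\<^sup>2 / 2))))"
    using \<open>\<epsilon> > 0\<close> by (intro Bochner_Integration.integral_cong refl) (simp add: F_def scaleR_conv_of_real power_divide field_simps)
  finally show ?thesis unfolding F_def by simp
qed

lemma ft_gaussian_weight:
  fixes f :: "'a::euclidean_space \<Rightarrow> complex"
  assumes f: "integrable lborel f" and f2: "integrable lborel (\<lambda>x. (norm (f x))\<^sup>2)" and "\<epsilon> > 0"
  shows "complex_of_real (LINT p|lborel. exp (- (\<epsilon> * norm p)\<^sup>2 / 2) * (norm (ft f p))\<^sup>2)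
     = complex_of_real ((sqrt (2 * pi)) ^ DIM('a)) *
        (LINT u|lborel. complex_of_real (exp (- (norm u)\<^sup>2 / 2)) * (LINT x|lborel. f x * cnj (f (x + \<epsilon> *\<^sub>R u))))"
proof -
  have [measurable]: "f \<in> borel_measurable borel" using f by auto
  let ?P = "lborel \<Otimes>\<^sub>M lborel :: ('a \<times> 'a) measure"
  interpret P: pair_sigma_finite "lborel :: 'a measure" ?P ..
  let ?\<gamma> = "\<lambda>p::'a. exp (- (\<epsilon> * norm p)\<^sup>2 / 2)"
  have gi: "integrable lborel ?\<gamma>"
    using gaussian_fourier(1)[OF \<open>\<epsilon> > 0\<close>, of "0::'a"] by (simp add: complex_of_real_integrable_eq)
  define k where "k = (\<lambda>(x, y). f x * cnj (f y))"
  have ki: "integrable ?P k"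
  proof (rule lborel_pair.Fubini_integrable)
    show "k \<in> borel_measurable ?P" unfolding k_def by measurable
  qed (use f in \<open>auto simp: norm_mult k_def\<close>)
  \<comment> \<open>The squared modulus becomes one integral over pairs (x, y) in which p enters
    only through x - y, so the weighted integral over p can be evaluated in closed form.\<close>
  have e0: "complex_of_real ((norm (ft f p))\<^sup>2) = (LINT w|?P. exp (- (\<i> * complex_of_real (p \<bullet> (fst w - snd w)))) * k w)" for p
  proof -
    have "complex_of_real ((norm (ft f p))\<^sup>2) = ft f p * cnj (ft f p)"
      by (simp only: complex_norm_square)
    also have "cnj (ft f p) = (LINT y|lborel. exp (\<i> * complex_of_real (p \<bullet> y)) * cnj (f y))"
      unfolding ft_def by (subst Bochner_Integration.integral_cnj[symmetric]) (simp add: exp_cnj)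
    also have "ft f p * \<dots> = (LINT x|lborel. phase p x * f x * (LINT y|lborel. exp (\<i> * complex_of_real (p \<bullet> y)) * cnj (f y)))"
      unfolding ft_def by simp
    also have "\<dots> = (LINT x|lborel. LINT y|lborel. exp (- (\<i> * complex_of_real (p \<bullet> (fst (x,y) - snd (x,y))))) * k (x, y))"
      by (intro Bochner_Integration.integral_cong refl, subst integral_mult_right_zero[symmetric],
          intro Bochner_Integration.integral_cong refl)
         (simp add: k_def inner_diff_right algebra_simps exp_diff exp_minus field_simps)
    also have "\<dots> = (LINT w|?P. exp (- (\<i> * complex_of_real (p \<bullet> (fst w - snd w)))) * k w)"
      by (rule lborel_pair.integral_fst', rule Bochner_Integration.integrable_bound[OF ki]) (auto simp: norm_mult k_def)
    finally show ?thesis .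
  qed
  have tri: "integrable (lborel \<Otimes>\<^sub>M ?P) (\<lambda>(p, w). complex_of_real (?\<gamma> p) * (exp (- (\<i> * complex_of_real (p \<bullet> (fst w - snd w)))) * k w))"
    (is "integrable _ ?T")
  proof (rule P.Fubini_integrable)
    show "?T \<in> borel_measurable (lborel \<Otimes>\<^sub>M ?P)" unfolding k_def by measurable
    show "integrable lborel (\<lambda>p. LINT w|?P. norm (?T (p, w)))"
      using gi by (simp add: norm_mult)
    show "AE p in lborel. integrable ?P (\<lambda>w. ?T (p, w))"
    proof (rule AE_I2)
      fix p :: 'a
      have "integrable ?P (\<lambda>w. exp (- (\<i> * complex_of_real (p \<bullet> (fst w - snd w)))) * k w)"
        by (rule Bochner_Integration.integrable_bound[OF ki]) (auto simp: norm_mult k_def)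
      then show "integrable ?P (\<lambda>w. ?T (p, w))" by simp
    qed
  qed
  have "complex_of_real (LINT p|lborel. ?\<gamma> p * (norm (ft f p))\<^sup>2) = (LINT p|lborel. complex_of_real (?\<gamma> p) * complex_of_real ((norm (ft f p))\<^sup>2))"
    by (simp add: integral_complex_of_real[symmetric] del: integral_complex_of_real)
  also have "\<dots> = (LINT p|lborel. LINT w|?P. ?T (p, w))"
    unfolding e0 by simp
  also have "\<dots> = (LINT w|?P. LINT p|lborel. ?T (p, w))"
    using P.Fubini_integral[of "\<lambda>p w. ?T (p, w)"] tri by simp
  also have "\<dots> = (LINT w|?P. k w * complex_of_real ((sqrt (2 * pi) / \<epsilon>) ^ DIM('a) * exp (- (norm (fst w - snd w) / \<epsilon>)\<^sup>2 / 2)))"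
    by (intro Bochner_Integration.integral_cong refl, subst gaussian_fourier(2)[OF \<open>\<epsilon> > 0\<close>, symmetric],
        subst integral_mult_right_zero[symmetric], intro Bochner_Integration.integral_cong refl) (simp add: ac_simps)
  also have "\<dots> = (LINT x|lborel. LINT y|lborel. k (x, y) * complex_of_real ((sqrt (2 * pi) / \<epsilon>) ^ DIM('a) * exp (- (norm (fst (x, y) - snd (x, y)) / \<epsilon>)\<^sup>2 / 2)))"
  proof (rule lborel_pair.integral_fst'[symmetric], rule Bochner_Integration.integrable_bound)
    show "integrable ?P (\<lambda>w. complex_of_real ((sqrt (2 * pi) / \<epsilon>) ^ DIM('a)) * k w)" using ki by simp
    show "AE x in ?P. norm (k x * complex_of_real ((sqrt (2 * pi) / \<epsilon>) ^ DIM('a) * exp (- (norm (fst x - snd x) / \<epsilon>)\<^sup>2 / 2)))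
         \<le> norm (complex_of_real ((sqrt (2 * pi) / \<epsilon>) ^ DIM('a)) * k x)"
    proof (rule AE_I2)
      fix x :: "'a \<times> 'a"
      have "exp (- (norm (fst x - snd x) / \<epsilon>)\<^sup>2 / 2) \<le> 1" by simp
      moreover have "\<bar>(sqrt (2 * pi) / \<epsilon>) ^ DIM('a)\<bar> * norm (k x) \<ge> 0" by simp
      ultimately show "norm (k x * complex_of_real ((sqrt (2 * pi) / \<epsilon>) ^ DIM('a) * exp (- (norm (fst x - snd x) / \<epsilon>)\<^sup>2 / 2)))
         \<le> norm (complex_of_real ((sqrt (2 * pi) / \<epsilon>) ^ DIM('a)) * k x)"
        unfolding norm_mult norm_of_real abs_mult abs_exp_cancel
        by (smt (verit) mult.commute mult.left_commute mult_left_le)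
    qed
  qed (simp add: k_def)
  also have "\<dots> = (LINT x|lborel. f x * (complex_of_real ((sqrt (2 * pi)) ^ DIM('a)) * (LINT u|lborel. cnj (f (x + \<epsilon> *\<^sub>R u)) * complex_of_real (exp (- (norm u)\<^sup>2 / 2)))))"
    by (intro Bochner_Integration.integral_cong refl, subst integral_gaussian_scale[OF _ \<open>\<epsilon> > 0\<close>, symmetric])
       (auto simp: k_def mult.assoc)
  also have "\<dots> = complex_of_real ((sqrt (2 * pi)) ^ DIM('a)) * (LINT x|lborel. LINT u|lborel. f x * (cnj (f (x + \<epsilon> *\<^sub>R u)) * complex_of_real (exp (- (norm u)\<^sup>2 / 2))))"
    by (subst mult.left_commute, subst integral_mult_right_zero) simp
  also have "(LINT x|lborel. LINT u|lborel. f x * (cnj (f (x + \<epsilon> *\<^sub>R u)) * complex_of_real (exp (- (norm u)\<^sup>2 / 2))))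
     = (LINT u|lborel. LINT x|lborel. f x * (cnj (f (x + \<epsilon> *\<^sub>R u)) * complex_of_real (exp (- (norm u)\<^sup>2 / 2))))"
  proof (rule lborel_pair.Fubini_integral)
    let ?\<gamma>1 = "\<lambda>u::'a. exp (- (norm u)\<^sup>2 / 2)"
    have g1: "integrable lborel ?\<gamma>1"
      using gaussian_fourier(1)[OF zero_less_one, of "0::'a"] by (simp add: complex_of_real_integrable_eq)
    \<comment> \<open>The product of two values of f is bounded by the sum of their squares, whose
      integrals over x do not depend on u by translation invariance; the Gaussian in u then makes
      the double integral finite.\<close>
    have sw: "integrable ?P (\<lambda>(u, x). f x * (cnj (f (x + \<epsilon> *\<^sub>R u)) * complex_of_real (?\<gamma>1 u)))"
    proof (rule lborel_pair.Fubini_integrable)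
      have b: "norm (f x * (cnj (f (x + \<epsilon> *\<^sub>R u)) * complex_of_real (?\<gamma>1 u))) \<le> ?\<gamma>1 u * ((norm (f x))\<^sup>2 + (norm (f (x + \<epsilon> *\<^sub>R u)))\<^sup>2)" for x u
      proof -
        have "norm (f x) * norm (f (x + \<epsilon> *\<^sub>R u)) \<le> (norm (f x))\<^sup>2 + (norm (f (x + \<epsilon> *\<^sub>R u)))\<^sup>2"
          using sum_squares_bound[of "norm (f x)" "norm (f (x + \<epsilon> *\<^sub>R u))"]
            mult_nonneg_nonneg[OF norm_ge_zero[of "f x"] norm_ge_zero[of "f (x + \<epsilon> *\<^sub>R u)"]] by linarith
        from mult_left_mono[OF this, of "?\<gamma>1 u"] show ?thesis by (simp add: norm_mult ac_simps)
      qed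
      have s1: "integrable lborel (\<lambda>x. (norm (f (x + v)))\<^sup>2)" "(LINT x|lborel. (norm (f (x + v)))\<^sup>2) = (LINT x|lborel. (norm (f x))\<^sup>2)" for v
        using f2 integrable_shift_iff[of "\<lambda>x. (norm (f x))\<^sup>2" v] integral_shift[of "\<lambda>x. (norm (f x))\<^sup>2" v] by auto
      have s2: "integrable lborel (\<lambda>x. ?\<gamma>1 u * ((norm (f x))\<^sup>2 + (norm (f (x + \<epsilon> *\<^sub>R u)))\<^sup>2))" for u
        using f2 s1(1) by auto
      have i1: "integrable lborel (\<lambda>x. f x * (cnj (f (x + \<epsilon> *\<^sub>R u)) * complex_of_real (?\<gamma>1 u)))" for u
        by (rule Bochner_Integration.integrable_bound[OF s2[of u]]) (use b in \<open>auto intro!: AE_I2 order_trans[OF _ abs_ge_self]\<close>)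
      show "AE u in lborel. integrable lborel (\<lambda>x. (case (u, x) of (u, x) \<Rightarrow> f x * (cnj (f (x + \<epsilon> *\<^sub>R u)) * complex_of_real (?\<gamma>1 u))))"
        using i1 by simp
      show "integrable lborel (\<lambda>u. LINT x|lborel. norm (case (u, x) of (u, x) \<Rightarrow> f x * (cnj (f (x + \<epsilon> *\<^sub>R u)) * complex_of_real (?\<gamma>1 u))))"
      proof (rule Bochner_Integration.integrable_bound)
        show "integrable lborel (\<lambda>u. ?\<gamma>1 u * (2 * (LINT x|lborel. (norm (f x))\<^sup>2)))" using g1 by simp
        show "AE u in lborel. norm (LINT x|lborel. norm (case (u, x) of (u, x) \<Rightarrow> f x * (cnj (f (x + \<epsilon> *\<^sub>R u)) * complex_of_real (?\<gamma>1 u))))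
           \<le> norm (?\<gamma>1 u * (2 * (LINT x|lborel. (norm (f x))\<^sup>2)))"
        proof (rule AE_I2)
          fix u :: 'a
          have "(LINT x|lborel. norm (f x * (cnj (f (x + \<epsilon> *\<^sub>R u)) * complex_of_real (?\<gamma>1 u)))) \<le> (LINT x|lborel. ?\<gamma>1 u * ((norm (f x))\<^sup>2 + (norm (f (x + \<epsilon> *\<^sub>R u)))\<^sup>2))"
            by (intro integral_mono b s2 integrable_norm i1)
          also have "\<dots> = ?\<gamma>1 u * (2 * (LINT x|lborel. (norm (f x))\<^sup>2))"
            using f2 s1 by simp
          finally show "norm (LINT x|lborel. norm (case (u, x) of (u, x) \<Rightarrow> f x * (cnj (f (x + \<epsilon> *\<^sub>R u)) * complex_of_real (?\<gamma>1 u))))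
           \<le> norm (?\<gamma>1 u * (2 * (LINT x|lborel. (norm (f x))\<^sup>2)))"
            by simp
        qed
      qed measurable
    qed measurable
    then show "integrable ?P (\<lambda>(u, x). f x * (cnj (f (x + \<epsilon> *\<^sub>R u)) * complex_of_real (?\<gamma>1 u)))" .
  qed
  also have "(LINT u|lborel. LINT x|lborel. f x * (cnj (f (x + \<epsilon> *\<^sub>R u)) * complex_of_real (exp (- (norm u)\<^sup>2 / 2))))
     = (LINT u|lborel. complex_of_real (exp (- (norm u)\<^sup>2 / 2)) * (LINT x|lborel. f x * cnj (f (x + \<epsilon> *\<^sub>R u))))"
    by (intro Bochner_Integration.integral_cong refl, subst integral_mult_right_zero[symmetric],
        intro Bochner_Integration.integral_cong refl) (simp add: ac_simps)
  finally show ?thesis .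
qed

text \<open>The Gaussian weight makes the triple integral absolutely convergent and turns the energy in momentum
  space into a Gaussian mean of the autocorrelation of \<open>f\<close>, which is continuous at \<open>0\<close>.\<close>

theorem plancherel:
  fixes f :: "'a::euclidean_space \<Rightarrow> complex"
  assumes f: "integrable lborel f" and f2: "integrable lborel (\<lambda>x. (norm (f x))\<^sup>2)"
  shows "L2_square (\<lambda>p. ft f p) = ennreal ((2 * pi) ^ DIM('a)) * L2_square (\<lambda>x. f x)"
proof -
  have [measurable]: "f \<in> borel_measurable borel" using f by auto
  define I where "I = (LINT x|lborel. (norm (f x))\<^sup>2)"
  define R where "R v = (LINT x|lborel. f x * cnj (f (x + v)))" for v
  define \<epsilon> where "\<epsilon> n = inverse (real (Suc n))" for n
  have \<epsilon>: "\<epsilon> n > 0" for n by (simp add: \<epsilon>_def)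
  have \<epsilon>lim: "\<epsilon> \<longlonglongrightarrow> 0" unfolding \<epsilon>_def by (rule LIMSEQ_inverse_real_of_nat)
  have s1: "integrable lborel (\<lambda>x. (norm (f (x + v)))\<^sup>2)" "(LINT x|lborel. (norm (f (x + v)))\<^sup>2) = I" for v
    using f2 integrable_shift_iff[of "\<lambda>x. (norm (f x))\<^sup>2" v] integral_shift[of "\<lambda>x. (norm (f x))\<^sup>2" v] by (auto simp: I_def)
  have pr: "norm (f x * cnj (f (x + v))) \<le> ((norm (f x))\<^sup>2 + (norm (f (x + v)))\<^sup>2) / 2" for x v
    using sum_squares_bound[of "norm (f x)" "norm (f (x + v))"] by (simp add: norm_mult)
  have s2: "integrable lborel (\<lambda>x. ((norm (f x))\<^sup>2 + (norm (f (x + v)))\<^sup>2) / 2)" for v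
    using f2 s1(1) by auto
  have s3: "integrable lborel (\<lambda>x. f x * cnj (f (x + v)))" for v
    by (rule Bochner_Integration.integrable_bound[OF s2[of v]], measurable) (use pr in \<open>auto intro!: AE_I2 order_trans[OF _ abs_ge_self]\<close>)
  have Rb: "norm (R v) \<le> I" for v
  proof -
    have "norm (R v) \<le> (LINT x|lborel. norm (f x * cnj (f (x + v))))" unfolding R_def by (rule integral_norm_bound)
    also have "\<dots> \<le> (LINT x|lborel. ((norm (f x))\<^sup>2 + (norm (f (x + v)))\<^sup>2) / 2)"
      by (intro integral_mono integrable_norm s2 s3 pr)
    also have "\<dots> = I" using f2 s1[of v] by (simp add: I_def)
    finally show ?thesis .
  qed
  \<comment> \<open>Expanding the square: the real part of the autocorrelation falls short of the
    energy by half the squared distance of f to its translate. Continuity of \<open>R\<close> at 0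
    is thus continuity of translation in L^2.\<close>
  have ReR: "Re (R v) = I - (LINT x|lborel. (norm (f (x + v) - f x))\<^sup>2) / 2" for v
  proof -
    have e: "(norm (f (x + v) - f x))\<^sup>2 = (norm (f x))\<^sup>2 + (norm (f (x + v)))\<^sup>2 - 2 * Re (f x * cnj (f (x + v)))" for x
      unfolding cmod_power2 by (simp add: power2_eq_square algebra_simps)
    define c where "c x = Re (f x * cnj (f (x + v)))" for x
    have c: "integrable lborel c" "integral\<^sup>L lborel c = Re (R v)"
      unfolding c_def R_def by (rule integrable_Re[OF s3], rule integral_Re[OF s3])
    have "(LINT x|lborel. (norm (f (x + v) - f x))\<^sup>2) = I + I - 2 * Re (R v)"
      unfolding e c_def[symmetric] using f2 s1[of v] c by (simp add: I_def)
    then show ?thesis by linarith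
  qed
  have [measurable]: "R \<in> borel_measurable borel"
  proof -
    have "(\<lambda>v. LINT x|lborel. f x * cnj (f (x + v))) \<in> borel_measurable borel" by measurable
    then show ?thesis unfolding R_def[abs_def] .
  qed
  let ?\<gamma> = "\<lambda>u::'a. exp (- (norm u)\<^sup>2 / 2)"
  have g1: "integrable lborel ?\<gamma>" and g2: "(LINT u|lborel. ?\<gamma> u) = (sqrt (2 * pi)) ^ DIM('a)"
  proof -
    show "integrable lborel ?\<gamma>"
      using gaussian_fourier(1)[OF zero_less_one, of "0::'a"] by (simp add: complex_of_real_integrable_eq)
    have "complex_of_real (LINT u|lborel. ?\<gamma> u) = complex_of_real ((sqrt (2 * pi)) ^ DIM('a))"
      using gaussian_fourier(2)[OF zero_less_one, of "0::'a"] by simp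
    then show "(LINT u|lborel. ?\<gamma> u) = (sqrt (2 * pi)) ^ DIM('a)" using of_real_eq_iff by blast
  qed
  define J where "J n = (LINT p|lborel. exp (- (\<epsilon> n * norm p)\<^sup>2 / 2) * (norm (ft f p))\<^sup>2)" for n
  have Ri: "integrable lborel (\<lambda>u. complex_of_real (?\<gamma> u) * R (\<epsilon> n *\<^sub>R u))" for n
  proof (rule Bochner_Integration.integrable_bound)
    show "integrable lborel (\<lambda>u. ?\<gamma> u * I)" using g1 by simp
    show "AE u in lborel. norm (complex_of_real (?\<gamma> u) * R (\<epsilon> n *\<^sub>R u)) \<le> norm (?\<gamma> u * I)"
      using Rb by (auto intro!: AE_I2 mult_left_mono order_trans[OF _ abs_ge_self] simp: norm_mult)
  qed measurable
  have J: "J n = (sqrt (2 * pi)) ^ DIM('a) * (LINT u|lborel. ?\<gamma> u * Re (R (\<epsilon> n *\<^sub>R u)))" for n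
  proof -
    have "J n = Re (complex_of_real (J n))" by simp
    also have "complex_of_real (J n) = complex_of_real ((sqrt (2 * pi)) ^ DIM('a)) * (LINT u|lborel. complex_of_real (?\<gamma> u) * R (\<epsilon> n *\<^sub>R u))"
      unfolding J_def R_def by (rule ft_gaussian_weight[OF f f2 \<epsilon>])
    also have "Re \<dots> = (sqrt (2 * pi)) ^ DIM('a) * Re (LINT u|lborel. complex_of_real (?\<gamma> u) * R (\<epsilon> n *\<^sub>R u))"
      by simp
    also have "Re (LINT u|lborel. complex_of_real (?\<gamma> u) * R (\<epsilon> n *\<^sub>R u)) = (LINT u|lborel. ?\<gamma> u * Re (R (\<epsilon> n *\<^sub>R u)))"
      by (subst integral_Re[OF Ri, symmetric]) simp
    finally show ?thesis .
  qed
  have "(\<lambda>n. LINT u|lborel. ?\<gamma> u * Re (R (\<epsilon> n *\<^sub>R u))) \<longlonglongrightarrow> (LINT u|lborel. ?\<gamma> u * I)"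
  proof (rule integral_dominated_convergence[where w="\<lambda>u. ?\<gamma> u * I"])
    show "AE u in lborel. (\<lambda>n. ?\<gamma> u * Re (R (\<epsilon> n *\<^sub>R u))) \<longlonglongrightarrow> ?\<gamma> u * I"
    proof (rule AE_I2)
      fix u :: 'a
      have "(\<lambda>n. \<epsilon> n *\<^sub>R u) \<longlonglongrightarrow> 0" using tendsto_scaleR[OF \<epsilon>lim tendsto_const[of u]] by simp
      then have "(\<lambda>n. LINT x|lborel. (norm (f (x + \<epsilon> n *\<^sub>R u) - f x))\<^sup>2) \<longlonglongrightarrow> 0"
        by (rule L2_translation_continuous[OF _ f2, rotated]) simp
      then have "(\<lambda>n. ?\<gamma> u * (I - (LINT x|lborel. (norm (f (x + \<epsilon> n *\<^sub>R u) - f x))\<^sup>2) / 2)) \<longlonglongrightarrow> ?\<gamma> u * (I - 0 / 2)"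
        by (intro tendsto_intros) auto
      then show "(\<lambda>n. ?\<gamma> u * Re (R (\<epsilon> n *\<^sub>R u))) \<longlonglongrightarrow> ?\<gamma> u * I" unfolding ReR by simp
    qed
    show "AE u in lborel. norm (?\<gamma> u * Re (R (\<epsilon> n *\<^sub>R u))) \<le> ?\<gamma> u * I" for n
      using Rb by (auto intro!: AE_I2 mult_left_mono order_trans[OF abs_Re_le_cmod] simp: abs_mult)
  qed (use g1 in auto)
  then have Jlim: "J \<longlonglongrightarrow> (sqrt (2 * pi)) ^ DIM('a) * (LINT u|lborel. ?\<gamma> u * I)"
    unfolding J[abs_def] by (intro tendsto_intros)
  have "(sqrt (2 * pi)) ^ DIM('a) * (LINT u|lborel. ?\<gamma> u * I) = (2 * pi) ^ DIM('a) * I"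
  proof -
    have "(sqrt (2 * pi)) ^ DIM('a) * (sqrt (2 * pi)) ^ DIM('a) = (sqrt (2 * pi) * sqrt (2 * pi)) ^ DIM('a)"
      by (rule power_mult_distrib[symmetric])
    also have "sqrt (2 * pi) * sqrt (2 * pi) = 2 * pi" by simp
    finally have "(sqrt (2 * pi)) ^ DIM('a) * (sqrt (2 * pi)) ^ DIM('a) = (2 * pi) ^ DIM('a)" .
    moreover have "(LINT u|lborel. ?\<gamma> u * I) = (sqrt (2 * pi)) ^ DIM('a) * I"
      by (simp only: integral_mult_left_zero g2)
    ultimately show ?thesis by (metis mult.assoc)
  qed
  with Jlim have Jlim: "J \<longlonglongrightarrow> (2 * pi) ^ DIM('a) * I" by (simp only:)
  have ftb: "norm (ft f p) \<le> (LINT x|lborel. norm (f x))" for p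
    unfolding ft_def using integral_norm_bound[of lborel "\<lambda>x. phase p x * f x"] by (simp add: norm_mult)
  have Ji: "integrable lborel (\<lambda>p. exp (- (\<epsilon> n * norm p)\<^sup>2 / 2) * (norm (ft f p))\<^sup>2)" for n
  proof (rule Bochner_Integration.integrable_bound)
    show "integrable lborel (\<lambda>p::'a. exp (- (\<epsilon> n * norm p)\<^sup>2 / 2) * (LINT x|lborel. norm (f x))\<^sup>2)"
      using gaussian_fourier(1)[OF \<epsilon>[of n], of "0::'a"] by (simp add: complex_of_real_integrable_eq)
    show "AE p in lborel. norm (exp (- (\<epsilon> n * norm p)\<^sup>2 / 2) * (norm (ft f p))\<^sup>2) \<le> norm (exp (- (\<epsilon> n * norm p)\<^sup>2 / 2) * (LINT x|lborel. norm (f x))\<^sup>2)"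
      using ftb by (auto intro!: AE_I2 mult_left_mono power_mono)
  qed measurable
  \<comment> \<open>The weights increase to 1 as \<epsilon> decreases, so monotone convergence
    applies, although square integrability of the transform is not yet known.\<close>
  have "L2_square (\<lambda>p. ft f p) = (\<integral>\<^sup>+p. (SUP n. ennreal (exp (- (\<epsilon> n * norm p)\<^sup>2 / 2) * (norm (ft f p))\<^sup>2)) \<partial>lborel)"
  proof (intro nn_integral_cong)
    fix p :: 'a
    have "(\<lambda>n. exp (- (\<epsilon> n * norm p)\<^sup>2 / 2) * (norm (ft f p))\<^sup>2) \<longlonglongrightarrow> exp (- (0 * norm p)\<^sup>2 / 2) * (norm (ft f p))\<^sup>2"
      by (intro tendsto_intros \<epsilon>lim) auto
    then have "(\<lambda>n. ennreal (exp (- (\<epsilon> n * norm p)\<^sup>2 / 2) * (norm (ft f p))\<^sup>2)) \<longlonglongrightarrow> ennreal ((norm (ft f p))\<^sup>2)"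
      by (intro tendsto_ennrealI) simp
    moreover have "incseq (\<lambda>n. ennreal (exp (- (\<epsilon> n * norm p)\<^sup>2 / 2) * (norm (ft f p))\<^sup>2))"
    proof (intro incseq_SucI ennreal_leI mult_right_mono)
      fix n
      have "\<epsilon> (Suc n) \<le> \<epsilon> n" unfolding \<epsilon>_def by (intro le_imp_inverse_le) auto
      then have "(\<epsilon> (Suc n) * norm p)\<^sup>2 \<le> (\<epsilon> n * norm p)\<^sup>2"
        using \<epsilon>[of "Suc n"] by (intro power_mono mult_right_mono) auto
      then show "exp (- (\<epsilon> n * norm p)\<^sup>2 / 2) \<le> exp (- (\<epsilon> (Suc n) * norm p)\<^sup>2 / 2)" by simp
    qed auto
    ultimately show "ennreal ((norm (ft f p))\<^sup>2) = (SUP n. ennreal (exp (- (\<epsilon> n * norm p)\<^sup>2 / 2) * (norm (ft f p))\<^sup>2))"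
      using LIMSEQ_SUP LIMSEQ_unique by blast
  qed
  also have "\<dots> = (SUP n. \<integral>\<^sup>+p. ennreal (exp (- (\<epsilon> n * norm p)\<^sup>2 / 2) * (norm (ft f p))\<^sup>2) \<partial>lborel)"
  proof (rule nn_integral_monotone_convergence_SUP)
    show "incseq (\<lambda>n p. ennreal (exp (- (\<epsilon> n * norm p)\<^sup>2 / 2) * (norm (ft f p))\<^sup>2))"
    proof (intro incseq_SucI le_funI ennreal_leI mult_right_mono)
      fix n and p :: 'a
      have "\<epsilon> (Suc n) \<le> \<epsilon> n" unfolding \<epsilon>_def by (intro le_imp_inverse_le) auto
      then have "(\<epsilon> (Suc n) * norm p)\<^sup>2 \<le> (\<epsilon> n * norm p)\<^sup>2"
        using \<epsilon>[of "Suc n"] by (intro power_mono mult_right_mono) auto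
      then show "exp (- (\<epsilon> n * norm p)\<^sup>2 / 2) \<le> exp (- (\<epsilon> (Suc n) * norm p)\<^sup>2 / 2)" by simp
    qed auto
  qed measurable
  also have "\<dots> = (SUP n. ennreal (J n))"
    unfolding J_def by (intro SUP_cong refl nn_integral_eq_integral[OF Ji]) auto
  also have "\<dots> = ennreal ((2 * pi) ^ DIM('a) * I)"
  proof -
    have "incseq (\<lambda>n. ennreal (J n))"
    proof (intro incseq_SucI ennreal_leI)
      fix n
      have "\<epsilon> (Suc n) \<le> \<epsilon> n" unfolding \<epsilon>_def by (intro le_imp_inverse_le) auto
      then have "(\<epsilon> (Suc n) * norm p)\<^sup>2 \<le> (\<epsilon> n * norm p)\<^sup>2" for p :: 'a
        using \<epsilon>[of "Suc n"] by (intro power_mono mult_right_mono) auto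
      then show "J n \<le> J (Suc n)" unfolding J_def by (intro integral_mono Ji mult_right_mono) auto
    qed
    from LIMSEQ_unique[OF LIMSEQ_SUP[OF this] tendsto_ennrealI[OF Jlim]] show ?thesis .
  qed
  also have "\<dots> = ennreal ((2 * pi) ^ DIM('a)) * ennreal I"
    by (intro ennreal_mult) (auto simp: I_def)
  also have "ennreal I = L2_square (\<lambda>x. f x)"
    unfolding I_def by (rule nn_integral_eq_integral[symmetric, OF f2]) auto
  finally show ?thesis .
qed

text \<open>The Riesz-Fischer argument, stated with nonnegative integrals so that only the
  differences have to be square integrable. Along a subsequence whose consecutive squared distances
  are at most 4^(-k), the sum weighted with 2^k has a finite integral. Hence almost everywhere the
  increments are O(2^(-k/2)) and the subsequence converges; Fatou's lemma turns the Cauchy estimate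
  into convergence in mean square.\<close>

lemma L2_complete:
  fixes f :: "nat \<Rightarrow> 'a \<Rightarrow> 'b::{banach, second_countable_topology}"
  assumes [measurable]: "\<And>n. f n \<in> borel_measurable M"
    and cauchy: "\<And>\<epsilon>. \<epsilon> > 0 \<Longrightarrow> \<exists>N. \<forall>m\<ge>N. \<forall>n\<ge>N. (\<integral>\<^sup>+x. ennreal ((norm (f m x - f n x))\<^sup>2) \<partial>M) \<le> ennreal \<epsilon>"
  obtains g where "g \<in> borel_measurable M" "(\<lambda>n. \<integral>\<^sup>+x. ennreal ((norm (f n x - g x))\<^sup>2) \<partial>M) \<longlonglongrightarrow> 0"
proof -
  have "\<forall>k. \<exists>N. \<forall>m\<ge>N. \<forall>n\<ge>N. (\<integral>\<^sup>+x. ennreal ((norm (f m x - f n x))\<^sup>2) \<partial>M) \<le> ennreal ((1/4) ^ k)"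
    using cauchy by simp
  then obtain N where N: "\<And>k m n. m \<ge> N k \<Longrightarrow> n \<ge> N k \<Longrightarrow> (\<integral>\<^sup>+x. ennreal ((norm (f m x - f n x))\<^sup>2) \<partial>M) \<le> ennreal ((1/4) ^ k)"
    by metis
  \<comment> \<open>The partial sum places both \<open>r k\<close> and \<open>r (Suc k)\<close>
    beyond \<open>N k\<close>; the summand \<open>k\<close> makes the indices tend to
    infinity.\<close>
  define r where "r k = (\<Sum>j\<le>k. N j) + k" for k :: nat
  have rN: "r k \<ge> N k" "r (Suc k) \<ge> N k" for k
  proof -
    show "r k \<ge> N k" unfolding r_def using member_le_sum[of k "{..k}" N] by simp
    then show "r (Suc k) \<ge> N k" by (simp add: r_def)
  qed
  define d where "d k x = norm (f (r (Suc k)) x - f (r k) x)" for k x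
  have [measurable]: "d k \<in> borel_measurable M" for k unfolding d_def by measurable
  define S where "S x = (\<Sum>k. ennreal (2 ^ k * (d k x)\<^sup>2))" for x
  have [measurable]: "S \<in> borel_measurable M" unfolding S_def by measurable
  have "(\<integral>\<^sup>+x. S x \<partial>M) = (\<Sum>k. \<integral>\<^sup>+x. ennreal (2 ^ k * (d k x)\<^sup>2) \<partial>M)"
    unfolding S_def by (rule nn_integral_suminf) measurable
  also have "\<dots> \<le> (\<Sum>k. ennreal ((1/2) ^ k))"
  proof (intro suminf_le allI summableI)
    fix k
    have "(\<integral>\<^sup>+x. ennreal (2 ^ k * (d k x)\<^sup>2) \<partial>M) = (\<integral>\<^sup>+x. ennreal (2 ^ k) * ennreal ((d k x)\<^sup>2) \<partial>M)"
      by (intro nn_integral_cong) (simp add: ennreal_mult)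
    also have "\<dots> = ennreal (2 ^ k) * (\<integral>\<^sup>+x. ennreal ((d k x)\<^sup>2) \<partial>M)"
      by (rule nn_integral_cmult) measurable
    also have "\<dots> \<le> ennreal (2 ^ k) * ennreal ((1/4) ^ k)"
      unfolding d_def by (intro mult_left_mono N rN) auto
    also have "\<dots> = ennreal (2 ^ k * (1/4) ^ k)" by (rule ennreal_mult[symmetric]) auto
    also have "(2::real) ^ k * (1/4) ^ k = (1/2) ^ k" by (simp flip: power_mult_distrib)
    finally show "(\<integral>\<^sup>+x. ennreal (2 ^ k * (d k x)\<^sup>2) \<partial>M) \<le> ennreal ((1/2) ^ k)" .
  qed
  also have "\<dots> < \<infinity>"
    by (subst suminf_ennreal2) (auto intro: summable_geometric)
  finally have "AE x in M. S x \<noteq> \<infinity>"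
    by (intro nn_integral_PInf_AE) auto
  then have conv: "AE x in M. convergent (\<lambda>k. f (r k) x)"
  proof eventually_elim
    case (elim x)
    then obtain C where C: "C \<ge> 0" "S x = ennreal C" by (cases "S x") auto
    have dk: "d k x \<le> sqrt C * (1 / sqrt 2) ^ k" for k
    proof -
      have "(\<Sum>j\<in>{k}. ennreal (2 ^ j * (d j x)\<^sup>2)) \<le> S x"
        unfolding S_def by (rule sum_le_suminf) auto
      then have "2 ^ k * (d k x)\<^sup>2 \<le> C" using C by simp
      then have "(d k x)\<^sup>2 \<le> C * (1/2) ^ k" by (simp add: power_divide field_simps)
      then have "sqrt ((d k x)\<^sup>2) \<le> sqrt (C * (1/2) ^ k)" by (rule real_sqrt_le_mono)
      then show ?thesis by (simp add: d_def real_sqrt_mult real_sqrt_power real_sqrt_divide)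
    qed
    have "summable (\<lambda>k. sqrt C * (1 / sqrt 2) ^ k)"
      by (intro summable_mult summable_geometric) simp
    then have "summable (\<lambda>k. norm (f (r (Suc k)) x - f (r k) x))"
      by (rule summable_comparison_test'[where N=0]) (use dk in \<open>simp add: d_def\<close>)
    then have "summable (\<lambda>k. f (r (Suc k)) x - f (r k) x)" by (rule summable_norm_cancel)
    then have "convergent (\<lambda>n. \<Sum>k<n. f (r (Suc k)) x - f (r k) x)"
      by (simp add: summable_iff_convergent)
    then have "convergent (\<lambda>n. f (r n) x - f (r 0) x)"
      using sum_lessThan_telescope[of "\<lambda>k. f (r k) x"] by simp
    then show ?case using convergent_diff_const_right_iff by fast
  qed
  define g where "g x = lim (\<lambda>k. f (r k) x)" for x
  have [measurable]: "g \<in> borel_measurable M"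
    unfolding g_def by (rule borel_measurable_lim_metric) measurable
  have lim: "AE x in M. (\<lambda>k. f (r k) x) \<longlonglongrightarrow> g x"
    using conv unfolding g_def by eventually_elim (simp add: convergent_LIMSEQ_iff)
  have key: "(\<integral>\<^sup>+x. ennreal ((norm (f n x - g x))\<^sup>2) \<partial>M) \<le> ennreal \<epsilon>"
    if N0: "\<forall>m\<ge>N0. \<forall>n\<ge>N0. (\<integral>\<^sup>+x. ennreal ((norm (f m x - f n x))\<^sup>2) \<partial>M) \<le> ennreal \<epsilon>" and n: "n \<ge> N0" for \<epsilon> N0 n
  proof -
    have "(\<integral>\<^sup>+x. ennreal ((norm (f n x - g x))\<^sup>2) \<partial>M) = (\<integral>\<^sup>+x. liminf (\<lambda>k. ennreal ((norm (f n x - f (r k) x))\<^sup>2)) \<partial>M)"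
    proof (rule nn_integral_cong_AE, use lim in eventually_elim)
      case (elim x)
      have "(\<lambda>k. ennreal ((norm (f n x - f (r k) x))\<^sup>2)) \<longlonglongrightarrow> ennreal ((norm (f n x - g x))\<^sup>2)"
        by (intro tendsto_ennrealI tendsto_intros elim)
      then show ?case by (rule lim_imp_Liminf[OF trivial_limit_sequentially, symmetric])
    qed
    also have "\<dots> \<le> liminf (\<lambda>k. \<integral>\<^sup>+x. ennreal ((norm (f n x - f (r k) x))\<^sup>2) \<partial>M)"
      by (rule nn_integral_liminf) measurable
    also have "\<dots> \<le> liminf (\<lambda>k. ennreal \<epsilon>)"
    proof (rule Liminf_mono)
      show "\<forall>\<^sub>F k in sequentially. (\<integral>\<^sup>+x. ennreal ((norm (f n x - f (r k) x))\<^sup>2) \<partial>M) \<le> ennreal \<epsilon>"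
        using eventually_ge_at_top[of N0]
      proof eventually_elim
        case (elim k)
        then have "r k \<ge> N0" by (simp add: r_def)
        then show ?case using N0 n by blast
      qed
    qed
    also have "\<dots> = ennreal \<epsilon>" by (simp add: Liminf_const)
    finally show ?thesis .
  qed
  have "(\<lambda>n. \<integral>\<^sup>+x. ennreal ((norm (f n x - g x))\<^sup>2) \<partial>M) \<longlonglongrightarrow> 0"
  proof (rule order_tendstoI)
    fix a :: ennreal assume "0 < a"
    then obtain \<epsilon> where \<epsilon>: "\<epsilon> > 0" "ennreal \<epsilon> < a"
      by (metis dense ennreal_cases ennreal_less_zero_iff less_top_ennreal order.strict_trans top.not_eq_extremum)
    from cauchy[OF \<epsilon>(1)] obtain N0 where "\<forall>m\<ge>N0. \<forall>n\<ge>N0. (\<integral>\<^sup>+x. ennreal ((norm (f m x - f n x))\<^sup>2) \<partial>M) \<le> ennreal \<epsilon>" by blast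
    from key[OF this] \<epsilon>(2) show "\<forall>\<^sub>F n in sequentially. (\<integral>\<^sup>+x. ennreal ((norm (f n x - g x))\<^sup>2) \<partial>M) < a"
      unfolding eventually_sequentially by (meson order.strict_trans1)
  qed auto
  then show ?thesis using that[of g] by simp
qed

section \<open>The transform of vector-valued functions\<close>

lemma norm_vec_power2: "(norm (v :: complex ^ 'n))\<^sup>2 = (\<Sum>i\<in>UNIV. (norm (v $ i))\<^sup>2)"
  by (simp add: norm_vec_def L2_set_def sum_nonneg)

lemma norm_vector_smult [simp]: "norm (c *s (v :: complex ^ 'n)) = norm c * norm v"
proof -
  have "(norm (c *s v))\<^sup>2 = (norm c * norm v)\<^sup>2"
    by (simp add: norm_vec_power2 power_mult_distrib norm_mult sum_distrib_left)
  then show ?thesis by (simp add: power2_eq_iff_nonneg)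
qed

lemma borel_measurable_vector_smult [measurable (raw)]:
  fixes f :: "'a \<Rightarrow> complex" and g :: "'a \<Rightarrow> complex ^ 'n"
  assumes [measurable]: "f \<in> borel_measurable M" "g \<in> borel_measurable M"
  shows "(\<lambda>x. f x *s g x) \<in> borel_measurable M"
proof -
  have "continuous_on UNIV (\<lambda>z :: complex \<times> (complex ^ 'n). fst z *s snd z)"
    unfolding vector_scalar_mult_def
    by (intro continuous_on_vec_lambda continuous_intros)
  from borel_measurable_continuous_on[OF this, of "\<lambda>x. (f x, g x)" M] show ?thesis by simp
qed

lemma borel_measurable_vec_nth' [measurable (raw)]:
  fixes g :: "'a \<Rightarrow> complex ^ 'n"
  assumes [measurable]: "g \<in> borel_measurable M"
  shows "(\<lambda>x. g x $ i) \<in> borel_measurable M"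
  by (rule borel_measurable_continuous_on[of "\<lambda>v. v $ i"]) (auto intro!: continuous_intros)

lemma integrable_vec_nth:
  fixes g :: "'a \<Rightarrow> complex ^ 'n"
  assumes "integrable M g"
  shows "integrable M (\<lambda>x. g x $ i)" and "(LINT x|M. g x) $ i = (LINT x|M. g x $ i)"
  using integrable_bounded_linear[OF bounded_linear_vec_nth assms] integral_bounded_linear[OF bounded_linear_vec_nth assms] by auto

lemma integrable_phase_smult:
  fixes \<psi> :: "'a::euclidean_space \<Rightarrow> complex ^ 4"
  assumes "integrable lborel \<psi>"
  shows "integrable lborel (\<lambda>x. phase p x *s \<psi> x)"
proof -
  have [measurable]: "\<psi> \<in> borel_measurable borel" using assms by auto
  show ?thesis
    by (rule Bochner_Integration.integrable_bound[OF assms]) auto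
qed

lemma fourier_integral_nth:
  assumes "integrable lborel \<psi>"
  shows "fourier_integral \<psi> p $ i = complex_of_real ((2 * pi) powr (- 3 / 2)) * ft (\<lambda>x. \<psi> x $ i) p"
  unfolding fourier_integral_def ft_def vector_scaleR_component
  by (subst integrable_vec_nth(2)[OF integrable_phase_smult[OF assms]]) (simp add: scaleR_conv_of_real)

lemma fourier_integral_diff:
  assumes "integrable lborel \<psi>" "integrable lborel \<phi>"
  shows "fourier_integral (\<lambda>x. \<psi> x - \<phi> x) p = fourier_integral \<psi> p - fourier_integral \<phi> p"
proof -
  have "phase p x *s (\<psi> x - \<phi> x) = phase p x *s \<psi> x - phase p x *s \<phi> x" for x
    by (simp add: vec_eq_iff algebra_simps)
  then show ?thesis
    unfolding fourier_integral_def
    using integrable_phase_smult[OF assms(1), of p] integrable_phase_smult[OF assms(2), of p]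
    by (simp add: scaleR_diff_right)
qed

lemma fourier_integral_measurable [measurable]:
  assumes [measurable]: "\<psi> \<in> borel_measurable borel"
  shows "fourier_integral \<psi> \<in> borel_measurable borel"
proof -
  have "(\<lambda>p. ((2 * pi) powr (- 3 / 2)) *\<^sub>R (LINT x|lborel. phase p x *s \<psi> x)) \<in> borel_measurable borel"
    by measurable
  then show ?thesis unfolding fourier_integral_def[abs_def] .
qed

text \<open>The squared prefactor cancels the factor (2 \<pi>)^3 which the scalar identity yields
  for each component.\<close>

lemma plancherel_vector:
  assumes "integrable lborel \<psi>" "integrable lborel (\<lambda>x. (norm (\<psi> x))\<^sup>2)"
  shows "L2_square (\<lambda>p. fourier_integral \<psi> p) = L2_square (\<lambda>x. \<psi> x)"
proof -
  have [measurable]: "\<psi> \<in> borel_measurable borel" using assms by auto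
  let ?c = "(2 * pi) powr (- 3 / 2)"
  have c: "?c\<^sup>2 * (2 * pi) ^ 3 = 1"
  proof -
    have "?c\<^sup>2 = (2 * pi) powr (- 3)" by (simp add: powr_power)
    also have "(2 * pi) powr (- 3) = inverse ((2 * pi) ^ 3)" by (simp add: powr_minus powr_numeral)
    finally have e: "?c\<^sup>2 = inverse ((2 * pi) ^ 3)" .
    show ?thesis unfolding e by simp
  qed
  have i: "integrable lborel (\<lambda>x. (norm (\<psi> x $ i))\<^sup>2)" for i
  proof (rule Bochner_Integration.integrable_bound[OF assms(2)])
    show "AE x in lborel. norm ((norm (\<psi> x $ i))\<^sup>2) \<le> norm ((norm (\<psi> x))\<^sup>2)"
      by (auto intro!: AE_I2 power_mono component_le_norm_cart Finite_Cartesian_Product.norm_nth_le)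
  qed measurable
  have "L2_square (\<lambda>p. fourier_integral \<psi> p)
     = (\<integral>\<^sup>+p. (\<Sum>i\<in>UNIV. ennreal (?c\<^sup>2) * ennreal ((norm (ft (\<lambda>x. \<psi> x $ i) p))\<^sup>2)) \<partial>lborel)"
    by (intro nn_integral_cong, subst norm_vec_power2, subst sum_ennreal[symmetric])
       (auto simp: fourier_integral_nth[OF assms(1)] norm_mult power_mult_distrib ennreal_mult[symmetric])
  also have "\<dots> = (\<Sum>i\<in>UNIV. ennreal (?c\<^sup>2) * L2_square (\<lambda>p. ft (\<lambda>x. \<psi> x $ i) p))"
    by (subst nn_integral_sum, measurable) (intro sum.cong refl nn_integral_cmult, measurable)
  also have "\<dots> = (\<Sum>i\<in>UNIV. ennreal (?c\<^sup>2 * (2 * pi) ^ 3) * L2_square (\<lambda>x. \<psi> x $ i))"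
    by (intro sum.cong refl, subst plancherel[OF integrable_vec_nth(1)[OF assms(1)] i])
       (simp add: ennreal_mult mult.assoc)
  also have "\<dots> = (\<Sum>i\<in>UNIV. L2_square (\<lambda>x. \<psi> x $ i))"
    unfolding c by simp
  also have "\<dots> = (\<integral>\<^sup>+x. (\<Sum>i\<in>UNIV. ennreal ((norm (\<psi> x $ i))\<^sup>2)) \<partial>lborel)"
    by (rule nn_integral_sum[symmetric]) measurable
  also have "\<dots> = L2_square (\<lambda>x. \<psi> x)"
    by (intro nn_integral_cong, subst norm_vec_power2, subst sum_ennreal) auto
  finally show ?thesis .
qed

section \<open>Uniqueness and inversion of the L^2 transform\<close>

lemma L2_bounded_support_integrable:
  fixes \<psi> :: "'a::euclidean_space \<Rightarrow> 'b::{banach, second_countable_topology}"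
  assumes "\<psi> \<in> borel_measurable lborel" "integrable lborel (\<lambda>x. (norm (\<psi> x))\<^sup>2)" "AE x in lborel. norm x > R \<longrightarrow> \<psi> x = 0"
  shows "integrable lborel \<psi>"
proof (rule Bochner_Integration.integrable_bound)
  show "integrable lborel (\<lambda>x. (norm (\<psi> x))\<^sup>2 + indicat_real (cball 0 R) x)"
    using assms(2) by (intro Bochner_Integration.integrable_add integrable_real_indicator)
       (auto simp: emeasure_lborel_cball_finite[unfolded infinity_ennreal_def])
  show "AE x in lborel. norm (\<psi> x) \<le> norm ((norm (\<psi> x))\<^sup>2 + indicat_real (cball 0 R) x)"
    using assms(3)
  proof eventually_elim
    case (elim x)
    have "2 * norm (\<psi> x) \<le> (norm (\<psi> x))\<^sup>2 + 1"
      using sum_squares_bound[of "norm (\<psi> x)" 1] by (simp add: power2_eq_square)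
    then have "norm (\<psi> x) \<le> (norm (\<psi> x))\<^sup>2 + 1" using norm_ge_zero[of "\<psi> x"] by linarith
    then show ?case using elim by (cases "norm x > R") auto
  qed
qed (use assms in auto)

text \<open>If \<psi> is integrable, Plancherel's identity for the difference suffices. Otherwise
  \<open>fourier \<psi>\<close> is a choice: the truncations of \<psi> to balls have transforms that
  are Cauchy in L^2, so the limit in the definition exists and the choice is such a limit. By
  Plancherel's identity the truncations then converge in L^2 to \<phi>, while they converge
  pointwise to \<psi>, and Fatou's lemma identifies the two.\<close>

lemma fourier_unique:
  assumes \<psi>: "dirac_wavefunction \<psi>" and \<phi>: "dirac_wavefunction \<phi>" and \<phi>i: "integrable lborel \<phi>"
    and eq: "AE p in lborel. fourier \<psi> p = fourier \<phi> p"
  shows "AE x in lborel. \<psi> x = \<phi> x"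
proof -
  have [measurable]: "\<psi> \<in> borel_measurable borel" "\<phi> \<in> borel_measurable borel"
    and \<psi>2: "integrable lborel (\<lambda>x. (norm (\<psi> x))\<^sup>2)" and \<phi>2: "integrable lborel (\<lambda>x. (norm (\<phi> x))\<^sup>2)"
    using \<psi> \<phi> by (auto simp: dirac_wavefunction_def)
  have F\<phi>: "fourier \<phi> = fourier_integral \<phi>" using \<phi>i by (simp add: fourier_def)
  have diff2: "integrable lborel (\<lambda>x. (norm (f x - g x))\<^sup>2)"
    if [measurable]: "f \<in> borel_measurable borel" "g \<in> borel_measurable borel"
      and "integrable lborel (\<lambda>x. (norm (f x))\<^sup>2)" "integrable lborel (\<lambda>x. (norm (g x))\<^sup>2)" for f g :: "real ^ 3 \<Rightarrow> complex ^ 4"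
  proof (rule Bochner_Integration.integrable_bound)
    show "integrable lborel (\<lambda>x. 2 * (norm (f x))\<^sup>2 + 2 * (norm (g x))\<^sup>2)" using that by auto
    show "AE x in lborel. norm ((norm (f x - g x))\<^sup>2) \<le> norm (2 * (norm (f x))\<^sup>2 + 2 * (norm (g x))\<^sup>2)"
      using norm_triangle_sq2[of "f _" "- g _"] by (auto intro!: AE_I2 order_trans[OF _ abs_ge_self])
  qed measurable
  have zero: "AE x in lborel. \<psi> x = \<phi> x" if "L2_square (\<lambda>x. \<psi> x - \<phi> x) = 0"
    using that by (subst (asm) nn_integral_0_iff_AE) auto
  show ?thesis
  proof (cases "integrable lborel \<psi>")
    case True
    then have "fourier \<psi> = fourier_integral \<psi>" by (simp add: fourier_def)
    with eq F\<phi> have e: "AE p in lborel. fourier_integral (\<lambda>x. \<psi> x - \<phi> x) p = 0"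
      by (auto simp: fourier_integral_diff[OF True \<phi>i])
    have "L2_square (\<lambda>x. \<psi> x - \<phi> x) = L2_square (\<lambda>p. fourier_integral (\<lambda>x. \<psi> x - \<phi> x) p)"
      by (rule plancherel_vector[symmetric]) (use True \<phi>i diff2[OF _ _ \<psi>2 \<phi>2] in auto)
    also have "\<dots> = 0" using e by (subst nn_integral_0_iff_AE) auto
    finally show ?thesis by (rule zero)
  next
    case False
    define \<psi>n where "\<psi>n n x = indicat_real (cball 0 (real n)) x *\<^sub>R \<psi> x" for n :: nat and x
    have [measurable]: "\<psi>n n \<in> borel_measurable borel" for n
      unfolding \<psi>n_def by (intro borel_measurable_scaleR borel_measurable_indicator) auto
    have n2: "integrable lborel (\<lambda>x. (norm (\<psi>n n x))\<^sup>2)" for n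
      by (rule Bochner_Integration.integrable_bound[OF \<psi>2]) (auto simp: \<psi>n_def indicator_def)
    have n1: "integrable lborel (\<psi>n n)" for n
      by (rule L2_bounded_support_integrable[OF _ n2, where R="real n"], simp) (auto simp: \<psi>n_def)
    define F where "F n = fourier_integral (\<psi>n n)" for n
    have [measurable]: "F n \<in> borel_measurable borel" for n unfolding F_def by measurable
    have lim0: "(\<lambda>N. LINT x|lborel. indicat_real (- cball 0 (real N)) x * (norm (\<psi> x))\<^sup>2) \<longlonglongrightarrow> (LINT x|(lborel::(real^3) measure). 0)"
    proof (rule integral_dominated_convergence[where w="\<lambda>x. (norm (\<psi> x))\<^sup>2"])
      show "AE x in lborel. (\<lambda>N. indicat_real (- cball 0 (real N)) x * (norm (\<psi> x))\<^sup>2) \<longlonglongrightarrow> 0"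
      proof (rule AE_I2, rule tendsto_eventually)
        fix x :: "real ^ 3"
        obtain k :: nat where k: "real k \<ge> norm x" using real_arch_simple by blast
        show "\<forall>\<^sub>F N in sequentially. indicat_real (- cball 0 (real N)) x * (norm (\<psi> x))\<^sup>2 = 0"
          using eventually_ge_at_top[of k] by eventually_elim (use k in auto)
      qed
    qed (use \<psi>2 in \<open>auto simp: indicator_def\<close>)
    have cauchy: "\<exists>N. \<forall>m\<ge>N. \<forall>n\<ge>N. L2_square (\<lambda>p. F m p - F n p) \<le> ennreal \<epsilon>" if "\<epsilon> > 0" for \<epsilon>
    proof -
      have "\<forall>\<^sub>F N in sequentially. (LINT x|lborel. indicat_real (- cball 0 (real N)) x * (norm (\<psi> x))\<^sup>2) < \<epsilon>"
        using lim0 that by (intro order_tendstoD(2)) auto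
      then obtain N where N: "(LINT x|lborel. indicat_real (- cball 0 (real N)) x * (norm (\<psi> x))\<^sup>2) < \<epsilon>"
        by (meson eventually_happens' sequentially_bot)
      show ?thesis
      proof (intro exI[of _ N] allI impI)
        fix m n assume mn: "m \<ge> N" "n \<ge> N"
        have "L2_square (\<lambda>p. F m p - F n p) = L2_square (\<lambda>x. \<psi>n m x - \<psi>n n x)"
          unfolding F_def fourier_integral_diff[OF n1 n1, symmetric]
          by (rule plancherel_vector) (use n1 diff2[OF _ _ n2 n2] in auto)
        also have "\<dots> \<le> (\<integral>\<^sup>+x. ennreal (indicat_real (- cball 0 (real N)) x * (norm (\<psi> x))\<^sup>2) \<partial>lborel)"
          using mn by (intro nn_integral_mono ennreal_leI) (auto simp: \<psi>n_def indicator_def)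
        also have "\<dots> = ennreal (LINT x|lborel. indicat_real (- cball 0 (real N)) x * (norm (\<psi> x))\<^sup>2)"
          by (rule nn_integral_eq_integral, rule Bochner_Integration.integrable_bound[OF \<psi>2]) (auto simp: indicator_def)
        also have "\<dots> \<le> ennreal \<epsilon>" using N by (intro ennreal_leI) simp
        finally show "L2_square (\<lambda>p. F m p - F n p) \<le> ennreal \<epsilon>" .
      qed
    qed
    obtain g where g[measurable]: "g \<in> borel_measurable lborel" and glim: "(\<lambda>n. \<integral>\<^sup>+p. ennreal ((norm (F n p - g p))\<^sup>2) \<partial>lborel) \<longlonglongrightarrow> 0"
      using L2_complete[of F lborel] cauchy by auto
    have "dirac_wavefunction g"
      unfolding dirac_wavefunction_def
    proof (intro conjI g integrableI_bounded)
      have "\<forall>\<^sub>F n in sequentially. L2_square (\<lambda>p. F n p - g p) < 1"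
        using glim by (intro order_tendstoD(2)) auto
      then obtain n where n: "L2_square (\<lambda>p. F n p - g p) < 1"
        by (meson eventually_happens' sequentially_bot)
      have "(\<integral>\<^sup>+p. ennreal (norm ((norm (g p))\<^sup>2)) \<partial>lborel) \<le> (\<integral>\<^sup>+p. 2 * ennreal ((norm (F n p - g p))\<^sup>2) + 2 * ennreal ((norm (F n p))\<^sup>2) \<partial>lborel)"
      proof (intro nn_integral_mono)
        fix p
        have "(norm (g p))\<^sup>2 \<le> 2 * (norm (F n p - g p))\<^sup>2 + 2 * (norm (F n p))\<^sup>2"
          using norm_triangle_sq2[of "g p - F n p" "F n p"] by (simp add: norm_minus_commute)
        then have "ennreal (norm ((norm (g p))\<^sup>2)) \<le> ennreal (2 * (norm (F n p - g p))\<^sup>2 + 2 * (norm (F n p))\<^sup>2)"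
          by (intro ennreal_leI) simp
        also have "\<dots> = 2 * ennreal ((norm (F n p - g p))\<^sup>2) + 2 * ennreal ((norm (F n p))\<^sup>2)"
          by (simp add: ennreal_mult)
        finally show "ennreal (norm ((norm (g p))\<^sup>2)) \<le> 2 * ennreal ((norm (F n p - g p))\<^sup>2) + 2 * ennreal ((norm (F n p))\<^sup>2)" .
      qed
      also have "\<dots> = 2 * L2_square (\<lambda>p. F n p - g p) + 2 * L2_square (\<lambda>p. F n p)"
        by (simp add: nn_integral_add nn_integral_cmult)
      also have "L2_square (\<lambda>p. F n p) = ennreal (LINT x|lborel. (norm (\<psi>n n x))\<^sup>2)"
        unfolding F_def plancherel_vector[OF n1 n2] by (rule nn_integral_eq_integral[OF n2]) auto
      also have "2 * L2_square (\<lambda>p. F n p - g p) + 2 * ennreal (LINT x|lborel. (norm (\<psi>n n x))\<^sup>2) < \<infinity>"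
        using n by (auto simp: ennreal_mult_eq_top_iff ennreal_add_eq_top less_top[symmetric])
      finally show "(\<integral>\<^sup>+p. ennreal (norm ((norm (g p))\<^sup>2)) \<partial>lborel) < \<infinity>" .
    qed measurable
    \<comment> \<open>With the witness \<open>g\<close> the \<open>SOME\<close> in
      \<open>fourier\<close> is known to satisfy its specification.\<close>
    then have "\<exists>\<phi>. dirac_wavefunction \<phi> \<and>
        (\<lambda>n::nat. \<integral>\<^sup>+ p. ennreal ((norm (fourier_integral (\<lambda>x. indicat_real (cball 0 (real n)) x *\<^sub>R \<psi> x) p - \<phi> p))\<^sup>2) \<partial>lborel) \<longlonglongrightarrow> 0"
      using glim unfolding F_def \<psi>n_def[abs_def] by blast
    from someI_ex[OF this] False
    have Flim: "(\<lambda>n. \<integral>\<^sup>+ p. ennreal ((norm (F n p - fourier \<psi> p))\<^sup>2) \<partial>lborel) \<longlonglongrightarrow> 0"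
      unfolding fourier_def F_def \<psi>n_def[abs_def] by simp
    have "L2_square (\<lambda>p. F n p - fourier \<psi> p) = L2_square (\<lambda>x. \<psi>n n x - \<phi> x)" for n
    proof -
      have "L2_square (\<lambda>p. F n p - fourier \<psi> p) = L2_square (\<lambda>p. fourier_integral (\<lambda>x. \<psi>n n x - \<phi> x) p)"
        by (rule nn_integral_cong_AE, use eq in eventually_elim) (simp add: F\<phi> F_def fourier_integral_diff[OF n1 \<phi>i])
      also have "\<dots> = L2_square (\<lambda>x. \<psi>n n x - \<phi> x)"
        by (rule plancherel_vector) (use n1 \<phi>i diff2[OF _ _ n2 \<phi>2] in auto)
      finally show ?thesis .
    qed
    with Flim have lim: "(\<lambda>n. \<integral>\<^sup>+ x. ennreal ((norm (\<psi>n n x - \<phi> x))\<^sup>2) \<partial>lborel) \<longlonglongrightarrow> 0" by simp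
    have "L2_square (\<lambda>x. \<psi> x - \<phi> x) = (\<integral>\<^sup>+x. liminf (\<lambda>n. ennreal ((norm (\<psi>n n x - \<phi> x))\<^sup>2)) \<partial>lborel)"
    proof (rule nn_integral_cong)
      fix x :: "real ^ 3"
      obtain k :: nat where k: "real k \<ge> norm x" using real_arch_simple by blast
      have "(\<lambda>n. \<psi>n n x) \<longlonglongrightarrow> \<psi> x"
        by (rule tendsto_eventually, use eventually_ge_at_top[of k] in eventually_elim) (use k in \<open>auto simp: \<psi>n_def\<close>)
      then have "(\<lambda>n. ennreal ((norm (\<psi>n n x - \<phi> x))\<^sup>2)) \<longlonglongrightarrow> ennreal ((norm (\<psi> x - \<phi> x))\<^sup>2)"
        by (intro tendsto_ennrealI tendsto_intros)
      then show "ennreal ((norm (\<psi> x - \<phi> x))\<^sup>2) = liminf (\<lambda>n. ennreal ((norm (\<psi>n n x - \<phi> x))\<^sup>2))"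
        by (rule lim_imp_Liminf[OF trivial_limit_sequentially, symmetric])
    qed
    also have "\<dots> \<le> liminf (\<lambda>n. \<integral>\<^sup>+x. ennreal ((norm (\<psi>n n x - \<phi> x))\<^sup>2) \<partial>lborel)"
      by (rule nn_integral_liminf) measurable
    also have "\<dots> = 0" by (rule lim_imp_Liminf[OF trivial_limit_sequentially lim])
    finally show ?thesis using zero by simp
  qed
qed

text \<open>A known integrable preimage is a witness for the \<open>SOME\<close> in
  \<open>inverse_fourier\<close>, and uniqueness then forces whatever was chosen to agree with it
  almost everywhere. This gives the evolution a concrete representative.\<close>

lemma inverse_fourier_eq_AE:
  assumes "dirac_wavefunction \<phi>" "integrable lborel \<phi>" "AE p in lborel. fourier \<phi> p = g p"
  shows "dirac_wavefunction (inverse_fourier g)" and "AE x in lborel. inverse_fourier g x = \<phi> x"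
proof -
  have "dirac_wavefunction (inverse_fourier g) \<and> (AE p in lborel. fourier (inverse_fourier g) p = g p)"
    unfolding inverse_fourier_def by (rule someI[of _ \<phi>]) (use assms in auto)
  then have d: "dirac_wavefunction (inverse_fourier g)" and e: "AE p in lborel. fourier (inverse_fourier g) p = g p"
    by auto
  show "dirac_wavefunction (inverse_fourier g)" by (rule d)
  have "AE p in lborel. fourier (inverse_fourier g) p = fourier \<phi> p"
    using e assms(3) by eventually_elim simp
  from fourier_unique[OF d assms(1,2) this] show "AE x in lborel. inverse_fourier g x = \<phi> x" .
qed

section \<open>The symbol of the Dirac operator\<close>

lemma linear_matrix_vector_mult: "linear (\<lambda>v. (M :: complex ^ 'n ^ 'm) *v v)"
  by (rule linearI)
     (simp_all add: vec_eq_iff matrix_vector_mult_def scaleR_sum_right distrib_left sum.distrib)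

lemma matrix_vector_mult_smult: "(M :: complex ^ 'n ^ 'm) *v (c *s v) = c *s (M *v v)"
  by (simp add: vec_eq_iff matrix_vector_mult_def sum_distrib_left mult_ac)

lemma scaleR_matrix_vector_mult: "(r *\<^sub>R (M :: complex ^ 'n ^ 'm)) *v v = r *\<^sub>R (M *v v)"
  by (simp add: vec_eq_iff matrix_vector_mult_def scaleR_sum_right)

lemma mat_matrix_vector_mult: "(mat c :: complex ^ 'n ^ 'n) *v v = c *s v"
  by (simp add: vec_eq_iff matrix_vector_mult_def mat_def if_distrib[of "\<lambda>x. x * _"] cong: if_cong)

lemma sum_matrix_vector_mult: "(\<Sum>k\<in>A. (M k :: complex ^ 'n ^ 'm)) *v v = (\<Sum>k\<in>A. M k *v v)"
  by (induction A rule: infinite_finite_induct) (auto simp: matrix_vector_mult_add_rdistrib)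

text \<open>On complex vectors \<open>inner\<close> is the real part of the Hermitian product, for
  which the matrix is self-adjoint.\<close>

lemma hermitian_inner:
  assumes "hermitian_matrix M"
  shows "inner (M *v v) w = inner v (M *v w)"
proof -
  have h: "cnj (M $ j $ i) = M $ i $ j" for i j
    using assms unfolding hermitian_matrix_def
    by (metis (no_types, lifting) map_matrix_def transpose_def vec_lambda_beta)
  have ic: "inner a b = Re (cnj a * b)" for a b :: complex
    by (simp add: inner_complex_def)
  have "inner (M *v v) w = (\<Sum>i\<in>UNIV. \<Sum>j\<in>UNIV. Re (cnj (v $ j) * (M $ j $ i * w $ i)))"
    unfolding inner_vec_def ic matrix_vector_mult_def
    by (simp only: vec_lambda_beta cnj_sum sum_distrib_right Re_sum) (intro sum.cong refl, simp add: h algebra_simps)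
  also have "\<dots> = (\<Sum>j\<in>UNIV. \<Sum>i\<in>UNIV. Re (cnj (v $ j) * (M $ j $ i * w $ i)))"
    by (rule sum.swap)
  also have "\<dots> = inner v (M *v w)"
    unfolding inner_vec_def ic matrix_vector_mult_def
    by (simp only: vec_lambda_beta sum_distrib_left Re_sum)
  finally show ?thesis .
qed

lemma inner_imag_smult: "inner v (\<i> *s w) = - inner (\<i> *s v) (w :: complex ^ 'n)"
  by (simp add: inner_vec_def inner_complex_def sum_negf[symmetric])

text \<open>For such an involution, \<open>rotor X \<theta>\<close> below is the unitary $e^{\mathrm{i}\theta X}$.\<close>

definition sa_involution :: "(complex ^ 4 \<Rightarrow> complex ^ 4) \<Rightarrow> bool" where
  "sa_involution X \<longleftrightarrow> linear X \<and> (\<forall>c v. X (c *s v) = c *s X v) \<and> (\<forall>v. X (X v) = v) \<and>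
     (\<forall>v w. inner (X v) w = inner v (X w))"

definition rotor :: "(complex ^ 4 \<Rightarrow> complex ^ 4) \<Rightarrow> real \<Rightarrow> complex ^ 4 \<Rightarrow> complex ^ 4" where
  "rotor X \<theta> v = cos \<theta> *\<^sub>R v + sin \<theta> *\<^sub>R (\<i> *s X v)"

lemma smult_scaleR: "c *s (r *\<^sub>R v) = r *\<^sub>R (c *s (v :: complex ^ 'n))"
  by (simp add: vec_eq_iff)

lemma smult_add: "c *s (v + w) = c *s v + c *s (w :: complex ^ 'n)"
  by (simp add: vec_eq_iff algebra_simps)

lemma smult_smult: "c *s (d *s v) = (c * d) *s (v :: complex ^ 'n)"
  by (simp add: vec_eq_iff)

lemma smult_minus_one: "(- 1) *s v = - (v :: complex ^ 'n)"
  by (simp add: vec_eq_iff)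

lemma norm_sa_involution:
  assumes "sa_involution X"
  shows "norm (X v) = norm v"
  using assms unfolding sa_involution_def by (metis norm_eq_sqrt_inner)

text \<open>Since X is self-adjoint, \<i>Xv is orthogonal to v for the real inner product, and since
  X is an involution it has the length of v. The rotor therefore rotates v within a plane.\<close>

lemma norm_rotor:
  assumes X: "sa_involution X"
  shows "norm (rotor X \<theta> v) = norm v"
proof -
  have "inner v (\<i> *s X v) = - inner v (\<i> *s X v)"
    using X unfolding sa_involution_def by (metis inner_commute inner_imag_smult)
  then have o: "inner v (\<i> *s X v) = 0" by simp
  have n: "inner (\<i> *s X v) (\<i> *s X v) = inner v v"
    unfolding inner_imag_smult[of "\<i> *s X v"] smult_smult using X
    by (simp add: smult_minus_one sa_involution_def)
  have "inner (rotor X \<theta> v) (rotor X \<theta> v) = (cos \<theta> * cos \<theta> + sin \<theta> * sin \<theta>) * inner v v"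
    unfolding rotor_def using o n
    by (simp add: inner_add_left inner_add_right inner_commute[of "\<i> *s X v" v] algebra_simps del: sin_cos_squared_add3)
  then show ?thesis by (simp add: norm_eq_sqrt_inner)
qed

lemma linear_rotor:
  assumes "sa_involution X"
  shows "linear (rotor X \<theta>)"
proof -
  have "linear X" using assms by (simp add: sa_involution_def)
  then show ?thesis
    by (intro linearI) (simp_all add: rotor_def linear_add linear_scale smult_add smult_scaleR algebra_simps)
qed

lemma rotor_rotor:
  assumes X: "sa_involution X"
  shows "rotor X a (rotor X b v) = rotor X (a + b) v"
proof -
  have l: "linear X" and s: "\<And>c v. X (c *s v) = c *s X v" and i: "\<And>v. X (X v) = v"
    using X by (auto simp: sa_involution_def)
  show ?thesis
    unfolding rotor_def linear_add[OF l] linear_scale[OF l] s i smult_add smult_scaleR smult_smult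
    by (simp add: smult_minus_one cos_add sin_add algebra_simps)
qed

lemma rotor_0 [simp]: "rotor X 0 v = v"
  by (simp add: rotor_def)

lemma rotor_funpow:
  assumes "sa_involution X"
  shows "(rotor X a ^^ n) v = rotor X (real n * a) v"
  by (induction n) (simp_all add: rotor_rotor[OF assms] algebra_simps)

lemma rotor_first_order:
  assumes "sa_involution X"
  shows "norm (rotor X \<theta> v - v - \<theta> *\<^sub>R (\<i> *s X v)) \<le> 2 * \<theta>\<^sup>2 * norm v"
proof -
  have c: "\<bar>cos \<theta> - 1\<bar> \<le> \<theta>\<^sup>2"
  proof -
    have "cos \<theta> = 1 - 2 * (sin (\<theta> / 2))\<^sup>2" using cos_double_sin[of "\<theta> / 2"] by simp
    moreover have "(sin (\<theta> / 2))\<^sup>2 \<le> (\<theta> / 2)\<^sup>2"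
      using abs_sin_x_le_abs_x[of "\<theta> / 2"] by (metis abs_le_square_iff)
    then have "4 * (sin (\<theta> / 2))\<^sup>2 \<le> \<theta>\<^sup>2" by (simp add: power_divide)
    moreover have "(sin (\<theta> / 2))\<^sup>2 \<ge> 0" by simp
    ultimately show ?thesis by linarith
  qed
  have s: "\<bar>sin \<theta> - \<theta>\<bar> \<le> \<theta>\<^sup>2"
  proof -
    have "2 * \<bar>sin \<theta> - \<theta>\<bar> \<le> \<theta>\<^sup>2"
      using Maclaurin_sin_bound[of \<theta> 2] by (simp add: numeral_2_eq_2 sin_coeff_def)
    moreover have "\<bar>sin \<theta> - \<theta>\<bar> \<le> 2 * \<bar>sin \<theta> - \<theta>\<bar>" by simp
    ultimately show ?thesis by (rule order_trans[rotated])
  qed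
  have "rotor X \<theta> v - v - \<theta> *\<^sub>R (\<i> *s X v) = (cos \<theta> - 1) *\<^sub>R v + (sin \<theta> - \<theta>) *\<^sub>R (\<i> *s X v)"
    by (simp add: rotor_def algebra_simps)
  also have "norm \<dots> \<le> \<theta>\<^sup>2 * norm v + \<theta>\<^sup>2 * norm v"
    using c s by (intro norm_triangle_le add_mono) (auto simp: norm_sa_involution[OF assms] intro!: mult_right_mono)
  finally show ?thesis by (simp add: mult_ac)
qed

section \<open>The Lie product formula with explicit remainders\<close>

definition first_order :: "(real \<Rightarrow> complex ^ 4 \<Rightarrow> complex ^ 4) \<Rightarrow> (complex ^ 4 \<Rightarrow> complex ^ 4) \<Rightarrow> bool" where
  "first_order F X \<longleftrightarrow> linear X \<and>
     (\<exists>C\<ge>0. \<forall>\<tau> v. \<bar>\<tau>\<bar> \<le> 1 \<longrightarrow> norm (F \<tau> v - v - \<tau> *\<^sub>R X v) \<le> C * \<tau>\<^sup>2 * norm v)"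

text \<open>Generators of a product add. F is expanded at w = G \<tau> v, and the generator X is
  then evaluated at w instead of v; the error \<tau> X (w - v) is again quadratic because w - v is
  of order \<tau>.\<close>

lemma first_order_comp:
  assumes F: "first_order F X" and G: "first_order G Y"
  shows "first_order (\<lambda>\<tau> v. F \<tau> (G \<tau> v)) (\<lambda>v. X v + Y v)"
proof -
  have lX: "linear X" and lY: "linear Y" using F G by (auto simp: first_order_def)
  obtain C where C: "C \<ge> 0" "\<And>\<tau> v. \<bar>\<tau>\<bar> \<le> 1 \<Longrightarrow> norm (F \<tau> v - v - \<tau> *\<^sub>R X v) \<le> C * \<tau>\<^sup>2 * norm v"
    using F unfolding first_order_def by blast
  obtain D where D: "D \<ge> 0" "\<And>\<tau> v. \<bar>\<tau>\<bar> \<le> 1 \<Longrightarrow> norm (G \<tau> v - v - \<tau> *\<^sub>R Y v) \<le> D * \<tau>\<^sup>2 * norm v"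
    using G unfolding first_order_def by blast
  obtain K where K: "K > 0" "\<And>v. norm (X v) \<le> K * norm v"
    using linear_bounded_pos[OF lX] by blast
  obtain L where L: "L > 0" "\<And>v. norm (Y v) \<le> L * norm v"
    using linear_bounded_pos[OF lY] by blast
  show ?thesis unfolding first_order_def
  proof (intro conjI exI[of _ "C * (1 + L + D) + D + K * (L + D)"] allI impI)
    show "linear (\<lambda>v. X v + Y v)" by (rule linear_compose_add[OF lX lY])
    show "C * (1 + L + D) + D + K * (L + D) \<ge> 0" using C(1) D(1) K(1) L(1) by simp
    fix \<tau> :: real and v assume t: "\<bar>\<tau>\<bar> \<le> 1"
    define w where "w = G \<tau> v"
    have w1: "norm (w - v - \<tau> *\<^sub>R Y v) \<le> D * \<tau>\<^sup>2 * norm v" unfolding w_def by (rule D(2)[OF t])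
    have t2: "\<tau>\<^sup>2 \<le> \<bar>\<tau>\<bar>" using mult_left_le[OF t, of "\<bar>\<tau>\<bar>"] by (simp add: power2_eq_square abs_mult_self_eq)
    have w2: "norm (w - v) \<le> \<bar>\<tau>\<bar> * (L + D) * norm v"
    proof -
      have "norm (w - v) \<le> norm (w - v - \<tau> *\<^sub>R Y v) + norm (\<tau> *\<^sub>R Y v)"
        using norm_triangle_ineq[of "w - v - \<tau> *\<^sub>R Y v" "\<tau> *\<^sub>R Y v"] by simp
      also have "\<dots> \<le> D * \<bar>\<tau>\<bar> * norm v + \<bar>\<tau>\<bar> * (L * norm v)"
        using D(1) L(2)[of v] t2 by (intro add_mono order_trans[OF w1] mult_right_mono mult_left_mono) (auto intro: mult_left_mono)
      finally show ?thesis by (simp add: algebra_simps)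
    qed
    have w3: "norm w \<le> (1 + L + D) * norm v"
    proof -
      have "norm w \<le> norm v + norm (w - v)" using norm_triangle_ineq[of v "w - v"] by simp
      also have "norm (w - v) \<le> 1 * (L + D) * norm v"
        using t D(1) L(1) by (intro order_trans[OF w2] mult_right_mono) auto
      finally show ?thesis by (simp add: algebra_simps)
    qed
    have "F \<tau> w - v - \<tau> *\<^sub>R (X v + Y v) = (F \<tau> w - w - \<tau> *\<^sub>R X w) + (w - v - \<tau> *\<^sub>R Y v) + \<tau> *\<^sub>R X (w - v)"
      by (simp add: linear_diff[OF lX] algebra_simps)
    also have "norm \<dots> \<le> C * \<tau>\<^sup>2 * ((1 + L + D) * norm v) + D * \<tau>\<^sup>2 * norm v + \<bar>\<tau>\<bar> * (K * (\<bar>\<tau>\<bar> * (L + D) * norm v))"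
    proof (intro norm_triangle_le add_mono w1)
      show "norm (F \<tau> w - w - \<tau> *\<^sub>R X w) \<le> C * \<tau>\<^sup>2 * ((1 + L + D) * norm v)"
        using C(1) w3 by (intro order_trans[OF C(2)[OF t]] mult_left_mono) auto
      show "norm (\<tau> *\<^sub>R X (w - v)) \<le> \<bar>\<tau>\<bar> * (K * (\<bar>\<tau>\<bar> * (L + D) * norm v))"
        using K(1) w2 by (auto intro!: mult_left_mono order_trans[OF K(2)])
    qed
    also have "\<dots> = (C * (1 + L + D) + D + K * (L + D)) * \<tau>\<^sup>2 * norm v"
    proof -
      have "\<bar>\<tau>\<bar> * \<bar>\<tau>\<bar> = \<tau>\<^sup>2" by (simp add: power2_eq_square abs_mult_self_eq)
      moreover have "\<bar>\<tau>\<bar> * (K * (\<bar>\<tau>\<bar> * (L + D) * norm v)) = (\<bar>\<tau>\<bar> * \<bar>\<tau>\<bar>) * (K * (L + D) * norm v)"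
        by (simp only: mult_ac)
      ultimately have "\<bar>\<tau>\<bar> * (K * (\<bar>\<tau>\<bar> * (L + D) * norm v)) = \<tau>\<^sup>2 * (K * (L + D) * norm v)"
        by (simp only:)
      then show ?thesis by (simp add: algebra_simps)
    qed
    finally show "norm (F \<tau> (G \<tau> v) - v - \<tau> *\<^sub>R (X v + Y v)) \<le> (C * (1 + L + D) + D + K * (L + D)) * \<tau>\<^sup>2 * norm v"
      by (simp add: w_def)
  qed
qed

lemma first_order_rotor:
  assumes X: "sa_involution X"
  shows "first_order (\<lambda>\<tau>. rotor X (\<tau> * r)) (\<lambda>v. r *\<^sub>R (\<i> *s X v))"
  unfolding first_order_def
proof (intro conjI exI[of _ "2 * r\<^sup>2"] allI impI)
  have l: "linear X" using X by (simp add: sa_involution_def)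
  show "linear (\<lambda>v. r *\<^sub>R (\<i> *s X v))"
    by (rule linearI) (simp_all add: linear_add[OF l] linear_scale[OF l] smult_add smult_scaleR algebra_simps)
  fix \<tau> v
  show "norm (rotor X (\<tau> * r) v - v - \<tau> *\<^sub>R r *\<^sub>R (\<i> *s X v)) \<le> 2 * r\<^sup>2 * \<tau>\<^sup>2 * norm v"
    using rotor_first_order[OF X, of "\<tau> * r" v] by (simp add: power_mult_distrib mult_ac)
next
  show "0 \<le> 2 * r\<^sup>2" by simp
qed

text \<open>F and G have the same generator, so one step of length t/n makes an error of order
  1/n^2. Since both are isometric, the errors of n steps merely add up in the telescoping sum, to
  order 1/n. For G the n steps compose exactly to u.\<close>

lemma lie_product_limit:
  assumes F: "first_order F X" and G: "first_order G X"
    and Fl: "\<And>\<tau>. linear (F \<tau>)" and Fn: "\<And>\<tau> v. norm (F \<tau> v) = norm v" and Gn: "\<And>\<tau> v. norm (G \<tau> v) = norm v"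
    and Gp: "\<And>n. (G (t / real (Suc n)) ^^ Suc n) v = u"
  shows "(\<lambda>n. (F (t / real (Suc n)) ^^ Suc n) v) \<longlonglongrightarrow> u"
proof -
  obtain C where C: "C \<ge> 0" "\<And>\<tau> v. \<bar>\<tau>\<bar> \<le> 1 \<Longrightarrow> norm (F \<tau> v - v - \<tau> *\<^sub>R X v) \<le> C * \<tau>\<^sup>2 * norm v"
    using F unfolding first_order_def by blast
  obtain D where D: "D \<ge> 0" "\<And>\<tau> v. \<bar>\<tau>\<bar> \<le> 1 \<Longrightarrow> norm (G \<tau> v - v - \<tau> *\<^sub>R X v) \<le> D * \<tau>\<^sup>2 * norm v"
    using G unfolding first_order_def by blast
  have FG: "norm (F \<tau> v - G \<tau> v) \<le> (C + D) * \<tau>\<^sup>2 * norm v" if "\<bar>\<tau>\<bar> \<le> 1" for \<tau> v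
  proof -
    have "F \<tau> v - G \<tau> v = (F \<tau> v - v - \<tau> *\<^sub>R X v) - (G \<tau> v - v - \<tau> *\<^sub>R X v)" by simp
    also have "norm \<dots> \<le> C * \<tau>\<^sup>2 * norm v + D * \<tau>\<^sup>2 * norm v"
      by (intro norm_triangle_le_diff add_mono C(2)[OF that] D(2)[OF that])
    finally show ?thesis by (simp add: algebra_simps)
  qed
  have Gpn: "norm ((G \<tau> ^^ k) v) = norm v" for \<tau> k by (induction k) (auto simp: Gn)
  have tel: "norm ((F \<tau> ^^ k) v - (G \<tau> ^^ k) v) \<le> real k * ((C + D) * \<tau>\<^sup>2 * norm v)" if t: "\<bar>\<tau>\<bar> \<le> 1" for \<tau> k
  proof (induction k)
    case (Suc k)
    have "(F \<tau> ^^ Suc k) v - (G \<tau> ^^ Suc k) v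
       = F \<tau> ((F \<tau> ^^ k) v - (G \<tau> ^^ k) v) + (F \<tau> ((G \<tau> ^^ k) v) - G \<tau> ((G \<tau> ^^ k) v))"
      by (simp add: linear_diff[OF Fl])
    also have "norm \<dots> \<le> real k * ((C + D) * \<tau>\<^sup>2 * norm v) + (C + D) * \<tau>\<^sup>2 * norm v"
      using Suc FG[OF t, of "(G \<tau> ^^ k) v"] by (intro norm_triangle_le add_mono) (auto simp: Fn Gpn)
    finally show ?case by (simp add: algebra_simps)
  qed simp
  have b: "\<forall>\<^sub>F n in sequentially. norm ((F (t / real (Suc n)) ^^ Suc n) v - u) \<le> (C + D) * t\<^sup>2 * norm v * inverse (real (Suc n))"
  proof -
    obtain n0 :: nat where n0: "real n0 \<ge> \<bar>t\<bar>" using real_arch_simple by blast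
    show ?thesis
      using eventually_ge_at_top[of n0]
    proof eventually_elim
      case (elim n)
      then have "\<bar>t / real (Suc n)\<bar> \<le> 1" using n0 by (simp add: abs_divide)
      from tel[OF this, of "Suc n"] Gp[of n]
      have "norm ((F (t / real (Suc n)) ^^ Suc n) v - u) \<le> real (Suc n) * ((C + D) * (t / real (Suc n))\<^sup>2 * norm v)"
        by simp
      also have "\<dots> = (C + D) * t\<^sup>2 * norm v * inverse (real (Suc n))"
        by (simp add: power_divide power2_eq_square field_simps del: of_nat_Suc)
      finally show ?case .
    qed
  qed
  have "(\<lambda>n. (C + D) * t\<^sup>2 * norm v * inverse (real (Suc n))) \<longlonglongrightarrow> (C + D) * t\<^sup>2 * norm v * 0"
    by (intro tendsto_intros LIMSEQ_inverse_real_of_nat)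
  then have "(\<lambda>n. (C + D) * t\<^sup>2 * norm v * inverse (real (Suc n))) \<longlonglongrightarrow> 0" by simp
  from Lim_null_comparison[OF b this] show ?thesis by (rule LIM_zero_cancel)
qed

section \<open>Dirac matrices, the free propagator and its Trotter products\<close>

lemma scaleR_eq_smult: "r *\<^sub>R v = complex_of_real r *s (v :: complex ^ 'n)"
  by (simp add: vec_eq_iff scaleR_conv_of_real[where 'a=complex])

lemma sa_involution_matrix:
  assumes "hermitian_matrix M" "M ** M = mat 1"
  shows "sa_involution (\<lambda>v. M *v v)"
  unfolding sa_involution_def
proof (intro conjI allI linear_matrix_vector_mult matrix_vector_mult_smult hermitian_inner assms(1))
  fix v show "M *v (M *v v) = v"
    by (simp add: matrix_vector_mul_assoc assms(2))
qed

lemma dirac_symbol_apply: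
  "dirac_symbol \<alpha> \<beta> m p *v v = (\<Sum>k\<in>UNIV. (p $ k) *\<^sub>R (\<alpha> k *v v)) + m *\<^sub>R (\<beta> *v v)"
  by (simp add: dirac_symbol_def matrix_vector_mult_add_rdistrib sum_matrix_vector_mult scaleR_matrix_vector_mult)

lemma dirac_symbol_add:
  "dirac_symbol \<alpha> \<beta> (m + m') (p + q) *v v = dirac_symbol \<alpha> \<beta> m p *v v + dirac_symbol \<alpha> \<beta> m' q *v v"
  by (simp add: dirac_symbol_apply sum.distrib scaleR_left_distrib)

lemma dirac_symbol_scaleR:
  "dirac_symbol \<alpha> \<beta> (r * m) (r *\<^sub>R p) *v v = r *\<^sub>R (dirac_symbol \<alpha> \<beta> m p *v v)"
  by (simp add: dirac_symbol_apply scaleR_sum_right scaleR_add_right)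

definition energy :: "real \<Rightarrow> real ^ 3 \<Rightarrow> real" where
  "energy m p = sqrt ((norm p)\<^sup>2 + m\<^sup>2)"

lemma energy_pos: "m > 0 \<Longrightarrow> energy m p > 0"
  unfolding energy_def by (simp add: add_nonneg_pos)

lemma energy_power2: "(energy m p)\<^sup>2 = (norm p)\<^sup>2 + m\<^sup>2"
  unfolding energy_def by simp

text \<open>The sign of the energy, h/\<omega>. It is an involution because h^2 = \<omega>^2, so
  that e^(\<i>th) is its rotor through the angle t\<omega>.\<close>

definition velocity :: "(3 \<Rightarrow> complex ^ 4 ^ 4) \<Rightarrow> complex ^ 4 ^ 4 \<Rightarrow> real \<Rightarrow> real ^ 3 \<Rightarrow> complex ^ 4 \<Rightarrow> complex ^ 4" where
  "velocity \<alpha> \<beta> m p v = (1 / energy m p) *\<^sub>R (dirac_symbol \<alpha> \<beta> m p *v v)"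

definition free_group :: "(3 \<Rightarrow> complex ^ 4 ^ 4) \<Rightarrow> complex ^ 4 ^ 4 \<Rightarrow> real \<Rightarrow> real \<Rightarrow> real ^ 3 \<Rightarrow> complex ^ 4 \<Rightarrow> complex ^ 4" where
  "free_group \<alpha> \<beta> m t p = rotor (velocity \<alpha> \<beta> m p) (t * energy m p)"

text \<open>Each \<alpha>-factor involves a single coordinate of p, so in position space it is a
  combination of two translations along one axis; the \<beta>-factor is constant in p. Their product
  has the same first-order term as the propagator.\<close>

definition trotter_step :: "(3 \<Rightarrow> complex ^ 4 ^ 4) \<Rightarrow> complex ^ 4 ^ 4 \<Rightarrow> real \<Rightarrow> real \<Rightarrow> real ^ 3 \<Rightarrow> complex ^ 4 \<Rightarrow> complex ^ 4" where
  "trotter_step \<alpha> \<beta> m \<tau> p v =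
     rotor (\<lambda>v. \<alpha> 1 *v v) (\<tau> * p $ 1) (rotor (\<lambda>v. \<alpha> 2 *v v) (\<tau> * p $ 2)
       (rotor (\<lambda>v. \<alpha> 3 *v v) (\<tau> * p $ 3) (rotor (\<lambda>v. \<beta> *v v) (\<tau> * m) v)))"

context
  fixes \<alpha> :: "3 \<Rightarrow> complex ^ 4 ^ 4" and \<beta> :: "complex ^ 4 ^ 4"
  assumes dm: "dirac_matrices \<alpha> \<beta>"
begin

lemma dirac_relations:
  "\<alpha> j ** \<alpha> k + \<alpha> k ** \<alpha> j = mat (if j = k then 2 else 0)" "\<alpha> k ** \<beta> + \<beta> ** \<alpha> k = 0"
proof -
  note c = dm[unfolded dirac_matrices_def, THEN conjunct2, THEN conjunct2]
  show "\<alpha> j ** \<alpha> k + \<alpha> k ** \<alpha> j = mat (if j = k then 2 else 0)"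
    by (rule c[THEN conjunct1, THEN spec, THEN spec])
  show "\<alpha> k ** \<beta> + \<beta> ** \<alpha> k = 0"
    by (rule c[THEN conjunct2, THEN conjunct1, THEN spec])
qed

lemma alpha_involution: "sa_involution (\<lambda>v. \<alpha> k *v v)"
proof (rule sa_involution_matrix)
  show "hermitian_matrix (\<alpha> k)" using dm by (simp add: dirac_matrices_def)
  have "\<alpha> k ** \<alpha> k + \<alpha> k ** \<alpha> k = mat 2" using dirac_relations(1)[of k k] by simp
  then have "(\<alpha> k ** \<alpha> k + \<alpha> k ** \<alpha> k) $ i $ j = (mat 2 :: complex ^ 4 ^ 4) $ i $ j" for i j by simp
  then have "(\<alpha> k ** \<alpha> k) $ i $ j = (mat 1 :: complex ^ 4 ^ 4) $ i $ j" for i j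
    by (simp add: mat_def split: if_splits) (metis mult_cancel_left1 mult_eq_0_iff zero_neq_numeral)
  then show "\<alpha> k ** \<alpha> k = mat 1" by (simp add: vec_eq_iff)
qed

lemma beta_involution: "sa_involution (\<lambda>v. \<beta> *v v)"
  using dm by (intro sa_involution_matrix) (auto simp: dirac_matrices_def)

lemma alpha_anticommute: "\<alpha> j *v (\<alpha> k *v v) + \<alpha> k *v (\<alpha> j *v v) = (if j = k then 2 else 0) *\<^sub>R v"
proof -
  have "\<alpha> j *v (\<alpha> k *v v) + \<alpha> k *v (\<alpha> j *v v) = (\<alpha> j ** \<alpha> k + \<alpha> k ** \<alpha> j) *v v"
    by (simp add: matrix_vector_mul_assoc matrix_vector_mult_add_rdistrib)
  also have "\<alpha> j ** \<alpha> k + \<alpha> k ** \<alpha> j = mat (if j = k then 2 else 0)"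
    by (rule dirac_relations(1))
  also have "\<dots> *v v = (if j = k then 2 else 0) *\<^sub>R v"
    by (simp add: mat_matrix_vector_mult vec_eq_iff scaleR_conv_of_real)
  finally show ?thesis .
qed

lemma beta_anticommute: "\<alpha> k *v (\<beta> *v v) + \<beta> *v (\<alpha> k *v v) = 0"
proof -
  have "\<alpha> k *v (\<beta> *v v) + \<beta> *v (\<alpha> k *v v) = (\<alpha> k ** \<beta> + \<beta> ** \<alpha> k) *v v"
    by (simp add: matrix_vector_mul_assoc matrix_vector_mult_add_rdistrib)
  also have "\<alpha> k ** \<beta> + \<beta> ** \<alpha> k = 0"
    by (rule dirac_relations(2))
  finally show ?thesis by simp
qed

text \<open>The polarised form of h^2 = \<omega>^2, with separate masses. With the masses m and 0 it
  gives the cross term of the square of h(p) + z e\<alpha> at complex z.\<close>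

lemma dirac_symbol_anticommute:
  "dirac_symbol \<alpha> \<beta> m p *v (dirac_symbol \<alpha> \<beta> m' q *v v) + dirac_symbol \<alpha> \<beta> m' q *v (dirac_symbol \<alpha> \<beta> m p *v v)
     = (2 * (p \<bullet> q + m * m')) *\<^sub>R v"
proof -
  note lin = linear_add[OF linear_matrix_vector_mult] linear_scale[OF linear_matrix_vector_mult] linear_sum[OF linear_matrix_vector_mult]
  have bb: "\<beta> *v (\<beta> *v v) = v" using beta_involution by (simp add: sa_involution_def)
  have ex: "dirac_symbol \<alpha> \<beta> m p *v (dirac_symbol \<alpha> \<beta> m' q *v v)
     = (\<Sum>j\<in>UNIV. \<Sum>k\<in>UNIV. (p $ j * q $ k) *\<^sub>R (\<alpha> j *v (\<alpha> k *v v))) + (\<Sum>j\<in>UNIV. (m' * p $ j) *\<^sub>R (\<alpha> j *v (\<beta> *v v)))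
       + (\<Sum>k\<in>UNIV. (m * q $ k) *\<^sub>R (\<beta> *v (\<alpha> k *v v))) + (m * m') *\<^sub>R v" for m p m' q
  proof -
    have a: "M *v (dirac_symbol \<alpha> \<beta> m' q *v v) = (\<Sum>k\<in>UNIV. q $ k *\<^sub>R (M *v (\<alpha> k *v v))) + m' *\<^sub>R (M *v (\<beta> *v v))" for M :: "complex ^ 4 ^ 4"
      by (simp only: dirac_symbol_apply lin)
    show ?thesis
      unfolding dirac_symbol_apply[of \<alpha> \<beta> m p "dirac_symbol \<alpha> \<beta> m' q *v v"] a[of "\<alpha> _"] a[of \<beta>]
      by (simp add: bb scaleR_add_right scaleR_sum_right sum.distrib mult.commute[of m'])
  qed
  have s: "(\<Sum>j\<in>UNIV. \<Sum>k\<in>UNIV. (q $ j * p $ k) *\<^sub>R (\<alpha> j *v (\<alpha> k *v v))) = (\<Sum>j\<in>UNIV. \<Sum>k\<in>UNIV. (p $ j * q $ k) *\<^sub>R (\<alpha> k *v (\<alpha> j *v v)))"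
    by (subst sum.swap) (simp add: mult.commute)
  have aa: "(\<Sum>j\<in>UNIV. \<Sum>k\<in>UNIV. (p $ j * q $ k) *\<^sub>R (\<alpha> j *v (\<alpha> k *v v))) + (\<Sum>j\<in>UNIV. \<Sum>k\<in>UNIV. (p $ j * q $ k) *\<^sub>R (\<alpha> k *v (\<alpha> j *v v)))
     = (2 * (p \<bullet> q)) *\<^sub>R v"
  proof -
    have "(\<Sum>j\<in>UNIV. \<Sum>k\<in>UNIV. (p $ j * q $ k) *\<^sub>R (\<alpha> j *v (\<alpha> k *v v))) + (\<Sum>j\<in>UNIV. \<Sum>k\<in>UNIV. (p $ j * q $ k) *\<^sub>R (\<alpha> k *v (\<alpha> j *v v)))
       = (\<Sum>j\<in>UNIV. \<Sum>k\<in>UNIV. (p $ j * q $ k) *\<^sub>R ((if j = k then 2 else 0) *\<^sub>R v))"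
      unfolding sum.distrib[symmetric] scaleR_add_right[symmetric] alpha_anticommute ..
    also have "\<dots> = (\<Sum>j\<in>UNIV. (p $ j * q $ j * 2) *\<^sub>R v)"
      by (intro sum.cong refl) (simp add: if_distrib[of "\<lambda>x. _ * x"] if_distrib[of "\<lambda>x. x *\<^sub>R _"] if_distrib[of "\<lambda>x. _ *\<^sub>R x"] cong: if_cong)
    also have "\<dots> = (2 * (p \<bullet> q)) *\<^sub>R v"
      by (simp add: inner_vec_def scaleR_sum_left[symmetric] sum_distrib_left mult_ac)
    finally show ?thesis .
  qed
  have ab: "(\<Sum>j\<in>UNIV. (r * s $ j) *\<^sub>R (\<alpha> j *v (\<beta> *v v))) + (\<Sum>j\<in>UNIV. (r * s $ j) *\<^sub>R (\<beta> *v (\<alpha> j *v v))) = 0" for r and s :: "real ^ 3"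
    unfolding sum.distrib[symmetric] scaleR_add_right[symmetric] beta_anticommute by simp
  show ?thesis
  proof -
    have r: "(a + b + c + d) + (a' + b' + c' + d') = (a + a') + (b + c') + (b' + c) + (d + d')" for a b c d a' b' c' d' :: "complex ^ 4"
      by (simp add: add_ac)
    have "2 * (p \<bullet> q) + 0 + 0 + (m * m' + m' * m) = 2 * (p \<bullet> q + m * m')" by simp
    from arg_cong[OF this, of "\<lambda>r. r *\<^sub>R v"]
    have f: "(2 * (p \<bullet> q)) *\<^sub>R v + 0 + 0 + ((m * m') *\<^sub>R v + (m' * m) *\<^sub>R v) = (2 * (p \<bullet> q + m * m')) *\<^sub>R v"
      by (simp only: scaleR_left_distrib add_0_right)
    show ?thesis
      unfolding ex s r aa ab by (rule f)
  qed
qed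

lemma dirac_symbol_square:
  "dirac_symbol \<alpha> \<beta> m p *v (dirac_symbol \<alpha> \<beta> m p *v v) = ((norm p)\<^sup>2 + m\<^sup>2) *\<^sub>R v"
proof -
  have e: "2 * (p \<bullet> p + m * m) = 2 * ((norm p)\<^sup>2 + m\<^sup>2)"
    by (simp add: power2_norm_eq_inner power2_eq_square[of m])
  have "2 *\<^sub>R (dirac_symbol \<alpha> \<beta> m p *v (dirac_symbol \<alpha> \<beta> m p *v v)) = 2 *\<^sub>R (((norm p)\<^sup>2 + m\<^sup>2) *\<^sub>R v)"
    using dirac_symbol_anticommute[of m p m p v]
    unfolding e scaleR_2 by (simp add: scaleR_left_distrib[symmetric])
  then show ?thesis by (simp only: scaleR_cancel_left) simp
qed

lemma dirac_symbol_inner: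
  "inner (dirac_symbol \<alpha> \<beta> m p *v v) w = inner v (dirac_symbol \<alpha> \<beta> m p *v w)"
proof -
  have "inner (\<alpha> k *v v) w = inner v (\<alpha> k *v w)" for k
    using alpha_involution unfolding sa_involution_def by blast
  moreover have "inner (\<beta> *v v) w = inner v (\<beta> *v w)"
    using beta_involution unfolding sa_involution_def by blast
  ultimately show ?thesis
    unfolding dirac_symbol_apply by (simp add: inner_add_left inner_add_right inner_sum_left inner_sum_right)
qed

lemma norm_dirac_symbol: "norm (dirac_symbol \<alpha> \<beta> m p *v v) = energy m p * norm v"
proof -
  have "(norm (dirac_symbol \<alpha> \<beta> m p *v v))\<^sup>2 = (energy m p * norm v)\<^sup>2"
    by (simp add: power2_norm_eq_inner dirac_symbol_inner dirac_symbol_square power_mult_distrib energy_power2)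
  then show ?thesis by (simp add: power2_eq_iff_nonneg energy_def)
qed

context
  fixes m :: real
  assumes m: "m > 0"
begin

lemma velocity_involution: "sa_involution (velocity \<alpha> \<beta> m p)"
  unfolding sa_involution_def
proof (intro conjI allI)
  note l = linear_matrix_vector_mult
  show "linear (velocity \<alpha> \<beta> m p)"
    by (rule linearI) (simp_all add: velocity_def linear_add[OF l] linear_scale[OF l] scaleR_add_right)
  fix v w and c :: complex
  show "velocity \<alpha> \<beta> m p (c *s v) = c *s velocity \<alpha> \<beta> m p v"
    by (simp add: velocity_def matrix_vector_mult_smult smult_scaleR)
  show "velocity \<alpha> \<beta> m p (velocity \<alpha> \<beta> m p v) = v"
    using energy_pos[OF m, of p]
    by (simp add: velocity_def linear_scale[OF l] dirac_symbol_square energy_power2[symmetric] power2_eq_square[of "energy m p"])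
  show "inner (velocity \<alpha> \<beta> m p v) w = inner v (velocity \<alpha> \<beta> m p w)"
    by (simp add: velocity_def dirac_symbol_inner)
qed

lemma norm_free_group: "norm (free_group \<alpha> \<beta> m t p v) = norm v"
  unfolding free_group_def by (rule norm_rotor[OF velocity_involution])

lemma free_group_add: "free_group \<alpha> \<beta> m s p (free_group \<alpha> \<beta> m t p v) = free_group \<alpha> \<beta> m (s + t) p v"
  unfolding free_group_def by (simp add: rotor_rotor[OF velocity_involution] algebra_simps)

lemma free_group_eq:
  "free_group \<alpha> \<beta> m t p v = cos (t * energy m p) *\<^sub>R v + (sin (t * energy m p) / energy m p) *\<^sub>R (\<i> *s (dirac_symbol \<alpha> \<beta> m p *v v))"
  unfolding free_group_def rotor_def velocity_def by (simp add: smult_scaleR)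

text \<open>The exponent acts as a scalar c = \<i>t\<omega> times the involution X, so its even
  powers are scalars and its odd powers multiples of X; the series splits into those of cosine and
  sine. Convergence is checked entry by entry, on the images of the basis vectors.\<close>

lemma matrix_exp_dirac_symbol:
  "matrix_exp (mat (\<i> * complex_of_real t) ** dirac_symbol \<alpha> \<beta> m p) *v v = free_group \<alpha> \<beta> m t p v"
proof -
  define A where "A = mat (\<i> * complex_of_real t) ** dirac_symbol \<alpha> \<beta> m p"
  define \<theta> where "\<theta> = t * energy m p"
  define c where "c = \<i> * complex_of_real \<theta>"
  define X where "X = velocity \<alpha> \<beta> m p"
  have X: "sa_involution X" unfolding X_def by (rule velocity_involution)
  have Xl: "linear X" and Xs: "\<And>c v. X (c *s v) = c *s X v" and XX: "\<And>v. X (X v) = v"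
    using X by (auto simp: sa_involution_def)
  have Av: "A *v v = c *s X v" for v
    using energy_pos[OF m, of p]
    by (simp add: A_def c_def X_def \<theta>_def velocity_def matrix_vector_mul_assoc[symmetric] mat_matrix_vector_mult scaleR_eq_smult smult_smult)
  define P where "P n = (((**) A ^^ n) (mat 1))" for n
  \<comment> \<open>The coefficients (c^n + (-c)^n)/2 and (c^n - (-c)^n)/2 encode the parity of n
    without a case distinction, and they sum directly to exponentials of c and -c.\<close>
  have Pv: "P n *v v = ((c ^ n + (- c) ^ n) / 2) *s v + ((c ^ n - (- c) ^ n) / 2) *s X v" for n v
  proof (induction n)
    case 0 then show ?case by (simp add: P_def mat_matrix_vector_mult vec_eq_iff)
  next
    case (Suc n)
    have "P (Suc n) *v v = A *v (P n *v v)" by (simp add: P_def matrix_vector_mul_assoc)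
    also have "\<dots> = ((c ^ Suc n + (- c) ^ Suc n) / 2) *s v + ((c ^ Suc n - (- c) ^ Suc n) / 2) *s X v"
      unfolding Suc Av linear_add[OF Xl] Xs XX smult_add smult_smult
      by (simp add: vec_eq_iff algebra_simps diff_divide_distrib add_divide_distrib)
    finally show ?case .
  qed
  have Pij: "P n $ i $ j = ((c ^ n + (- c) ^ n) / 2) * axis j 1 $ i + ((c ^ n - (- c) ^ n) / 2) * X (axis j 1) $ i" for n i j
  proof -
    have "P n $ i $ j = (P n *v axis j 1) $ i" by (simp add: matrix_vector_mult_def axis_def if_distrib[of "\<lambda>x. _ * x"] cong: if_cong)
    then show ?thesis by (simp add: Pv)
  qed
  define E :: "complex ^ 4 ^ 4" where "E = (\<chi> i j. complex_of_real (cos \<theta>) * (axis j 1 :: complex ^ 4) $ i + (\<i> * complex_of_real (sin \<theta>)) * X (axis j 1) $ i)"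
  have "(\<lambda>n. inverse (fact n) *\<^sub>R P n) sums E"
    unfolding sums_def
  proof (intro vec_tendstoI)
    fix i j
    have "(\<lambda>n. inverse (fact n) *\<^sub>R (P n $ i $ j)) sums (E $ i $ j)"
    proof -
      have e: "(\<lambda>n. inverse (fact n) *\<^sub>R c ^ n) sums exp c" "(\<lambda>n. inverse (fact n) *\<^sub>R (- c) ^ n) sums exp (- c)"
        using exp_converges[of c] exp_converges[of "- c"] by simp_all
      have "(\<lambda>n. (inverse (fact n) *\<^sub>R c ^ n + inverse (fact n) *\<^sub>R (- c) ^ n) / 2 * axis j 1 $ i
          + (inverse (fact n) *\<^sub>R c ^ n - inverse (fact n) *\<^sub>R (- c) ^ n) / 2 * X (axis j 1) $ i)
         sums ((exp c + exp (- c)) / 2 * axis j 1 $ i + (exp c - exp (- c)) / 2 * X (axis j 1) $ i)"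
        by (intro sums_add sums_diff sums_mult2 sums_divide e)
      also have "(exp c + exp (- c)) / 2 = cos \<theta>"
        unfolding c_def exp_Euler exp_minus_Euler by (simp add: cos_of_real)
      also have "(exp c - exp (- c)) / 2 = \<i> * sin \<theta>"
        unfolding c_def exp_Euler exp_minus_Euler by (simp add: sin_of_real)
      finally show ?thesis
        unfolding Pij E_def by (simp add: scaleR_conv_of_real algebra_simps add_divide_distrib diff_divide_distrib)
    qed
    then show "(\<lambda>n. (\<Sum>n<n. inverse (fact n) *\<^sub>R P n) $ i $ j) \<longlonglongrightarrow> E $ i $ j"
      unfolding sums_def by simp
  qed
  then have mE: "matrix_exp A = E"
    unfolding matrix_exp_def P_def by (rule sums_unique[symmetric])
  have "E *v v = rotor X \<theta> v"
  proof -
    have v: "v = (\<Sum>j\<in>UNIV. v $ j *s axis j 1)" by (rule basis_expansion[symmetric])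
    have "X v = (\<Sum>j\<in>UNIV. v $ j *s X (axis j 1))"
      by (subst v, subst linear_sum[OF Xl]) (simp add: Xs)
    then have Xv: "X v $ i = (\<Sum>j\<in>UNIV. v $ j * X (axis j 1) $ i)" for i by simp
    have vi: "v $ i = (\<Sum>j\<in>UNIV. v $ j * axis j 1 $ i)" for i
      by (subst v) simp
    show ?thesis
      by (simp add: vec_eq_iff rotor_def E_def matrix_vector_mult_def distrib_right sum.distrib Xv scaleR_conv_of_real[where 'a=complex])
         (subst vi, simp add: sum_distrib_left mult_ac)
  qed
  then show ?thesis
    using mE unfolding A_def free_group_def X_def \<theta>_def by simp
qed

lemma trotter_limit:
  "(\<lambda>n. (trotter_step \<alpha> \<beta> m (t / real (Suc n)) p ^^ Suc n) v) \<longlonglongrightarrow> free_group \<alpha> \<beta> m t p v"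
proof (rule lie_product_limit[where G="\<lambda>\<tau>. free_group \<alpha> \<beta> m \<tau> p" and X="\<lambda>v. \<i> *s (dirac_symbol \<alpha> \<beta> m p *v v)"])
  note fo = first_order_rotor[OF alpha_involution] first_order_rotor[OF beta_involution]
  have "first_order (\<lambda>\<tau>. trotter_step \<alpha> \<beta> m \<tau> p)
     (\<lambda>v. (p $ 1) *\<^sub>R (\<i> *s (\<alpha> 1 *v v)) + ((p $ 2) *\<^sub>R (\<i> *s (\<alpha> 2 *v v)) + ((p $ 3) *\<^sub>R (\<i> *s (\<alpha> 3 *v v)) + m *\<^sub>R (\<i> *s (\<beta> *v v)))))"
    unfolding trotter_step_def[abs_def]
    by (rule first_order_comp[OF fo(1) first_order_comp[OF fo(1) first_order_comp[OF fo(1) fo(2)]]])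
  also have "(\<lambda>v. (p $ 1) *\<^sub>R (\<i> *s (\<alpha> 1 *v v)) + ((p $ 2) *\<^sub>R (\<i> *s (\<alpha> 2 *v v)) + ((p $ 3) *\<^sub>R (\<i> *s (\<alpha> 3 *v v)) + m *\<^sub>R (\<i> *s (\<beta> *v v)))))
     = (\<lambda>v. \<i> *s (dirac_symbol \<alpha> \<beta> m p *v v))"
    by (simp add: fun_eq_iff dirac_symbol_apply sum_3 smult_add smult_scaleR add.assoc)
  finally show "first_order (\<lambda>\<tau>. trotter_step \<alpha> \<beta> m \<tau> p) (\<lambda>v. \<i> *s (dirac_symbol \<alpha> \<beta> m p *v v))" .
  have "first_order (\<lambda>\<tau>. free_group \<alpha> \<beta> m \<tau> p) (\<lambda>v. energy m p *\<^sub>R (\<i> *s velocity \<alpha> \<beta> m p v))"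
    unfolding free_group_def by (rule first_order_rotor[OF velocity_involution])
  also have "(\<lambda>v. energy m p *\<^sub>R (\<i> *s velocity \<alpha> \<beta> m p v)) = (\<lambda>v. \<i> *s (dirac_symbol \<alpha> \<beta> m p *v v))"
    using energy_pos[OF m, of p] by (simp add: fun_eq_iff velocity_def smult_scaleR)
  finally show "first_order (\<lambda>\<tau>. free_group \<alpha> \<beta> m \<tau> p) (\<lambda>v. \<i> *s (dirac_symbol \<alpha> \<beta> m p *v v))" .
  fix \<tau> v n
  note lr = linear_rotor[OF alpha_involution] linear_rotor[OF beta_involution]
  show "linear (trotter_step \<alpha> \<beta> m \<tau> p)"
    by (rule linearI) (simp_all add: trotter_step_def linear_add[OF lr(1)] linear_add[OF lr(2)] linear_scale[OF lr(1)] linear_scale[OF lr(2)])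
  show "norm (trotter_step \<alpha> \<beta> m \<tau> p v) = norm v"
    by (simp add: trotter_step_def norm_rotor[OF alpha_involution] norm_rotor[OF beta_involution])
  show "norm (free_group \<alpha> \<beta> m \<tau> p v) = norm v" by (rule norm_free_group)
next
  fix n
  show "(free_group \<alpha> \<beta> m (t / real (Suc n)) p ^^ Suc n) v = free_group \<alpha> \<beta> m t p v"
    unfolding free_group_def rotor_funpow[OF velocity_involution] by simp
qed

lemma norm_trotter_funpow: "norm ((trotter_step \<alpha> \<beta> m \<tau> p ^^ n) v) = norm v"
  by (induction n) (simp_all add: trotter_step_def norm_rotor[OF alpha_involution] norm_rotor[OF beta_involution])

end
end

section \<open>Entire functions of exponential type\<close>

text \<open>If |arg w| \<le> \<pi>/4, then w^(3/2) has argument at most 3\<pi>/8 < \<pi>/2, so its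
  real part is comparable to its modulus. For the square root a + \<i>b it is enough that |b| \<le>
  a/2: then a^2 \<ge> (4/5)|w| and a^2 - 3b^2 \<ge> a^2/4, which are the constants in the
  statement.\<close>

lemma Re_csqrt_cube_ge:
  assumes "\<bar>Im w\<bar> \<le> Re w"
  shows "Re (csqrt w ^ 3) \<ge> sqrt (4 / 5 * norm w) ^ 3 / 4"
proof -
  define a b where "a = Re (csqrt w)" and "b = Im (csqrt w)"
  have "w = csqrt w ^ 2" by simp
  then have w: "w = Complex a b ^ 2" unfolding a_def b_def complex_surj .
  have a0: "a \<ge> 0" unfolding a_def using csqrt_principal[of w] by auto
  have Rw: "Re w = a\<^sup>2 - b\<^sup>2" and Iw: "Im w = 2 * a * b" unfolding w by (simp_all add: power2_eq_square)
  have nw: "norm w = a\<^sup>2 + b\<^sup>2" unfolding w norm_power by (simp add: cmod_power2)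
  have le: "2 * a * \<bar>b\<bar> \<le> a\<^sup>2 - b\<^sup>2" using assms a0 by (simp add: Rw Iw abs_mult)
  have ba: "\<bar>b\<bar> \<le> a / 2"
  proof (rule ccontr)
    assume "\<not> ?thesis"
    then have c: "a < 2 * \<bar>b\<bar>" by simp
    then have "a * a \<le> a * (2 * \<bar>b\<bar>)" using a0 by (intro mult_left_mono) auto
    moreover have "b\<^sup>2 > 0" using c a0 by auto
    ultimately show False using le by (simp add: power2_eq_square)
  qed
  then have b2: "b\<^sup>2 \<le> a\<^sup>2 / 4"
    using power_mono[OF ba, of 2] by (simp add: power_divide)
  have "a\<^sup>2 \<ge> 4 / 5 * norm w" using b2 nw by simp
  then have "a \<ge> sqrt (4 / 5 * norm w)" using a0 by (simp add: real_le_lsqrt)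
  then have s: "a ^ 3 \<ge> sqrt (4 / 5 * norm w) ^ 3" by (intro power_mono) auto
  have "Re (csqrt w ^ 3) = a * (a\<^sup>2 - 3 * b\<^sup>2)"
    by (simp add: a_def b_def power3_eq_cube power2_eq_square algebra_simps)
  also have "\<dots> \<ge> a * (a\<^sup>2 / 4)" using a0 b2 by (intro mult_left_mono) auto
  finally show ?thesis using s by (simp add: power3_eq_cube power2_eq_square)
qed

lemma phragmen_lindelof_quadrant:
  fixes f :: "complex \<Rightarrow> complex"
  assumes cont: "continuous_on {z. 0 \<le> Re z \<and> 0 \<le> Im z} f"
    and hol: "f holomorphic_on {z. 0 < Re z \<and> 0 < Im z}"
    and growth: "\<And>z. 0 \<le> Re z \<Longrightarrow> 0 \<le> Im z \<Longrightarrow> norm (f z) \<le> K * exp (B * norm z)"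
    and bd: "\<And>z. 0 \<le> Re z \<Longrightarrow> 0 \<le> Im z \<Longrightarrow> Re z = 0 \<or> Im z = 0 \<Longrightarrow> norm (f z) \<le> M"
    and z0: "0 \<le> Re z0" "0 \<le> Im z0"
  shows "norm (f z0) \<le> M"
proof -
  \<comment> \<open>The factor 1 - \<i> turns the quadrant into the sector |arg| \<le> \<pi>/4; the
    shift by 1 keeps it away from the branch point of the square root.\<close>
  define w where "w z = (1 + z) * (1 - \<i>)" for z
  define s where "s z = csqrt (w z) ^ 3" for z
  have w: "\<bar>Im (w z)\<bar> \<le> Re (w z)" "Re (w z) > 0" "norm (w z) \<ge> norm z * sqrt 2" if "0 \<le> Re z" "0 \<le> Im z" for z
  proof -
    show "\<bar>Im (w z)\<bar> \<le> Re (w z)" "Re (w z) > 0" using that by (auto simp: w_def algebra_simps)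
    have "norm z \<le> norm (1 + z)" using that by (simp add: cmod_def power2_eq_square algebra_simps)
    moreover have "norm (1 - \<i>) = sqrt 2" by (simp add: cmod_def)
    ultimately show "norm (w z) \<ge> norm z * sqrt 2" by (simp add: w_def norm_mult)
  qed
  have sR: "Re (s z) \<ge> sqrt (norm z) ^ 3 / 4" if "0 \<le> Re z" "0 \<le> Im z" for z
  proof -
    have "5 / 4 \<le> sqrt 2" by (rule real_le_rsqrt) (simp add: power2_eq_square)
    then have "norm z * (5 / 4) \<le> norm z * sqrt 2" by (intro mult_left_mono) auto
    also have "\<dots> \<le> norm (w z)" by (rule w(3)[OF that])
    finally have "norm z \<le> 4 / 5 * norm (w z)" by simp
    then have "sqrt (norm z) ^ 3 \<le> sqrt (4 / 5 * norm (w z)) ^ 3" by (intro power_mono) auto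
    then show ?thesis using Re_csqrt_cube_ge[OF w(1)[OF that]] unfolding s_def by linarith
  qed
  have s_cont: "continuous_on {z. 0 \<le> Re z \<and> 0 \<le> Im z} s"
    unfolding s_def
  proof (intro continuous_intros continuous_on_compose2[OF continuous_on_csqrt])
    show "w ` {z. 0 \<le> Re z \<and> 0 \<le> Im z} \<subseteq> - \<real>\<^sub>\<le>\<^sub>0" using w(2) by (auto simp: complex_nonpos_Reals_iff) fastforce
  qed (auto simp: w_def complex_nonpos_Reals_iff intro!: continuous_intros)
  have s_hol: "s holomorphic_on {z. 0 < Re z \<and> 0 < Im z}"
    unfolding s_def w_def
    by (intro holomorphic_intros) (use w(2) in \<open>force simp: w_def complex_nonpos_Reals_iff\<close>)
  \<comment> \<open>A bound \<open>M'\<close> strictly above \<open>M\<close> is positive even if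
    \<open>M\<close> is 0, which leaves room for the small but nonzero values on the arc.\<close>
  have le: "norm (f z0) * exp (- \<epsilon> * Re (s z0)) \<le> M'" if "\<epsilon> > 0" and M': "M' > M" for \<epsilon> M'
  proof -
    let ?Q = "{z. 0 \<le> Re z \<and> 0 \<le> Im z}" and ?P = "{z. 0 < Re z \<and> 0 < Im z}"
    have "M \<ge> 0" using order_trans[OF norm_ge_zero bd[of 0]] by simp
    then have M'0: "M' > 0" using M' by simp
    have "((\<lambda>R. \<bar>K\<bar> * exp (- R)) \<longlongrightarrow> \<bar>K\<bar> * 0) at_top"
      by (intro tendsto_intros filterlim_compose[OF exp_at_bot] filterlim_uminus_at_bot_at_top)
    then have "\<forall>\<^sub>F R in at_top. \<bar>K\<bar> * exp (- R) < M'"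
      using M'0 by (intro order_tendstoD(2)) auto
    then have "\<forall>\<^sub>F R in at_top. K * exp (B * R - \<epsilon> * (sqrt R ^ 3 / 4)) < M'"
      using eventually_ge_at_top[of "(4 * (\<bar>B\<bar> + 1) / \<epsilon>)\<^sup>2"] eventually_ge_at_top[of 0]
    proof eventually_elim
      case (elim R)
      have "sqrt R \<ge> 4 * (\<bar>B\<bar> + 1) / \<epsilon>" by (rule real_le_rsqrt[OF elim(2)])
      then have "\<epsilon> * sqrt R \<ge> 4 * (\<bar>B\<bar> + 1)" using \<open>\<epsilon> > 0\<close> by (simp add: divide_le_eq mult.commute)
      then have "R * (\<epsilon> * sqrt R) \<ge> R * (4 * (\<bar>B\<bar> + 1))" by (rule mult_left_mono) (rule elim(3))
      moreover have "sqrt R ^ 3 = R * sqrt R" using elim(3) by (simp add: power3_eq_cube)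
      moreover have "R * B \<le> R * \<bar>B\<bar>" using elim(3) by (intro mult_left_mono) auto
      ultimately have "B * R - \<epsilon> * (sqrt R ^ 3 / 4) \<le> - R" by (simp add: algebra_simps)
      then have "\<bar>K\<bar> * exp (B * R - \<epsilon> * (sqrt R ^ 3 / 4)) \<le> \<bar>K\<bar> * exp (- R)" by (intro mult_left_mono) auto
      moreover have "K * exp (B * R - \<epsilon> * (sqrt R ^ 3 / 4)) \<le> \<bar>K\<bar> * exp (B * R - \<epsilon> * (sqrt R ^ 3 / 4))"
        by (intro mult_right_mono) auto
      ultimately show ?case using elim(1) by linarith
    qed
    then have "\<forall>\<^sub>F R in at_top. K * exp (B * R - \<epsilon> * (sqrt R ^ 3 / 4)) < M' \<and> R > norm z0"
      using eventually_gt_at_top[of "norm z0"] by (rule eventually_conj)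
    from eventually_happens'[OF trivial_limit_at_top_linorder this]
    obtain R where R: "K * exp (B * R - \<epsilon> * (sqrt R ^ 3 / 4)) < M'" "R > norm z0"
      by blast
    define S where "S = ?Q \<inter> cball 0 R"
    define g where "g z = f z * exp (- of_real \<epsilon> * s z)" for z
    have clQ: "closed ?Q"
      unfolding Collect_conj_eq by (intro closed_Int closed_halfspace_Re_ge closed_halfspace_Im_ge)
    have "closed S" unfolding S_def using clQ by auto
    have opn: "open (?P \<inter> ball 0 R)"
      unfolding Collect_conj_eq by (intro open_Int open_halfspace_Re_gt open_halfspace_Im_gt open_ball)
    have int: "?P \<inter> ball 0 R \<subseteq> interior S"
      by (rule interior_maximal[OF _ opn]) (auto simp: S_def)
    have intQ: "interior S \<subseteq> ?P"
    proof
      fix z assume "z \<in> interior S"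
      then obtain e where e: "e > 0" "cball z e \<subseteq> S" by (meson mem_interior_cball)
      have "z - of_real e \<in> S" "z - \<i> * of_real e \<in> S" using e by (auto intro!: subsetD[OF e(2)] simp: dist_norm norm_mult)
      then show "z \<in> ?P" using e(1) by (auto simp: S_def)
    qed
    have ng: "norm (g z) = norm (f z) * exp (- \<epsilon> * Re (s z))" for z
      by (simp add: g_def norm_mult norm_exp_eq_Re)
    have "norm (g z0) \<le> M'"
    proof (rule maximum_modulus_frontier[of g S])
      show "g holomorphic_on interior S"
        unfolding g_def using hol s_hol intQ by (intro holomorphic_intros) (auto intro: holomorphic_on_subset)
      show "continuous_on (closure S) g"
        unfolding g_def using \<open>closed S\<close> by (intro continuous_intros continuous_on_subset[OF cont] continuous_on_subset[OF s_cont]) (auto simp: S_def)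
      show "bounded S" unfolding S_def by (rule bounded_subset[OF bounded_cball]) auto
      show "z0 \<in> S" using z0 R(2) by (simp add: S_def)
      fix z assume "z \<in> frontier S"
      then have zS: "z \<in> S" and "z \<notin> interior S" using \<open>closed S\<close> by (auto simp: frontier_def)
      then have z: "0 \<le> Re z" "0 \<le> Im z" and c: "Re z = 0 \<or> Im z = 0 \<or> norm z = R"
        using int by (force simp: S_def)+
      have e1: "exp (- \<epsilon> * Re (s z)) \<le> exp (- \<epsilon> * (sqrt (norm z) ^ 3 / 4))"
        using sR[OF z] \<open>\<epsilon> > 0\<close> by simp
      show "norm (g z) \<le> M'"
      proof (cases "Re z = 0 \<or> Im z = 0")
        case True
        have "exp (- \<epsilon> * Re (s z)) \<le> 1"
          using e1 \<open>\<epsilon> > 0\<close> by (rule_tac order_trans[OF e1]) simp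
        then have "norm (g z) \<le> norm (f z)" unfolding ng by (intro mult_left_le) auto
        also have "\<dots> \<le> M" by (rule bd[OF z True])
        finally show ?thesis using M' by simp
      next
        case False
        then have zR: "norm z = R" using c by auto
        have "norm (g z) \<le> (K * exp (B * norm z)) * exp (- \<epsilon> * (sqrt (norm z) ^ 3 / 4))"
          unfolding ng by (intro mult_mono growth z e1) (auto intro: order_trans[OF norm_ge_zero growth[OF z]])
        also have "\<dots> = K * exp (B * R - \<epsilon> * (sqrt R ^ 3 / 4))"
          by (simp only: zR mult.assoc exp_add[symmetric]) simp
        finally show ?thesis using R(1) by simp
      qed
    qed
    then show ?thesis by (simp add: ng)
  qed
  show ?thesis
  proof (rule dense_ge)
    fix M' assume M': "M < M'"
    have "((\<lambda>\<epsilon>. norm (f z0) * exp (- \<epsilon> * Re (s z0))) \<longlongrightarrow> norm (f z0) * exp (- 0 * Re (s z0))) (at_right 0)"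
      by (intro tendsto_intros)
    moreover have "\<forall>\<^sub>F \<epsilon> in at_right 0. norm (f z0) * exp (- \<epsilon> * Re (s z0)) \<le> M'"
      by (intro eventually_at_rightI[of 0 1] le[OF _ M']) auto
    ultimately have "norm (f z0) * exp (- 0 * Re (s z0)) \<le> M'"
      by (rule tendsto_upperbound) simp
    then show "norm (f z0) \<le> M'" by simp
  qed
qed

text \<open>Division by (1 + z)^k makes the function bounded on the axes. In the quadrant 1 + |z|
  \<le> 2 |1 + z|, which is the origin of the factor 2^k.\<close>

lemma phragmen_lindelof_quadrant_poly:
  fixes f :: "complex \<Rightarrow> complex"
  assumes hol: "f holomorphic_on UNIV"
    and growth: "\<And>z. norm (f z) \<le> K * exp (B * norm z)"
    and re: "\<And>x. x \<ge> 0 \<Longrightarrow> norm (f (of_real x)) \<le> M * (1 + x) ^ k"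
    and im: "\<And>y. y \<ge> 0 \<Longrightarrow> norm (f (\<i> * of_real y)) \<le> M * (1 + y) ^ k"
    and z: "0 \<le> Re z" "0 \<le> Im z"
  shows "norm (f z) \<le> M * 2 ^ k * (1 + norm z) ^ k"
proof -
  have n1: "norm (1 + z) \<ge> 1" "2 * norm (1 + z) \<ge> 1 + norm z" if "0 \<le> Re z" for z :: complex
  proof -
    have "1 \<le> Re (1 + z)" using that by simp
    also have "\<dots> \<le> norm (1 + z)" by (rule complex_Re_le_cmod)
    finally show a: "norm (1 + z) \<ge> 1" .
    have "norm z \<le> norm (1 + z)" using that by (simp add: cmod_def power2_eq_square algebra_simps)
    with a show "2 * norm (1 + z) \<ge> 1 + norm z" by simp
  qed
  have M0: "M \<ge> 0" using order_trans[OF norm_ge_zero re[of 0]] by simp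
  have K0: "K * exp (B * norm z) \<ge> 0" for z :: complex using growth[of z] norm_ge_zero[of "f z"] by linarith
  have fc: "continuous_on A f" for A
    using hol holomorphic_on_imp_continuous_on continuous_on_subset by blast
  have fh: "f holomorphic_on A" for A using hol holomorphic_on_subset by blast
  have nz: "1 + z \<noteq> 0" if "0 \<le> Re z" for z using n1(1)[OF that] by auto
  have "norm (f z / (1 + z) ^ k) \<le> M * 2 ^ k"
  proof (rule phragmen_lindelof_quadrant[OF _ _ _ _ z, where K=K and B=B])
    show "continuous_on {z. 0 \<le> Re z \<and> 0 \<le> Im z} (\<lambda>z. f z / (1 + z) ^ k)"
      using nz by (intro continuous_intros fc) auto
    show "(\<lambda>z. f z / (1 + z) ^ k) holomorphic_on {z. 0 < Re z \<and> 0 < Im z}"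
      using nz by (intro holomorphic_intros fh) auto
    show "norm (f z / (1 + z) ^ k) \<le> K * exp (B * norm z)" if "0 \<le> Re z" "0 \<le> Im z" for z
    proof -
      have "norm (f z / (1 + z) ^ k) \<le> norm (f z) / 1"
        unfolding norm_divide norm_power using n1(1)[OF that(1)] by (intro divide_left_mono one_le_power mult_pos_pos zero_less_power) auto
      then show ?thesis using growth[of z] by simp
    qed
    show "norm (f z / (1 + z) ^ k) \<le> M * 2 ^ k" if a: "0 \<le> Re z" "0 \<le> Im z" and c: "Re z = 0 \<or> Im z = 0" for z
    proof -
      have "norm (f z) \<le> M * (1 + norm z) ^ k"
      proof (cases "Im z = 0")
        case True
        then have "z = of_real (Re z)" by (simp add: complex_eq_iff)
        then show ?thesis using re[OF a(1)] a(1) by (metis abs_of_nonneg norm_of_real)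
      next
        case False
        then have "z = \<i> * of_real (Im z)" using c by (simp add: complex_eq_iff)
        moreover have "norm (\<i> * of_real (Im z)) = Im z" using a(2) by (simp add: norm_mult)
        ultimately show ?thesis using im[OF a(2)] by metis
      qed
      also have "\<dots> \<le> M * (2 * norm (1 + z)) ^ k"
        using n1(2)[OF a(1)] M0 by (intro mult_left_mono power_mono) auto
      finally show ?thesis using nz[OF a(1)]
        by (simp add: norm_divide norm_power power_mult_distrib divide_le_eq mult_ac)
    qed
  qed
  then have "norm (f z) \<le> M * 2 ^ k * norm (1 + z) ^ k"
    using nz[OF z(1)] by (simp add: norm_divide norm_power divide_le_eq)
  also have "\<dots> \<le> M * 2 ^ k * (1 + norm z) ^ k"
    using M0 norm_triangle_ineq[of 1 z] by (intro mult_left_mono power_mono) auto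
  finally show ?thesis .
qed

section \<open>Entire functions controlled on both axes\<close>

lemma entire_exponential_type_poly_bound:
  fixes f :: "complex \<Rightarrow> complex"
  assumes hol: "f holomorphic_on UNIV"
    and growth: "\<And>z. norm (f z) \<le> K * exp (B * norm z)"
    and re: "\<And>x. norm (f (of_real x)) \<le> M * (1 + \<bar>x\<bar>) ^ k"
    and im: "\<And>y. norm (f (\<i> * of_real y)) \<le> M * (1 + \<bar>y\<bar>) ^ k"
  shows "norm (f z) \<le> M * 2 ^ k * (1 + norm z) ^ k"
proof -
  \<comment> \<open>Multiplication by the unit \<open>c\<close>, a power of \<i>, carries the first
    quadrant onto any of the four; \<open>r\<close> and \<open>i\<close> are the bounds on its two
    sides.\<close>
  have rot: "norm (f (c * z)) \<le> M * 2 ^ k * (1 + norm z) ^ k"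
    if z: "0 \<le> Re z" "0 \<le> Im z" and c: "norm c = 1"
      and r: "\<And>x. x \<ge> 0 \<Longrightarrow> norm (f (c * of_real x)) \<le> M * (1 + x) ^ k"
      and i: "\<And>x. x \<ge> 0 \<Longrightarrow> norm (f (c * (\<i> * of_real x))) \<le> M * (1 + x) ^ k" for c z
  proof (rule phragmen_lindelof_quadrant_poly[OF _ _ _ _ z, where f="\<lambda>z. f (c * z)" and K=K and B=B])
    have "f \<circ> (\<lambda>z. c * z) holomorphic_on UNIV"
      by (intro holomorphic_on_compose holomorphic_on_subset[OF hol] holomorphic_intros) auto
    then show "(\<lambda>z. f (c * z)) holomorphic_on UNIV" by (simp add: o_def)
    show "norm (f (c * z)) \<le> K * exp (B * norm z)" for z
      using growth[of "c * z"] c by (simp add: norm_mult)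
  qed (use r i in auto)
  consider "0 \<le> Re z" "0 \<le> Im z" | "Re z \<le> 0" "0 \<le> Im z" | "Re z \<le> 0" "Im z \<le> 0" | "0 \<le> Re z" "Im z \<le> 0"
    by linarith
  then show ?thesis
  proof cases
    case 1
    then show ?thesis using rot[of z 1] re im by (metis abs_of_nonneg mult_1 norm_one)
  next
    case 2
    have "norm (f (\<i> * (- \<i> * z))) \<le> M * 2 ^ k * (1 + norm (- \<i> * z)) ^ k"
    proof (rule rot)
      fix x :: real assume "x \<ge> 0"
      then show "norm (f (\<i> * of_real x)) \<le> M * (1 + x) ^ k" "norm (f (\<i> * (\<i> * of_real x))) \<le> M * (1 + x) ^ k"
        using im[of x] re[of "- x"] by (simp_all add: mult.assoc[symmetric])
    qed (use 2 in auto)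
    then show ?thesis by (simp add: norm_mult mult.assoc[symmetric])
  next
    case 3
    have "norm (f (- 1 * (- z))) \<le> M * 2 ^ k * (1 + norm (- z)) ^ k"
    proof (rule rot)
      fix x :: real assume "x \<ge> 0"
      then show "norm (f (- 1 * of_real x)) \<le> M * (1 + x) ^ k" "norm (f (- 1 * (\<i> * of_real x))) \<le> M * (1 + x) ^ k"
        using im[of "- x"] re[of "- x"] by simp_all
    qed (use 3 in auto)
    then show ?thesis by simp
  next
    case 4
    have "norm (f (- \<i> * (\<i> * z))) \<le> M * 2 ^ k * (1 + norm (\<i> * z)) ^ k"
    proof (rule rot)
      fix x :: real assume "x \<ge> 0"
      then show "norm (f (- \<i> * of_real x)) \<le> M * (1 + x) ^ k" "norm (f (- \<i> * (\<i> * of_real x))) \<le> M * (1 + x) ^ k"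
        using im[of "- x"] re[of x] by (simp_all add: mult.assoc[symmetric])
    qed (use 4 in auto)
    then show ?thesis by (simp add: norm_mult mult.assoc[symmetric])
  qed
qed

text \<open>By the polynomial bound and Liouville's theorem f is a polynomial. A nonconstant
  polynomial tends to infinity along every ray, so boundedness far out on a single ray leaves only a
  constant.\<close>

lemma entire_exponential_type_constant:
  fixes f :: "complex \<Rightarrow> complex"
  assumes hol: "f holomorphic_on UNIV"
    and growth: "\<And>z. norm (f z) \<le> K * exp (B * norm z)"
    and re: "\<And>x. norm (f (of_real x)) \<le> M * (1 + \<bar>x\<bar>) ^ k"
    and im: "\<And>y. norm (f (\<i> * of_real y)) \<le> M * (1 + \<bar>y\<bar>) ^ k"
    and ray: "c \<noteq> 0" "\<And>x. x \<ge> xmin \<Longrightarrow> norm (f (c * of_real x)) \<le> b"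
  shows "f z = f 0"
proof -
  have M0: "M \<ge> 0" using order_trans[OF norm_ge_zero re[of 0]] by simp
  define a where "a j = (deriv ^^ j) f 0 / fact j" for j
  have poly: "f z = (\<Sum>j\<le>k. a j * z ^ j)" for z
    unfolding a_def
  proof (rule Liouville_polynomial[OF hol, where A=1 and B="M * 2 ^ k * 2 ^ k"])
    fix z :: complex assume "1 \<le> norm z"
    then have "(1 + norm z) ^ k \<le> (2 * norm z) ^ k" by (intro power_mono) auto
    then have "M * 2 ^ k * (1 + norm z) ^ k \<le> M * 2 ^ k * (2 * norm z) ^ k" using M0 by (intro mult_left_mono) auto
    with entire_exponential_type_poly_bound[OF assms(1-4), of z]
    show "norm (f z) \<le> M * 2 ^ k * 2 ^ k * norm z ^ k" by (simp add: power_mult_distrib mult.assoc)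
  qed
  have "a j = 0" if "j \<ge> 1" "j \<le> k" for j
  proof (rule ccontr)
    assume "a j \<noteq> 0"
    then have "\<forall>\<^sub>F z in at_infinity. norm (\<Sum>j\<le>k. a j * z ^ j) \<ge> b + 1"
      using that by (intro polyfun_extremal exI[of _ j]) auto
    then obtain r where r: "\<And>z. norm z \<ge> r \<Longrightarrow> norm (f z) \<ge> b + 1"
      unfolding eventually_at_infinity poly by blast
    define x where "x = \<bar>r\<bar> / norm c + \<bar>xmin\<bar>"
    have x: "x \<ge> 0" "x \<ge> xmin" by (simp_all add: x_def add_increasing)
    have "norm c * x \<ge> \<bar>r\<bar>" using ray(1) by (simp add: x_def distrib_left)
    then have "norm (c * of_real x) \<ge> r" using x by (simp add: norm_mult)
    then have "norm (f (c * of_real x)) \<ge> b + 1" by (rule r)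
    moreover have "norm (f (c * of_real x)) \<le> b" by (rule ray(2)[OF x(2)])
    ultimately show False by linarith
  qed
  then have "(\<Sum>j\<le>k. a j * z ^ j) = (\<Sum>j\<in>{0}. a j * z ^ j)" for z
    by (intro sum.mono_neutral_right) auto
  then have "f z = a 0" for z using poly by simp
  then show ?thesis by metis
qed

text \<open>Otherwise q = g/f would be a holomorphic square root of (z - a)(z - b) near the simple
  zero a. With q(a) = 0 the derivative of q^2 at a is 0, whereas the product has derivative a -
  b.\<close>

lemma entire_square_branch_zero:
  fixes f g :: "complex \<Rightarrow> complex"
  assumes f: "f holomorphic_on UNIV" and g: "g holomorphic_on UNIV"
    and ab: "a \<noteq> b" and eq: "\<And>z. (z - a) * (z - b) * f z ^ 2 = g z ^ 2"
  shows "f z = 0"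
proof (rule ccontr)
  assume nz: "f z \<noteq> 0"
  \<comment> \<open>f may vanish at a itself; zeros are isolated, so some punctured disc about a is
    free of them.\<close>
  obtain r where r: "r > 0" "\<And>z. z \<in> ball a r - {a} \<Longrightarrow> f z \<noteq> 0"
  proof (cases "f a = 0")
    case True
    from isolated_zeros[OF f open_UNIV connected_UNIV UNIV_I True UNIV_I nz] show ?thesis using that by metis
  next
    case False
    have "isCont f a" using holomorphic_on_imp_continuous_on[OF f] by (simp add: continuous_on_eq_continuous_at)
    from continuous_at_avoid[OF this False] show ?thesis using that by (metis DiffD1 dist_commute mem_ball)
  qed
  define q where "q z = (if z = a then 0 else g z / f z)" for z
  have q2: "q z ^ 2 = (z - a) * (z - b)" if "z \<in> ball a r" for z
  proof (cases "z = a")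
    case False
    then have "f z \<noteq> 0" using r(2) that by auto
    then have "q z ^ 2 = g z ^ 2 / f z ^ 2" using False by (simp add: q_def power_divide)
    also have "\<dots> = (z - a) * (z - b)" using eq[of z] \<open>f z \<noteq> 0\<close> by (simp add: divide_simps mult.commute)
    finally show ?thesis .
  qed (simp add: q_def)
  \<comment> \<open>The singularity at a is removable with value 0, because |q|^2 = |z - a| |z - b|
    tends to 0 there.\<close>
  have qh: "q holomorphic_on ball a r"
  proof (rule no_isolated_singularity'[where K="{a}"])
    have "(\<lambda>z. g z / f z) holomorphic_on ball a r - {a}"
      using r(2) by (intro holomorphic_intros holomorphic_on_subset[OF f] holomorphic_on_subset[OF g]) auto
    then show "q holomorphic_on ball a r - {a}"
      by (rule holomorphic_transform) (auto simp: q_def)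
    have "((\<lambda>z. (z - a) * (z - b)) \<longlongrightarrow> (a - a) * (a - b)) (at a within ball a r)"
      by (intro tendsto_intros)
    then have "((\<lambda>z. q z ^ 2) \<longlongrightarrow> 0) (at a within ball a r)"
      by (rule_tac Lim_transform_within[OF _ zero_less_one]) (auto simp: q2)
    then have "((\<lambda>z. norm (q z ^ 2)) \<longlongrightarrow> 0) (at a within ball a r)" by (rule tendsto_norm_zero)
    then have "((\<lambda>z. sqrt (norm (q z ^ 2))) \<longlongrightarrow> sqrt 0) (at a within ball a r)" by (rule tendsto_real_sqrt)
    then have "(q \<longlongrightarrow> 0) (at a within ball a r)" by (intro tendsto_norm_zero_cancel[of q]) (simp add: norm_power)
    then show "(q \<longlongrightarrow> q z) (at z within ball a r)" if "z \<in> {a}" for z using that by (simp add: q_def)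
  qed auto
  then obtain q' where q': "(q has_field_derivative q') (at a)"
    using r(1) by (meson centre_in_ball holomorphic_on_imp_differentiable_at open_ball field_differentiable_def)
  have "((\<lambda>z. q z ^ 2) has_field_derivative 2 * q a * q') (at a)"
    using DERIV_power[OF q', of 2] by (simp add: mult_ac)
  moreover have "((\<lambda>z. (z - a) * (z - b)) has_field_derivative (a - b)) (at a)"
    by (auto intro!: derivative_eq_intros)
  then have "((\<lambda>z. q z ^ 2) has_field_derivative (a - b)) (at a)"
    by (rule DERIV_cong_ev[OF refl _ refl, THEN iffD1, rotated])
       (use r(1) q2 in \<open>auto simp: eventually_nhds intro!: exI[of _ "ball a r"]\<close>)
  ultimately have "2 * q a * q' = a - b" by (rule DERIV_unique)
  then show False using ab by (simp add: q_def)
qed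

section \<open>Time evolution of boundedly supported wavefunctions\<close>

text \<open>The support radius is kept explicit because the Trotter products need one that does not
  depend on the number of factors.\<close>

definition compact_wave :: "real \<Rightarrow> (real ^ 3 \<Rightarrow> complex ^ 4) \<Rightarrow> bool" where
  "compact_wave R \<psi> \<longleftrightarrow> dirac_wavefunction \<psi> \<and> (AE x in lborel. norm x > R \<longrightarrow> \<psi> x = 0)"

lemma compact_waveD:
  assumes "compact_wave R \<psi>"
  shows "\<psi> \<in> borel_measurable borel" "integrable lborel (\<lambda>x. (norm (\<psi> x))\<^sup>2)"
    "AE x in lborel. norm x > R \<longrightarrow> \<psi> x = 0" "integrable lborel \<psi>"
proof -
  show 1: "\<psi> \<in> borel_measurable borel" "integrable lborel (\<lambda>x. (norm (\<psi> x))\<^sup>2)"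
    "AE x in lborel. norm x > R \<longrightarrow> \<psi> x = 0"
    using assms by (simp_all add: compact_wave_def dirac_wavefunction_def)
  show "integrable lborel \<psi>"
    by (rule L2_bounded_support_integrable[OF _ 1(2,3)]) (use 1(1) in simp)
qed

lemma fourier_compact_wave: "compact_wave R \<psi> \<Longrightarrow> fourier \<psi> = fourier_integral \<psi>"
  by (simp add: fourier_def compact_waveD(4))

lemma compact_wave_mono: "compact_wave R \<psi> \<Longrightarrow> R \<le> R' \<Longrightarrow> compact_wave R' \<psi>"
  unfolding compact_wave_def by (auto elim!: eventually_mono)

lemma compact_wave_add:
  assumes "compact_wave R \<psi>" "compact_wave R \<phi>"
  shows "compact_wave R (\<lambda>x. \<psi> x + \<phi> x)"
  unfolding compact_wave_def dirac_wavefunction_def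
proof (intro conjI)
  note [measurable] = compact_waveD(1)[OF assms(1)] compact_waveD(1)[OF assms(2)]
  show "(\<lambda>x. \<psi> x + \<phi> x) \<in> borel_measurable lborel" by measurable
  show "integrable lborel (\<lambda>x. (norm (\<psi> x + \<phi> x))\<^sup>2)"
  proof (rule Bochner_Integration.integrable_bound)
    show "integrable lborel (\<lambda>x. 2 * (norm (\<psi> x))\<^sup>2 + 2 * (norm (\<phi> x))\<^sup>2)"
      using compact_waveD(2)[OF assms(1)] compact_waveD(2)[OF assms(2)] by auto
    show "AE x in lborel. norm ((norm (\<psi> x + \<phi> x))\<^sup>2) \<le> norm (2 * (norm (\<psi> x))\<^sup>2 + 2 * (norm (\<phi> x))\<^sup>2)"
      using norm_triangle_sq2[of "\<psi> _" "\<phi> _"] by (auto intro!: AE_I2)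
  qed measurable
  show "AE x in lborel. norm x > R \<longrightarrow> \<psi> x + \<phi> x = 0"
    using compact_waveD(3)[OF assms(1)] compact_waveD(3)[OF assms(2)] by eventually_elim auto
qed

lemma compact_wave_linear:
  assumes "compact_wave R \<psi>" "linear L"
  shows "compact_wave R (\<lambda>x. L (\<psi> x))"
  unfolding compact_wave_def dirac_wavefunction_def
proof (intro conjI)
  note [measurable] = compact_waveD(1)[OF assms(1)]
  have [measurable]: "L \<in> borel_measurable borel"
    using assms(2) by (intro borel_measurable_continuous_onI linear_continuous_on linear_conv_bounded_linear[THEN iffD1])
  obtain K where K: "K > 0" "\<And>v. norm (L v) \<le> K * norm v"
    using linear_bounded_pos[OF assms(2)] by blast
  show "(\<lambda>x. L (\<psi> x)) \<in> borel_measurable lborel" by measurable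
  show "integrable lborel (\<lambda>x. (norm (L (\<psi> x)))\<^sup>2)"
  proof (rule Bochner_Integration.integrable_bound)
    show "integrable lborel (\<lambda>x. K\<^sup>2 * (norm (\<psi> x))\<^sup>2)"
      using compact_waveD(2)[OF assms(1)] by auto
    show "AE x in lborel. norm ((norm (L (\<psi> x)))\<^sup>2) \<le> norm (K\<^sup>2 * (norm (\<psi> x))\<^sup>2)"
      using power_mono[OF K(2), of _ 2] by (auto intro!: AE_I2 simp: power_mult_distrib)
  qed measurable
  show "AE x in lborel. norm x > R \<longrightarrow> L (\<psi> x) = 0"
    using compact_waveD(3)[OF assms(1)] by eventually_elim (auto simp: linear_0[OF assms(2)])
qed

lemma compact_wave_shift:
  assumes "compact_wave R \<psi>"
  shows "compact_wave (R + norm v) (\<lambda>x. \<psi> (x + v))"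
  unfolding compact_wave_def dirac_wavefunction_def
proof (intro conjI)
  note [measurable] = compact_waveD(1)[OF assms(1)]
  show "(\<lambda>x. \<psi> (x + v)) \<in> borel_measurable lborel" by measurable
  show "integrable lborel (\<lambda>x. (norm (\<psi> (x + v)))\<^sup>2)"
    using compact_waveD(2)[OF assms(1)] integrable_shift_iff[of "\<lambda>x. (norm (\<psi> x))\<^sup>2" v] by simp
  have "AE x in distr lborel borel ((+) v). norm x > R \<longrightarrow> \<psi> x = 0"
    unfolding lborel_distr_plus using compact_waveD(3)[OF assms(1)] .
  then have "AE x in lborel. norm (v + x) > R \<longrightarrow> \<psi> (v + x) = 0"
    by (subst (asm) AE_distr_iff) (measurable)
  then show "AE x in lborel. norm x > R + norm v \<longrightarrow> \<psi> (x + v) = 0"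
  proof eventually_elim
    case (elim x)
    have "norm x \<le> norm (v + x) + norm v" using norm_triangle_ineq4[of "v + x" v] by simp
    then show ?case using elim by (auto simp: add.commute)
  qed
qed

section \<open>Multipliers that enlarge the support by a bounded amount\<close>

lemma fourier_integral_linear:
  assumes "integrable lborel \<psi>" "linear L" "\<And>c v. L (c *s v) = c *s L v"
  shows "fourier_integral (\<lambda>x. L (\<psi> x)) p = L (fourier_integral \<psi> p)"
proof -
  have bl: "bounded_linear L" using assms(2) by (simp add: linear_conv_bounded_linear)
  show ?thesis
    unfolding fourier_integral_def linear_scale[OF assms(2)]
    by (subst integral_bounded_linear[OF bl integrable_phase_smult[OF assms(1)], symmetric]) (simp add: assms(3))
qed

lemma fourier_integral_add:
  assumes "integrable lborel \<psi>" "integrable lborel \<phi>"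
  shows "fourier_integral (\<lambda>x. \<psi> x + \<phi> x) p = fourier_integral \<psi> p + fourier_integral \<phi> p"
  unfolding fourier_integral_def smult_add
  using integrable_phase_smult[OF assms(1), of p] integrable_phase_smult[OF assms(2), of p]
  by (simp add: scaleR_add_right)

lemma linear_smult: "linear (\<lambda>v. c *s (v :: complex ^ 'n))"
  by (rule linearI) (simp_all add: smult_add smult_scaleR)

lemma fourier_integral_shift:
  assumes "integrable lborel \<psi>"
  shows "fourier_integral (\<lambda>x. \<psi> (x + v)) p = exp (\<i> * complex_of_real (p \<bullet> v)) *s fourier_integral \<psi> p"
proof -
  have [measurable]: "\<psi> \<in> borel_measurable borel" using assms by auto
  define g where "g x = exp (\<i> * complex_of_real (p \<bullet> v)) *s (phase p x *s \<psi> x)" for x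
  have [measurable]: "g \<in> borel_measurable borel" unfolding g_def by measurable
  have "phase p x *s \<psi> (x + v) = g (x + v)" for x
    unfolding g_def smult_smult by (simp add: inner_add_right algebra_simps flip: exp_add)
  then have "(LINT x|lborel. phase p x *s \<psi> (x + v)) = integral\<^sup>L lborel g"
    using integral_shift[of g v] by simp
  also have "\<dots> = exp (\<i> * complex_of_real (p \<bullet> v)) *s (LINT x|lborel. phase p x *s \<psi> x)"
    unfolding g_def
    by (rule integral_bounded_linear[OF _ integrable_phase_smult[OF assms]])
       (simp add: linear_conv_bounded_linear[symmetric] linear_smult)
  finally show ?thesis
    unfolding fourier_integral_def by (simp add: smult_scaleR)
qed

text \<open>Locality is expressed by the existence of a preimage with the enlarged support. This
  composes directly and avoids any inverse transform.\<close>

definition local_multiplier :: "real \<Rightarrow> (real ^ 3 \<Rightarrow> complex ^ 4 \<Rightarrow> complex ^ 4) \<Rightarrow> bool" where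
  "local_multiplier r M \<longleftrightarrow> (\<forall>R \<psi>. compact_wave R \<psi> \<longrightarrow>
     (\<exists>\<phi>. compact_wave (R + r) \<phi> \<and> (\<forall>p. fourier_integral \<phi> p = M p (fourier_integral \<psi> p))))"

lemma local_multiplier_comp:
  assumes "local_multiplier r M" "local_multiplier s N"
  shows "local_multiplier (s + r) (\<lambda>p v. M p (N p v))"
  unfolding local_multiplier_def
proof (intro allI impI)
  fix R \<psi> assume "compact_wave R \<psi>"
  then obtain \<xi> where \<xi>: "compact_wave (R + s) \<xi>" "\<And>p. fourier_integral \<xi> p = N p (fourier_integral \<psi> p)"
    using assms(2) unfolding local_multiplier_def by blast
  then obtain \<phi> where "compact_wave (R + s + r) \<phi>" "\<And>p. fourier_integral \<phi> p = M p (fourier_integral \<xi> p)"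
    using assms(1) unfolding local_multiplier_def by blast
  then show "\<exists>\<phi>. compact_wave (R + (s + r)) \<phi> \<and> (\<forall>p. fourier_integral \<phi> p = M p (N p (fourier_integral \<psi> p)))"
    using \<xi>(2) by (auto simp: add.assoc)
qed

lemma local_multiplier_funpow:
  assumes "local_multiplier r M"
  shows "local_multiplier (real n * r) (\<lambda>p. M p ^^ n)"
proof (induction n)
  case 0 show ?case by (auto simp: local_multiplier_def)
next
  case (Suc n)
  from local_multiplier_comp[OF assms Suc] show ?case by (simp add: algebra_simps o_def)
qed

lemma local_multiplier_rotor_const:
  assumes "sa_involution X"
  shows "local_multiplier 0 (\<lambda>p. rotor X \<theta>)"
  unfolding local_multiplier_def
proof (intro allI impI)
  fix R \<psi> assume \<psi>: "compact_wave R \<psi>"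
  have Xs: "X (c *s v) = c *s X v" for c v using assms by (auto simp: sa_involution_def)
  have s: "rotor X \<theta> (c *s v) = c *s rotor X \<theta> v" for c v
    by (simp add: rotor_def Xs smult_add smult_scaleR smult_smult mult.commute)
  show "\<exists>\<phi>. compact_wave (R + 0) \<phi> \<and> (\<forall>p. fourier_integral \<phi> p = rotor X \<theta> (fourier_integral \<psi> p))"
    using compact_wave_linear[OF \<psi> linear_rotor[OF assms]] fourier_integral_linear[OF compact_waveD(4)[OF \<psi>] linear_rotor[OF assms] s]
    by (intro exI[of _ "\<lambda>x. rotor X \<theta> (\<psi> x)"]) auto
qed

text \<open>On the eigenspaces of X for 1 and -1 the rotor is the phase e^(\<i>\<tau>p_k) or its
  inverse, that is, a translation by \<tau> along one axis in either direction. \<open>L1\<close>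
  and \<open>L2\<close> are the projections onto these eigenspaces.\<close>

lemma local_multiplier_rotor_shift:
  assumes X: "sa_involution X"
  shows "local_multiplier \<bar>\<tau>\<bar> (\<lambda>p. rotor X (\<tau> * p $ k))"
  unfolding local_multiplier_def
proof (intro allI impI)
  fix R \<psi> assume \<psi>: "compact_wave R \<psi>"
  have Xl: "linear X" and Xs: "\<And>c v. X (c *s v) = c *s X v" using X by (auto simp: sa_involution_def)
  define e :: "real ^ 3" where "e = axis k 1"
  define L1 where "L1 v = (1/2) *\<^sub>R (v + X v)" for v
  define L2 where "L2 v = (1/2) *\<^sub>R (v - X v)" for v
  have l: "linear L1" "linear L2"
    by (auto intro!: linearI simp: L1_def L2_def linear_add[OF Xl] linear_scale[OF Xl] algebra_simps)
  have s: "L1 (c *s v) = c *s L1 v" "L2 (c *s v) = c *s L2 v" for c v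
    by (simp_all add: L1_def L2_def Xs vec_eq_iff algebra_simps)
  define \<psi>p \<psi>m where "\<psi>p x = \<psi> (x + \<tau> *\<^sub>R e)" and "\<psi>m x = \<psi> (x + (- \<tau>) *\<^sub>R e)" for x
  have ne: "norm (\<tau> *\<^sub>R e) = \<bar>\<tau>\<bar>" "norm ((- \<tau>) *\<^sub>R e) = \<bar>\<tau>\<bar>" by (simp_all add: e_def norm_axis_1)
  have pm: "compact_wave (R + \<bar>\<tau>\<bar>) \<psi>p" "compact_wave (R + \<bar>\<tau>\<bar>) \<psi>m"
    using compact_wave_shift[OF \<psi>, of "\<tau> *\<^sub>R e"] compact_wave_shift[OF \<psi>, of "(- \<tau>) *\<^sub>R e"]
    unfolding ne \<psi>p_def[abs_def] \<psi>m_def[abs_def] by simp_all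
  have pe: "p \<bullet> e = p $ k" for p by (simp add: e_def inner_axis)
  note c1 = compact_wave_linear[OF pm(1) l(1)] and c2 = compact_wave_linear[OF pm(2) l(2)]
  have "fourier_integral (\<lambda>x. L1 (\<psi>p x) + L2 (\<psi>m x)) p = rotor X (\<tau> * p $ k) (fourier_integral \<psi> p)" for p
  proof -
    let ?F = "fourier_integral \<psi> p" and ?t = "\<tau> * p $ k"
    have fp: "fourier_integral \<psi>p p = exp (\<i> * complex_of_real ?t) *s ?F"
      and fm: "fourier_integral \<psi>m p = exp (- (\<i> * complex_of_real ?t)) *s ?F"
      unfolding \<psi>p_def[abs_def] \<psi>m_def[abs_def] fourier_integral_shift[OF compact_waveD(4)[OF \<psi>]]
      by (simp_all add: pe)
    have "fourier_integral (\<lambda>x. L1 (\<psi>p x) + L2 (\<psi>m x)) p = L1 (fourier_integral \<psi>p p) + L2 (fourier_integral \<psi>m p)"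
      unfolding fourier_integral_add[OF compact_waveD(4)[OF c1] compact_waveD(4)[OF c2]]
      by (simp only: fourier_integral_linear[OF compact_waveD(4)[OF pm(1)] l(1) s(1)] fourier_integral_linear[OF compact_waveD(4)[OF pm(2)] l(2) s(2)])
    also have "\<dots> = rotor X ?t ?F"
      unfolding fp fm s exp_Euler exp_minus_Euler
      by (simp add: L1_def L2_def rotor_def vec_eq_iff cos_of_real[symmetric] sin_of_real[symmetric] scaleR_conv_of_real[where 'a=complex] algebra_simps field_simps)
    finally show ?thesis .
  qed
  then show "\<exists>\<phi>. compact_wave (R + \<bar>\<tau>\<bar>) \<phi> \<and> (\<forall>p. fourier_integral \<phi> p = rotor X (\<tau> * p $ k) (fourier_integral \<psi> p))"
    using compact_wave_add[OF c1 c2] by blast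
qed

text \<open>Each of the three axes contributes a shift by |\<tau>| to the support radius, and the
  mass term none.\<close>

lemma local_multiplier_trotter_step:
  assumes "dirac_matrices \<alpha> \<beta>"
  shows "local_multiplier (3 * \<bar>\<tau>\<bar>) (trotter_step \<alpha> \<beta> m \<tau>)"
proof -
  note a = local_multiplier_rotor_shift[OF alpha_involution[OF assms], of \<tau>]
  note b = local_multiplier_rotor_const[OF beta_involution[OF assms], of "\<tau> * m"]
  have "local_multiplier (((0 + \<bar>\<tau>\<bar>) + \<bar>\<tau>\<bar>) + \<bar>\<tau>\<bar>) (\<lambda>p v. rotor (\<lambda>v. \<alpha> 1 *v v) (\<tau> * p $ 1) (rotor (\<lambda>v. \<alpha> 2 *v v) (\<tau> * p $ 2)
       (rotor (\<lambda>v. \<alpha> 3 *v v) (\<tau> * p $ 3) (rotor (\<lambda>v. \<beta> *v v) (\<tau> * m) v))))"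
    by (rule local_multiplier_comp[OF a local_multiplier_comp[OF a local_multiplier_comp[OF a b]]])
  then show ?thesis unfolding trotter_step_def[abs_def] by (simp add: algebra_simps)
qed

section \<open>Limits of waves with a common support\<close>

lemma compact_wave_AE_cong:
  assumes "compact_wave R \<psi>" "\<phi> \<in> borel_measurable borel" "AE x in lborel. \<phi> x = \<psi> x"
  shows "compact_wave R \<phi>"
  unfolding compact_wave_def dirac_wavefunction_def
proof (intro conjI)
  note [measurable] = compact_waveD(1)[OF assms(1)] assms(2)
  show "\<phi> \<in> borel_measurable lborel" by measurable
  have "AE x in lborel. (norm (\<phi> x))\<^sup>2 = (norm (\<psi> x))\<^sup>2"
    using assms(3) by eventually_elim simp
  then show "integrable lborel (\<lambda>x. (norm (\<phi> x))\<^sup>2)"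
    using compact_waveD(2)[OF assms(1)] by (subst integrable_cong_AE) auto
  show "AE x in lborel. norm x > R \<longrightarrow> \<phi> x = 0"
    using compact_waveD(3)[OF assms(1)] assms(3) by eventually_elim auto
qed

lemma fourier_integral_AE_cong:
  assumes [measurable]: "\<phi> \<in> borel_measurable borel" "\<psi> \<in> borel_measurable borel"
    and "AE x in lborel. \<phi> x = \<psi> x"
  shows "fourier_integral \<phi> p = fourier_integral \<psi> p"
  unfolding fourier_integral_def
  by (rule arg_cong[where f="\<lambda>v. _ *\<^sub>R v"], rule integral_cong_AE) (use assms(3) in \<open>auto elim!: eventually_mono\<close>)

lemma norm_fourier_integral_le:
  assumes "integrable lborel \<psi>"
  shows "norm (fourier_integral \<psi> p) \<le> (2 * pi) powr (- 3 / 2) * (LINT x|lborel. norm (\<psi> x))"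
proof -
  have "norm (LINT x|lborel. phase p x *s \<psi> x) \<le> (LINT x|lborel. norm (phase p x *s \<psi> x))"
    by (rule integral_norm_bound)
  then show ?thesis
    unfolding fourier_integral_def by (simp add: mult_left_mono)
qed

lemma compact_wave_diff:
  assumes "compact_wave R \<psi>" "compact_wave R \<phi>"
  shows "compact_wave R (\<lambda>x. \<psi> x - \<phi> x)"
proof -
  have "linear (uminus :: complex ^ 4 \<Rightarrow> complex ^ 4)" by (rule linearI) auto
  from compact_wave_add[OF assms(1) compact_wave_linear[OF assms(2) this]] show ?thesis by simp
qed

text \<open>On a common ball convergence in L^2 implies convergence in L^1, which controls the
  transform at every single p.\<close>

lemma fourier_integral_L2_tendsto:
  assumes \<phi>: "\<And>n. compact_wave R (\<phi> n)" "compact_wave R \<psi>"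
    and lim: "(\<lambda>n. \<integral>\<^sup>+x. ennreal ((norm (\<phi> n x - \<psi> x))\<^sup>2) \<partial>lborel) \<longlonglongrightarrow> 0"
  shows "(\<lambda>n. fourier_integral (\<phi> n) p) \<longlonglongrightarrow> fourier_integral \<psi> p"
proof (rule LIMSEQ_I)
  fix r :: real assume "r > 0"
  let ?c = "(2 * pi) powr (- 3 / 2) :: real"
  have c: "?c > 0" by simp
  define V where "V = measure lborel (cball (0 :: real ^ 3) R)"
  \<comment> \<open>Chosen so that \<open>?c * (\<delta> * (V + 1))\<close> equals r/2. The estimate
    |a| \<le> \<delta> + |a|^2/\<delta> on the ball contributes \<delta>V from the volume and less
    than \<delta> from the square.\<close>
  define \<delta> where "\<delta> = r / (2 * ?c * (V + 1))"
  have V0: "V \<ge> 0" by (simp add: V_def)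
  have \<delta>: "\<delta> > 0" using \<open>r > 0\<close> c V0 by (simp add: \<delta>_def)
  have "\<forall>\<^sub>F n in sequentially. L2_square (\<lambda>x. \<phi> n x - \<psi> x) < ennreal (\<delta>\<^sup>2)"
    using lim \<delta> by (intro order_tendstoD(2)) auto
  then obtain N where N: "\<And>n. n \<ge> N \<Longrightarrow> L2_square (\<lambda>x. \<phi> n x - \<psi> x) < ennreal (\<delta>\<^sup>2)"
    by (auto simp: eventually_sequentially)
  show "\<exists>N. \<forall>n\<ge>N. norm (fourier_integral (\<phi> n) p - fourier_integral \<psi> p) < r"
  proof (intro exI[of _ N] allI impI)
    fix n assume n: "n \<ge> N"
    note d = compact_wave_diff[OF \<phi>(1)[of n] \<phi>(2)]
    have "ennreal (LINT x|lborel. (norm (\<phi> n x - \<psi> x))\<^sup>2) < ennreal (\<delta>\<^sup>2)"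
      using N[OF n] compact_waveD(2)[OF d] by (subst nn_integral_eq_integral[symmetric]) auto
    then have L2: "(LINT x|lborel. (norm (\<phi> n x - \<psi> x))\<^sup>2) < \<delta>\<^sup>2"
      by (simp add: ennreal_less_iff)
    have ci: "integrable lborel (indicat_real (cball (0 :: real ^ 3) R))"
      by (intro integrable_real_indicator) (auto simp: emeasure_lborel_cball_finite[unfolded infinity_ennreal_def])
    have "(LINT x|lborel. norm (\<phi> n x - \<psi> x)) \<le> (LINT x|lborel. \<delta> * indicat_real (cball 0 R) x + (norm (\<phi> n x - \<psi> x))\<^sup>2 / \<delta>)"
    proof (rule integral_mono_AE)
      show "integrable lborel (\<lambda>x. norm (\<phi> n x - \<psi> x))" using compact_waveD(4)[OF d] by simp
      show "integrable lborel (\<lambda>x. \<delta> * indicat_real (cball 0 R) x + (norm (\<phi> n x - \<psi> x))\<^sup>2 / \<delta>)"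
        using ci compact_waveD(2)[OF d] by auto
      show "AE x in lborel. norm (\<phi> n x - \<psi> x) \<le> \<delta> * indicat_real (cball 0 R) x + (norm (\<phi> n x - \<psi> x))\<^sup>2 / \<delta>"
        using compact_waveD(3)[OF d]
      proof eventually_elim
        case (elim x)
        let ?a = "norm (\<phi> n x - \<psi> x)"
        have "2 * ?a * \<delta> \<le> ?a\<^sup>2 + \<delta>\<^sup>2" by (rule sum_squares_bound)
        moreover have "0 \<le> ?a * \<delta>" using \<delta> by simp
        ultimately have "?a * \<delta> \<le> ?a\<^sup>2 + \<delta> * \<delta>" unfolding power2_eq_square by linarith
        then have "?a \<le> \<delta> + ?a\<^sup>2 / \<delta>" using \<delta> by (simp add: field_simps)
        then show ?case using elim \<delta> by (cases "norm x > R") auto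
      qed
    qed
    also have "\<dots> = \<delta> * V + (LINT x|lborel. (norm (\<phi> n x - \<psi> x))\<^sup>2) / \<delta>"
      using ci compact_waveD(2)[OF d] by (simp add: V_def)
    also have "\<dots> < \<delta> * V + \<delta>\<^sup>2 / \<delta>" using L2 \<delta> by (simp add: divide_strict_right_mono)
    also have "\<dots> = \<delta> * (V + 1)" using \<delta> by (simp add: power2_eq_square algebra_simps)
    finally have L1: "(LINT x|lborel. norm (\<phi> n x - \<psi> x)) < \<delta> * (V + 1)" .
    have "norm (fourier_integral (\<phi> n) p - fourier_integral \<psi> p) \<le> ?c * (LINT x|lborel. norm (\<phi> n x - \<psi> x))"
      using norm_fourier_integral_le[OF compact_waveD(4)[OF d], of p]
      by (simp add: fourier_integral_diff[OF compact_waveD(4)[OF \<phi>(1)] compact_waveD(4)[OF \<phi>(2)]])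
    also have "\<dots> < ?c * (\<delta> * (V + 1))" using L1 c by (intro mult_strict_left_mono)
    also have "\<dots> = r / 2"
    proof -
      have "a * (r / (2 * a * b) * b) = r / 2" if "a \<noteq> 0" "b \<noteq> 0" for a b :: real
        using that by (simp add: field_simps)
      then show ?thesis unfolding \<delta>_def using c V0 by (metis add_nonneg_pos less_numeral_extra(3) zero_less_one)
    qed
    finally show "norm (fourier_integral (\<phi> n) p - fourier_integral \<psi> p) < r" using \<open>r > 0\<close> by simp
  qed
qed

text \<open>All the transforms have the modulus of a single square integrable function, so their
  pointwise convergence is dominated and hence holds in L^2. By Plancherel's identity the waves
  themselves are Cauchy; their limit vanishes outside the common ball because every approximant
  does.\<close>

lemma compact_wave_fourier_limit:
  assumes \<phi>: "\<And>n. compact_wave R (\<phi> n)" and \<psi>: "compact_wave S \<psi>"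
    and nrm: "\<And>n p. norm (fourier_integral (\<phi> n) p) = norm (fourier_integral \<psi> p)"
    and lim: "\<And>p. (\<lambda>n. fourier_integral (\<phi> n) p) \<longlonglongrightarrow> \<xi> p"
  obtains \<omega> where "compact_wave R \<omega>" "\<And>p. fourier_integral \<omega> p = \<xi> p"
proof -
  define F where "F = fourier_integral \<psi>"
  have [measurable]: "\<phi> n \<in> borel_measurable borel" for n by (rule compact_waveD(1)[OF \<phi>])
  have [measurable]: "\<psi> \<in> borel_measurable borel" by (rule compact_waveD(1)[OF \<psi>])
  have [measurable]: "F \<in> borel_measurable borel" unfolding F_def by measurable
  have [measurable]: "\<xi> \<in> borel_measurable borel"
    by (rule borel_measurable_LIMSEQ_metric[OF _ lim]) measurable
  have Fi: "integrable lborel (\<lambda>p. (norm (F p))\<^sup>2)"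
  proof (rule integrableI_bounded)
    have "(\<integral>\<^sup>+p. ennreal (norm ((norm (F p))\<^sup>2)) \<partial>lborel) = L2_square (\<lambda>x. \<psi> x)"
      unfolding F_def using plancherel_vector[OF compact_waveD(4)[OF \<psi>] compact_waveD(2)[OF \<psi>]] by simp
    also have "\<dots> = ennreal (LINT x|lborel. (norm (\<psi> x))\<^sup>2)"
      by (rule nn_integral_eq_integral[OF compact_waveD(2)[OF \<psi>]]) simp
    finally show "(\<integral>\<^sup>+p. ennreal (norm ((norm (F p))\<^sup>2)) \<partial>lborel) < \<infinity>" by simp
  qed measurable
  have n\<xi>: "norm (\<xi> p) = norm (F p)" for p
    using LIMSEQ_unique[OF tendsto_norm[OF lim[of p]]] nrm by (simp add: F_def)
  have bd: "norm ((norm (fourier_integral (\<phi> n) p - \<xi> p))\<^sup>2) \<le> 4 * (norm (F p))\<^sup>2" for n p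
  proof -
    have "norm (fourier_integral (\<phi> n) p - \<xi> p) \<le> 2 * norm (F p)"
      using norm_triangle_ineq4[of "fourier_integral (\<phi> n) p" "\<xi> p"] by (simp add: nrm n\<xi> F_def)
    from power_mono[OF this norm_ge_zero, of 2] show ?thesis by (simp add: power_mult_distrib)
  qed
  have wi: "integrable lborel (\<lambda>p. 4 * (norm (F p))\<^sup>2)" using Fi by simp
  have di: "integrable lborel (\<lambda>p. (norm (fourier_integral (\<phi> n) p - \<xi> p))\<^sup>2)" for n
    by (rule Bochner_Integration.integrable_bound[OF wi]) (use bd[of n] in \<open>auto intro!: AE_I2\<close>)
  have dlim: "(\<lambda>n. LINT p|lborel. (norm (fourier_integral (\<phi> n) p - \<xi> p))\<^sup>2) \<longlonglongrightarrow> (LINT p|(lborel :: (real ^ 3) measure). 0)"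
  proof (rule integral_dominated_convergence[OF _ _ wi])
    show "AE p in lborel. (\<lambda>n. (norm (fourier_integral (\<phi> n) p - \<xi> p))\<^sup>2) \<longlonglongrightarrow> 0"
    proof (rule AE_I2)
      fix p
      from tendsto_power[OF tendsto_norm[OF tendsto_diff[OF lim[of p] tendsto_const[of "\<xi> p"]]], of 2]
      show "(\<lambda>n. (norm (fourier_integral (\<phi> n) p - \<xi> p))\<^sup>2) \<longlonglongrightarrow> 0" by simp
    qed
  qed (use bd in auto)
  have cauchy: "\<exists>N. \<forall>k\<ge>N. \<forall>n\<ge>N. L2_square (\<lambda>x. \<phi> k x - \<phi> n x) \<le> ennreal \<epsilon>" if "\<epsilon> > 0" for \<epsilon>
  proof -
    have "\<forall>\<^sub>F n in sequentially. (LINT p|lborel. (norm (fourier_integral (\<phi> n) p - \<xi> p))\<^sup>2) < \<epsilon> / 4"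
      using dlim that by (intro order_tendstoD(2)) auto
    then obtain N where N: "\<And>n. n \<ge> N \<Longrightarrow> (LINT p|lborel. (norm (fourier_integral (\<phi> n) p - \<xi> p))\<^sup>2) < \<epsilon> / 4"
      by (auto simp: eventually_sequentially)
    show ?thesis
    proof (intro exI[of _ N] allI impI)
      fix k n assume kn: "k \<ge> N" "n \<ge> N"
      note d = compact_wave_diff[OF \<phi>[of k] \<phi>[of n]]
      have "L2_square (\<lambda>x. \<phi> k x - \<phi> n x) = L2_square (\<lambda>p. fourier_integral (\<lambda>x. \<phi> k x - \<phi> n x) p)"
        by (rule plancherel_vector[OF compact_waveD(4)[OF d] compact_waveD(2)[OF d], symmetric])
      also have "\<dots> \<le> (\<integral>\<^sup>+p. ennreal (2 * (norm (fourier_integral (\<phi> k) p - \<xi> p))\<^sup>2 + 2 * (norm (fourier_integral (\<phi> n) p - \<xi> p))\<^sup>2) \<partial>lborel)"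
      proof (intro nn_integral_mono ennreal_leI)
        fix p
        show "(norm (fourier_integral (\<lambda>x. \<phi> k x - \<phi> n x) p))\<^sup>2 \<le> 2 * (norm (fourier_integral (\<phi> k) p - \<xi> p))\<^sup>2 + 2 * (norm (fourier_integral (\<phi> n) p - \<xi> p))\<^sup>2"
          using norm_triangle_sq2[of "fourier_integral (\<phi> k) p - \<xi> p" "\<xi> p - fourier_integral (\<phi> n) p"]
          by (simp add: fourier_integral_diff[OF compact_waveD(4)[OF \<phi>] compact_waveD(4)[OF \<phi>]] norm_minus_commute)
      qed
      also have "\<dots> = ennreal (LINT p|lborel. 2 * (norm (fourier_integral (\<phi> k) p - \<xi> p))\<^sup>2 + 2 * (norm (fourier_integral (\<phi> n) p - \<xi> p))\<^sup>2)"
        using di[of k] di[of n] by (intro nn_integral_eq_integral) auto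
      also have "\<dots> \<le> ennreal \<epsilon>"
        using N[OF kn(1)] N[OF kn(2)] di[of k] di[of n] by (intro ennreal_leI) simp
      finally show "L2_square (\<lambda>x. \<phi> k x - \<phi> n x) \<le> ennreal \<epsilon>" .
    qed
  qed
  obtain g where g[measurable]: "g \<in> borel_measurable lborel"
    and glim: "(\<lambda>n. \<integral>\<^sup>+x. ennreal ((norm (\<phi> n x - g x))\<^sup>2) \<partial>lborel) \<longlonglongrightarrow> 0"
    using L2_complete[of \<phi> lborel] cauchy by auto
  have "compact_wave R g"
    unfolding compact_wave_def dirac_wavefunction_def
  proof (intro conjI g)
    have "\<forall>\<^sub>F n in sequentially. L2_square (\<lambda>x. \<phi> n x - g x) < 1"
      using glim by (intro order_tendstoD(2)) auto
    then obtain n where n: "L2_square (\<lambda>x. \<phi> n x - g x) < 1"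
      unfolding eventually_sequentially by blast
    have di2: "integrable lborel (\<lambda>x. (norm (\<phi> n x - g x))\<^sup>2)"
      by (rule integrableI_bounded) (use n in \<open>auto intro: less_trans[OF _ ennreal_one_less_top]\<close>)
    show "integrable lborel (\<lambda>x. (norm (g x))\<^sup>2)"
    proof (rule Bochner_Integration.integrable_bound)
      show "integrable lborel (\<lambda>x. 2 * (norm (\<phi> n x - g x))\<^sup>2 + 2 * (norm (\<phi> n x))\<^sup>2)"
        using di2 compact_waveD(2)[OF \<phi>[of n]] by auto
      show "AE x in lborel. norm ((norm (g x))\<^sup>2) \<le> norm (2 * (norm (\<phi> n x - g x))\<^sup>2 + 2 * (norm (\<phi> n x))\<^sup>2)"
      proof (rule AE_I2)
        fix x
        show "norm ((norm (g x))\<^sup>2) \<le> norm (2 * (norm (\<phi> n x - g x))\<^sup>2 + 2 * (norm (\<phi> n x))\<^sup>2)"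
          using norm_triangle_sq2[of "g x - \<phi> n x" "\<phi> n x"] by (simp add: norm_minus_commute)
      qed
    qed measurable
    have "(\<integral>\<^sup>+x. ennreal (indicat_real (- cball 0 R) x * (norm (g x))\<^sup>2) \<partial>lborel) \<le> L2_square (\<lambda>x. \<phi> n x - g x)" for n
    proof (rule nn_integral_mono_AE)
      show "AE x in lborel. ennreal (indicat_real (- cball 0 R) x * (norm (g x))\<^sup>2) \<le> ennreal ((norm (\<phi> n x - g x))\<^sup>2)"
        using compact_waveD(3)[OF \<phi>[of n]] by eventually_elim (auto simp: indicator_def intro!: ennreal_leI)
    qed
    then have "(\<integral>\<^sup>+x. ennreal (indicat_real (- cball 0 R) x * (norm (g x))\<^sup>2) \<partial>lborel) \<le> 0"
      by (intro LIMSEQ_le_const[OF glim]) auto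
    then have "AE x in lborel. ennreal (indicat_real (- cball 0 R) x * (norm (g x))\<^sup>2) = 0"
      by (subst nn_integral_0_iff_AE[symmetric]) auto
    then show "AE x in lborel. R < norm x \<longrightarrow> g x = 0"
      by eventually_elim (auto simp: indicator_def)
  qed
  moreover have "fourier_integral g p = \<xi> p" for p
    using LIMSEQ_unique[OF fourier_integral_L2_tendsto[OF \<phi> \<open>compact_wave R g\<close> glim] lim] .
  ultimately show ?thesis by (rule that)
qed

text \<open>Trotter products of any number of steps have support radius R + 3|t|, as the step
  lengths add up to |t|. Their limit keeps this radius and is the preimage that identifies the
  chosen inverse transform. The formula for the transform holds at every p and not just almost
  everywhere, since integrals ignore null sets.\<close>

theorem dirac_evolution_compact_wave:
  assumes dm: "dirac_matrices \<alpha> \<beta>" and m: "m > 0" and \<psi>: "compact_wave R \<psi>"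
  shows "compact_wave (R + 3 * \<bar>t\<bar>) (dirac_evolution \<alpha> \<beta> m t \<psi>)"
    and "fourier_integral (dirac_evolution \<alpha> \<beta> m t \<psi>) p = free_group \<alpha> \<beta> m t p (fourier_integral \<psi> p)"
proof -
  have "\<exists>\<phi>. compact_wave (R + 3 * \<bar>t\<bar>) \<phi> \<and> (\<forall>p. fourier_integral \<phi> p = (trotter_step \<alpha> \<beta> m (t / real (Suc n)) p ^^ Suc n) (fourier_integral \<psi> p))" for n
  proof -
    have "real (Suc n) * (3 * \<bar>t / real (Suc n)\<bar>) = 3 * \<bar>t\<bar>" by (simp add: abs_divide del: of_nat_Suc)
    with local_multiplier_funpow[OF local_multiplier_trotter_step[OF dm, of "t / real (Suc n)" m], of "Suc n"] \<psi>
    show ?thesis unfolding local_multiplier_def by metis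
  qed
  then obtain \<phi> where \<phi>: "\<And>n. compact_wave (R + 3 * \<bar>t\<bar>) (\<phi> n)"
    and F\<phi>: "\<And>n p. fourier_integral (\<phi> n) p = (trotter_step \<alpha> \<beta> m (t / real (Suc n)) p ^^ Suc n) (fourier_integral \<psi> p)"
    by metis
  obtain \<phi>' where \<phi>': "compact_wave (R + 3 * \<bar>t\<bar>) \<phi>'" and F\<phi>': "\<And>p. fourier_integral \<phi>' p = free_group \<alpha> \<beta> m t p (fourier_integral \<psi> p)"
  proof (rule compact_wave_fourier_limit[OF \<phi> \<psi>])
    show "norm (fourier_integral (\<phi> n) p) = norm (fourier_integral \<psi> p)" for n p
      unfolding F\<phi> by (rule norm_trotter_funpow[OF dm m])
    show "(\<lambda>n. fourier_integral (\<phi> n) p) \<longlonglongrightarrow> free_group \<alpha> \<beta> m t p (fourier_integral \<psi> p)" for p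
      unfolding F\<phi> by (rule trotter_limit[OF dm m])
  qed (use that in blast)
  have g: "(\<lambda>p. matrix_exp (mat (\<i> * complex_of_real t) ** dirac_symbol \<alpha> \<beta> m p) *v fourier \<psi> p) = fourier \<phi>'"
    by (simp add: fun_eq_iff fourier_compact_wave[OF \<psi>] fourier_compact_wave[OF \<phi>'] F\<phi>' matrix_exp_dirac_symbol[OF dm m])
  have d: "dirac_wavefunction \<phi>'" using \<phi>' by (simp add: compact_wave_def)
  note inv = inverse_fourier_eq_AE[OF d compact_waveD(4)[OF \<phi>'], of "fourier \<phi>'"]
  have e: "dirac_evolution \<alpha> \<beta> m t \<psi> = inverse_fourier (fourier \<phi>')"
    unfolding dirac_evolution_def g ..
  have em: "dirac_evolution \<alpha> \<beta> m t \<psi> \<in> borel_measurable borel"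
    using inv(1) unfolding e dirac_wavefunction_def by simp
  have ae: "AE x in lborel. dirac_evolution \<alpha> \<beta> m t \<psi> x = \<phi>' x"
    using inv(2) unfolding e by simp
  show "compact_wave (R + 3 * \<bar>t\<bar>) (dirac_evolution \<alpha> \<beta> m t \<psi>)"
    by (rule compact_wave_AE_cong[OF \<phi>' em ae])
  show "fourier_integral (dirac_evolution \<alpha> \<beta> m t \<psi>) p = free_group \<alpha> \<beta> m t p (fourier_integral \<psi> p)"
    using fourier_integral_AE_cong[OF em compact_waveD(1)[OF \<phi>'] ae] F\<phi>' by simp
qed

section \<open>Supports and complex momenta\<close>

abbreviation complex_phase :: "real ^ 3 \<Rightarrow> real ^ 3 \<Rightarrow> complex \<Rightarrow> real ^ 3 \<Rightarrow> complex" where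
  "complex_phase e p z x \<equiv> exp (- (\<i> * (complex_of_real (p \<bullet> x) + z * complex_of_real (x \<bullet> e))))"

text \<open>\<open>complex_fourier e \<psi> p z\<close> is the Fourier transform at the complex momentum \<open>p + z e\<close>.\<close>

definition complex_fourier :: "real ^ 3 \<Rightarrow> (real ^ 3 \<Rightarrow> complex ^ 4) \<Rightarrow> real ^ 3 \<Rightarrow> complex \<Rightarrow> complex ^ 4" where
  "complex_fourier e \<psi> p z = ((2 * pi) powr (- 3 / 2)) *\<^sub>R
     (LINT x|lborel. complex_phase e p z x *s \<psi> x)"

text \<open>The strict inequality makes the condition stable under increasing limits of
  \<open>a\<close>, so that an optimal \<open>a\<close> exists. It agrees with the non-strict one in
  \<open>edge\<close>, as hyperplanes are null sets.\<close>

definition vanishes_below :: "real ^ 3 \<Rightarrow> real \<Rightarrow> (real ^ 3 \<Rightarrow> complex ^ 4) \<Rightarrow> bool" where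
  "vanishes_below e a \<psi> \<longleftrightarrow> (AE x in lborel. x \<bullet> e < a \<longrightarrow> \<psi> x = 0)"

lemma norm_complex_phase:
  "norm (exp (- (\<i> * (complex_of_real a + z * complex_of_real b)))) = exp (Im z * b)"
  by (simp add: norm_exp_eq_Re)

lemma complex_fourier_of_real:
  "complex_fourier e \<psi> p (of_real r) = fourier_integral \<psi> (p + r *\<^sub>R e)"
  unfolding complex_fourier_def fourier_integral_def
  by (simp add: inner_add_left inner_commute[of e])

lemma complex_fourier_minus:
  "complex_fourier (- e) \<psi> p (- z) = complex_fourier e \<psi> p z"
  unfolding complex_fourier_def by simp

context
  fixes e :: "real ^ 3" and R :: real and \<psi> :: "real ^ 3 \<Rightarrow> complex ^ 4"
  assumes e: "norm e = 1" and \<psi>: "compact_wave R \<psi>"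
begin

lemma inner_unit_le: "\<bar>x \<bullet> e\<bar> \<le> norm x"
  using Cauchy_Schwarz_ineq2[of x e] e by simp

lemma AE_norm_inner_le: "AE x in lborel. \<psi> x \<noteq> 0 \<longrightarrow> \<bar>x \<bullet> e\<bar> \<le> \<bar>R\<bar>"
  using compact_waveD(3)[OF \<psi>]
proof eventually_elim
  case (elim x)
  then show ?case using inner_unit_le[of x] by (cases "norm x > R") auto
qed

lemma integrable_complex_phase:
  "integrable lborel (\<lambda>x. complex_phase e p z x *s \<psi> x)"
proof (rule Bochner_Integration.integrable_bound)
  have [measurable]: "\<psi> \<in> borel_measurable borel" by (rule compact_waveD(1)[OF \<psi>])
  show "(\<lambda>x. complex_phase e p z x *s \<psi> x) \<in> borel_measurable lborel"
    by measurable
  show "integrable lborel (\<lambda>x. exp (\<bar>Im z\<bar> * \<bar>R\<bar>) *\<^sub>R \<psi> x)" using compact_waveD(4)[OF \<psi>] by simp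
  show "AE x in lborel. norm (complex_phase e p z x *s \<psi> x) \<le> norm (exp (\<bar>Im z\<bar> * \<bar>R\<bar>) *\<^sub>R \<psi> x)"
    using AE_norm_inner_le
  proof eventually_elim
    case (elim x)
    show ?case
    proof (cases "\<psi> x = 0")
      case False
      have "Im z * (x \<bullet> e) \<le> \<bar>Im z\<bar> * \<bar>x \<bullet> e\<bar>" by (metis abs_ge_self abs_mult)
      also have "\<dots> \<le> \<bar>Im z\<bar> * \<bar>R\<bar>" using elim False by (intro mult_left_mono) auto
      finally show ?thesis by (simp add: norm_complex_phase mult_right_mono)
    qed simp
  qed
qed

lemma complex_fourier_bound:
  assumes "AE x in lborel. \<psi> x \<noteq> 0 \<longrightarrow> Im z * (x \<bullet> e) \<le> B"
  shows "norm (complex_fourier e \<psi> p z) \<le> exp B * (LINT x|lborel. norm (\<psi> x))"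
proof -
  have "norm (LINT x|lborel. complex_phase e p z x *s \<psi> x)
     \<le> (LINT x|lborel. norm (complex_phase e p z x *s \<psi> x))"
    by (rule integral_norm_bound)
  also have "\<dots> \<le> (LINT x|lborel. exp B * norm (\<psi> x))"
  proof (rule integral_mono_AE)
    show "integrable lborel (\<lambda>x. norm (complex_phase e p z x *s \<psi> x))"
      by (rule integrable_norm[OF integrable_complex_phase])
    show "integrable lborel (\<lambda>x. exp B * norm (\<psi> x))" using compact_waveD(4)[OF \<psi>] by simp
    show "AE x in lborel. norm (complex_phase e p z x *s \<psi> x) \<le> exp B * norm (\<psi> x)"
      using assms
    proof eventually_elim
      case (elim x)
      then show ?case by (cases "\<psi> x = 0") (auto simp: norm_complex_phase intro!: mult_right_mono)
    qed
  qed
  finally have 1: "norm (LINT x|lborel. complex_phase e p z x *s \<psi> x)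
      \<le> exp B * (LINT x|lborel. norm (\<psi> x))" by simp
  have "(2 * pi) powr (- 3 / 2) \<le> (2 * pi) powr 0"
    using pi_ge_two by (intro powr_mono) auto
  then have "(2 * pi) powr (- 3 / 2) \<le> 1" by simp
  then have "(2 * pi) powr (- 3 / 2) * norm (LINT x|lborel. complex_phase e p z x *s \<psi> x)
     \<le> 1 * (exp B * (LINT x|lborel. norm (\<psi> x)))"
    by (intro mult_mono 1) auto
  then show ?thesis unfolding complex_fourier_def by simp
qed

lemma complex_fourier_bound_exp:
  "norm (complex_fourier e \<psi> p z) \<le> exp (\<bar>R\<bar> * \<bar>Im z\<bar>) * (LINT x|lborel. norm (\<psi> x))"
proof (rule complex_fourier_bound)
  show "AE x in lborel. \<psi> x \<noteq> 0 \<longrightarrow> Im z * (x \<bullet> e) \<le> \<bar>R\<bar> * \<bar>Im z\<bar>"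
    using AE_norm_inner_le
  proof eventually_elim
    case (elim x)
    have "Im z * (x \<bullet> e) \<le> \<bar>Im z\<bar> * \<bar>x \<bullet> e\<bar>" by (metis abs_ge_self abs_mult)
    moreover have "\<bar>Im z\<bar> * \<bar>x \<bullet> e\<bar> \<le> \<bar>Im z\<bar> * \<bar>R\<bar>" if "\<psi> x \<noteq> 0" using elim that by (intro mult_left_mono) auto
    ultimately show ?case by (auto simp: mult.commute)
  qed
qed

lemma complex_fourier_bound_below:
  assumes "vanishes_below e a \<psi>" "Im z \<le> 0"
  shows "norm (complex_fourier e \<psi> p z) \<le> exp (a * Im z) * (LINT x|lborel. norm (\<psi> x))"
proof (rule complex_fourier_bound)
  show "AE x in lborel. \<psi> x \<noteq> 0 \<longrightarrow> Im z * (x \<bullet> e) \<le> a * Im z"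
    using assms(1) unfolding vanishes_below_def
    by eventually_elim (use assms(2) in \<open>auto simp: mult.commute[of "Im z"] not_less intro!: mult_right_mono_neg\<close>)
qed

lemma complex_fourier_nth:
  "complex_fourier e \<psi> p z $ i = (2 * pi) powr (- 3 / 2) * (LINT x|lborel. complex_phase e p z x * \<psi> x $ i)"
  unfolding complex_fourier_def vector_scaleR_component integrable_vec_nth(2)[OF integrable_complex_phase]
  by (simp add: scaleR_conv_of_real)

text \<open>Differentiation under the integral. On the support |xe| \<le> |R|, so for increments of
  modulus at most 1 the inequality |e^w - 1| \<le> |w| e^|w| bounds the difference quotients by |R|
  e^|R| times the integrand.\<close>

lemma complex_fourier_holomorphic:
  "(\<lambda>z. complex_fourier e \<psi> p z $ i) holomorphic_on UNIV"
proof -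
  define k where "k z x = complex_phase e p z x * \<psi> x $ i" for z x
  have [measurable]: "\<psi> \<in> borel_measurable borel" by (rule compact_waveD(1)[OF \<psi>])
  have [measurable]: "k z \<in> borel_measurable borel" for z unfolding k_def by measurable
  have ki: "integrable lborel (k z)" for z
    unfolding k_def using integrable_vec_nth(1)[OF integrable_complex_phase, of p z i] by simp
  have [simp]: "(\<lambda>x. - (\<i> * complex_of_real (x \<bullet> e)) * k z x) \<in> borel_measurable borel" for z by measurable
  define k' where "k' z = (LINT x|lborel. - (\<i> * complex_of_real (x \<bullet> e)) * k z x)" for z
  have "((\<lambda>z. integral\<^sup>L lborel (k z)) has_field_derivative k' z) (at z)" for z
    unfolding DERIV_def
  proof (subst tendsto_at_iff_sequentially, intro allI impI)
    fix h assume h: "\<forall>n. h n \<in> UNIV - {0}" "h \<longlonglongrightarrow> (0 :: complex)"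
    have h0: "h n \<noteq> 0" for n using h(1) by auto
    obtain n0 where n0: "\<And>n. n \<ge> n0 \<Longrightarrow> norm (h n) \<le> 1"
      using LIMSEQ_D[OF h(2), of 1] by (auto intro: less_imp_le)
    define q where "q n x = (k (z + h n) x - k z x) / h n" for n x
    have qe: "q n x = k z x * ((exp (h n * (- (\<i> * complex_of_real (x \<bullet> e)))) - 1) / h n)" for n x
    proof -
      have "k (z + h n) x = k z x * exp (h n * (- (\<i> * complex_of_real (x \<bullet> e))))"
        unfolding k_def by (simp add: algebra_simps flip: exp_add)
      then show ?thesis by (simp add: q_def right_diff_distrib)
    qed
    have ex: "norm (exp w - 1) \<le> norm w * exp (norm w)" for w :: complex
      using Taylor_exp_field[of w 0] by (simp add: mult.commute)
    have "(\<lambda>n. LINT x|lborel. q (n + n0) x) \<longlonglongrightarrow> k' z"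
      unfolding k'_def
    proof (rule integral_dominated_convergence[where w="\<lambda>x. norm (k z x) * (\<bar>R\<bar> * exp \<bar>R\<bar>)"])
      show "integrable lborel (\<lambda>x. norm (k z x) * (\<bar>R\<bar> * exp \<bar>R\<bar>))" using ki[of z] by simp
      show "AE x in lborel. (\<lambda>n. q (n + n0) x) \<longlonglongrightarrow> - (\<i> * complex_of_real (x \<bullet> e)) * k z x"
      proof (rule AE_I2)
        fix x
        let ?c = "- (\<i> * complex_of_real (x \<bullet> e))"
        have "((\<lambda>u. exp (u * ?c)) has_field_derivative exp (0 * ?c) * ?c) (at 0)"
          by (auto intro!: derivative_eq_intros)
        then have "((\<lambda>u. (exp (u * ?c) - 1) / u) \<longlongrightarrow> ?c) (at 0)"
          unfolding DERIV_def by simp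
        then have "(\<lambda>n. (exp (h n * ?c) - 1) / h n) \<longlonglongrightarrow> ?c"
          unfolding tendsto_at_iff_sequentially using h by (auto simp: o_def)
        then have "(\<lambda>n. k z x * ((exp (h n * ?c) - 1) / h n)) \<longlonglongrightarrow> k z x * ?c"
          by (intro tendsto_intros)
        then show "(\<lambda>n. q (n + n0) x) \<longlonglongrightarrow> ?c * k z x"
          unfolding qe mult.commute[of ?c] by (rule LIMSEQ_ignore_initial_segment)
      qed
      show "AE x in lborel. norm (q (n + n0) x) \<le> norm (k z x) * (\<bar>R\<bar> * exp \<bar>R\<bar>)" for n
        using AE_norm_inner_le
      proof eventually_elim
        case (elim x)
        show ?case
        proof (cases "\<psi> x = 0")
          case True then show ?thesis by (simp add: qe k_def)
        next
          case False
          let ?c = "- (\<i> * complex_of_real (x \<bullet> e))" and ?h = "h (n + n0)"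
          have c: "norm ?c \<le> \<bar>R\<bar>" using elim False by (simp add: norm_mult)
          have hc: "norm (?h * ?c) \<le> norm ?h * \<bar>R\<bar>" unfolding norm_mult[of ?h] using c by (intro mult_left_mono) auto
          also have "\<dots> \<le> 1 * \<bar>R\<bar>" using n0[of "n + n0"] by (intro mult_right_mono) auto
          finally have hc1: "norm (?h * ?c) \<le> \<bar>R\<bar>" by simp
          have "norm (exp (?h * ?c) - 1) \<le> norm (?h * ?c) * exp (norm (?h * ?c))" by (rule ex)
          also have "\<dots> \<le> (norm ?h * \<bar>R\<bar>) * exp \<bar>R\<bar>"
            using hc hc1 by (intro mult_mono) auto
          finally have "norm ((exp (?h * ?c) - 1) / ?h) \<le> \<bar>R\<bar> * exp \<bar>R\<bar>"
            using h0[of "n + n0"] by (simp add: norm_divide divide_le_eq mult_ac)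
          then show ?thesis unfolding qe norm_mult[of "k z x"] by (intro mult_left_mono) auto
        qed
      qed
    qed (auto simp: q_def)
    then have "(\<lambda>n. LINT x|lborel. q n x) \<longlonglongrightarrow> k' z" by (rule LIMSEQ_offset)
    moreover have "(LINT x|lborel. q n x) = (integral\<^sup>L lborel (k (z + h n)) - integral\<^sup>L lborel (k z)) / h n" for n
      unfolding q_def using ki by simp
    ultimately show "((\<lambda>u. (integral\<^sup>L lborel (k (z + u)) - integral\<^sup>L lborel (k z)) / u) \<circ> h) \<longlonglongrightarrow> k' z"
      by (simp add: o_def)
  qed
  then have "(\<lambda>z. integral\<^sup>L lborel (k z)) holomorphic_on UNIV"
    by (auto simp: holomorphic_on_def field_differentiable_def intro: has_field_derivative_at_within)
  then show ?thesis
    unfolding complex_fourier_nth k_def by (intro holomorphic_intros)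
qed

end

section \<open>From growth at complex momenta back to supports\<close>

lemma compact_wave_restrict:
  assumes "compact_wave R \<psi>" and [measurable]: "A \<in> sets borel"
  shows "compact_wave R (\<lambda>x. indicat_real A x *\<^sub>R \<psi> x)"
  unfolding compact_wave_def dirac_wavefunction_def
proof (intro conjI)
  note [measurable] = compact_waveD(1)[OF assms(1)]
  show "(\<lambda>x. indicat_real A x *\<^sub>R \<psi> x) \<in> borel_measurable lborel" by measurable
  show "integrable lborel (\<lambda>x. (norm (indicat_real A x *\<^sub>R \<psi> x))\<^sup>2)"
    by (rule Bochner_Integration.integrable_bound[OF compact_waveD(2)[OF assms(1)]]) (auto simp: indicator_def)
  show "AE x in lborel. R < norm x \<longrightarrow> indicat_real A x *\<^sub>R \<psi> x = 0"
    using compact_waveD(3)[OF assms(1)] by eventually_elim auto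
qed

lemma compact_wave_fourier_zero:
  assumes "compact_wave R \<psi>" "AE p in lborel. fourier_integral \<psi> p = 0"
  shows "AE x in lborel. \<psi> x = 0"
proof -
  note [measurable] = compact_waveD(1)[OF assms(1)]
  have "L2_square (\<lambda>x. \<psi> x) = L2_square (\<lambda>p. fourier_integral \<psi> p)"
    by (rule plancherel_vector[OF compact_waveD(4)[OF assms(1)] compact_waveD(2)[OF assms(1)], symmetric])
  also have "\<dots> = 0" using assms(2) by (subst nn_integral_0_iff_AE) auto
  finally show ?thesis by (subst (asm) nn_integral_0_iff_AE) auto
qed

lemma AE_inner_neq:
  assumes "norm (e :: real ^ 3) = 1"
  shows "AE x in lborel. x \<bullet> e \<noteq> a"
proof -
  have "negligible {x. e \<bullet> x = a}" using assms by (intro negligible_hyperplane) auto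
  then have "AE x in lebesgue. x \<notin> {x. e \<bullet> x = a}"
    unfolding negligible_iff_null_sets by (rule AE_not_in)
  then show ?thesis by (simp add: AE_completion_iff inner_commute)
qed

text \<open>After multiplication by $e^{\mathrm{i}az}$, the transform of the part of \<open>\<psi>\<close> below the hyperplane is bounded on
  both axes, hence constant; it decays along the positive imaginary axis, hence it is zero.\<close>

theorem vanishes_below_of_growth:
  assumes e: "norm e = 1" and \<psi>: "compact_wave R \<psi>"
    and growth: "\<And>p. p \<bullet> e \<noteq> 0 \<Longrightarrow> \<exists>C. \<forall>s\<le>0. norm (complex_fourier e \<psi> p (\<i> * of_real s)) \<le> C * exp (a * s)"
  shows "vanishes_below e a \<psi>"
proof -
  define A where "A = {x :: real ^ 3. x \<bullet> e < a}"
  have A[measurable]: "A \<in> sets borel"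
    unfolding A_def by (intro borel_open open_Collect_less continuous_intros)
  define g where "g x = indicat_real A x *\<^sub>R \<psi> x" for x
  define k where "k x = \<psi> x - g x" for x
  have g: "compact_wave R g" unfolding g_def by (rule compact_wave_restrict[OF \<psi> A])
  have k: "compact_wave R k" unfolding k_def by (rule compact_wave_diff[OF \<psi> g])
  note [measurable] = compact_waveD(1)[OF g]
  have ka: "vanishes_below e a k" by (auto simp: vanishes_below_def k_def g_def A_def)
  let ?N = "LINT x|lborel. norm (g x)" and ?K = "LINT x|lborel. norm (k x)"
  have N0: "?N \<ge> 0" and K0: "?K \<ge> 0" by simp_all
  have split: "complex_fourier e g p z = complex_fourier e \<psi> p z - complex_fourier e k p z" for p z
  proof -
    have "complex_fourier e k p z = complex_fourier e \<psi> p z - complex_fourier e g p z"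
    proof -
      have "c *s k x = c *s \<psi> x - c *s g x" for c x by (simp add: k_def vec_eq_iff algebra_simps)
      then show ?thesis
        unfolding complex_fourier_def
        using integrable_complex_phase[OF e \<psi>, of p z] integrable_complex_phase[OF e g, of p z]
        by (simp add: scaleR_diff_right)
    qed
    then show ?thesis by simp
  qed
  have "fourier_integral g p = 0" if p: "p \<bullet> e \<noteq> 0" for p
  proof -
    obtain C where C: "\<And>s. s \<le> 0 \<Longrightarrow> norm (complex_fourier e \<psi> p (\<i> * of_real s)) \<le> C * exp (a * s)"
      using growth[OF p] by blast
    have "complex_fourier e g p 0 $ i = 0" for i
    proof -
      \<comment> \<open>The exponential moves the hyperplane xe = a to the origin, so that the
        integrand defining f decays along the positive imaginary axis.\<close>
      define f where "f z = complex_fourier e g p z $ i * exp (\<i> * of_real a * z)" for z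
      have hol: "f holomorphic_on UNIV"
        unfolding f_def by (intro holomorphic_intros complex_fourier_holomorphic[OF e g])
      have nf: "norm (f z) \<le> norm (complex_fourier e g p z) * exp (- a * Im z)" for z
        unfolding f_def norm_mult by (intro mult_mono Finite_Cartesian_Product.norm_nth_le) (auto simp: norm_exp_eq_Re)
      have gr: "norm (f z) \<le> ?N * exp ((\<bar>R\<bar> + \<bar>a\<bar>) * norm z)" for z
      proof -
        have "norm (f z) \<le> (exp (\<bar>R\<bar> * \<bar>Im z\<bar>) * ?N) * exp (\<bar>a\<bar> * \<bar>Im z\<bar>)"
          using complex_fourier_bound_exp[OF e g, of p z]
          by (intro order_trans[OF nf] mult_mono) (auto simp: abs_mult[symmetric] simp del: abs_mult intro: order_trans[OF abs_ge_self[of "- a * Im z"]])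
        also have "\<dots> = ?N * exp ((\<bar>R\<bar> + \<bar>a\<bar>) * \<bar>Im z\<bar>)" by (simp add: algebra_simps exp_add)
        also have "\<dots> \<le> ?N * exp ((\<bar>R\<bar> + \<bar>a\<bar>) * norm z)"
          using N0 abs_Im_le_cmod[of z] by (intro mult_left_mono) (auto intro!: mult_left_mono)
        finally show ?thesis .
      qed
      \<comment> \<open>The two halves of the axis are bounded for different reasons. Upwards, g
        lives below the hyperplane; downwards, g = \<psi> - k, where \<psi> obeys the growth
        hypothesis and k lives above the hyperplane.\<close>
      have fy: "norm (f (\<i> * of_real y)) \<le> ?N + \<bar>C\<bar> + ?K" for y
      proof (cases "y \<ge> 0")
        case True
        have "norm (complex_fourier e g p (\<i> * of_real y)) \<le> exp (a * y) * ?N"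
          by (rule complex_fourier_bound[OF e g]) (use True in \<open>auto simp: g_def A_def indicator_def mult.commute[of a] intro!: AE_I2 mult_left_mono\<close>)
        then have "norm (f (\<i> * of_real y)) \<le> (exp (a * y) * ?N) * exp (- a * y)"
          using nf[of "\<i> * of_real y"] by (auto elim!: order_trans intro!: mult_right_mono)
        also have "\<dots> = ?N" by (simp add: exp_minus)
        finally show ?thesis using K0 abs_ge_zero[of C] by linarith
      next
        case False
        have "norm (complex_fourier e g p (\<i> * of_real y)) \<le> norm (complex_fourier e \<psi> p (\<i> * of_real y)) + norm (complex_fourier e k p (\<i> * of_real y))"
          unfolding split by (rule norm_triangle_ineq4)
        also have "\<dots> \<le> C * exp (a * y) + exp (a * y) * ?K"
          using C[of y] complex_fourier_bound_below[OF e k ka, of "\<i> * of_real y" p] False by (intro add_mono) auto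
        also have "\<dots> \<le> (\<bar>C\<bar> + ?K) * exp (a * y)" by (simp add: algebra_simps)
        finally have "norm (f (\<i> * of_real y)) \<le> ((\<bar>C\<bar> + ?K) * exp (a * y)) * exp (- a * y)"
          using nf[of "\<i> * of_real y"] by (auto elim!: order_trans intro!: mult_right_mono)
        also have "\<dots> = \<bar>C\<bar> + ?K" by (simp add: exp_minus)
        finally show ?thesis using N0 abs_ge_zero[of C] by linarith
      qed
      have fx: "norm (f (of_real x)) \<le> ?N + \<bar>C\<bar> + ?K" for x
      proof -
        have "norm (f (of_real x)) \<le> norm (complex_fourier e g p (of_real x))" using nf[of "of_real x"] by simp
        also have "\<dots> \<le> ?N" using complex_fourier_bound_exp[OF e g, of p "of_real x"] by simp
        finally show ?thesis using K0 abs_ge_zero[of C] by linarith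
      qed
      have const: "f z = f 0" for z
        by (rule entire_exponential_type_constant[OF hol gr, where k=0 and M="?N + \<bar>C\<bar> + ?K" and c=1 and b="?N + \<bar>C\<bar> + ?K"])
           (use fx fy in auto)
      \<comment> \<open>The constant f is evaluated at the points \<i>n. There it is dominated by
        integrals that tend to 0, because g vanishes where xe \<ge> a.\<close>
      have "(\<lambda>n. LINT x|lborel. exp (real n * (x \<bullet> e - a)) * norm (g x)) \<longlonglongrightarrow> (LINT x|(lborel :: (real ^ 3) measure). 0)"
      proof (rule integral_dominated_convergence[where w="\<lambda>x. norm (g x)"])
        show "AE x in lborel. (\<lambda>n. exp (real n * (x \<bullet> e - a)) * norm (g x)) \<longlonglongrightarrow> 0"
        proof (rule AE_I2)
          fix x
          show "(\<lambda>n. exp (real n * (x \<bullet> e - a)) * norm (g x)) \<longlonglongrightarrow> 0"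
          proof (cases "x \<bullet> e < a")
            case True
            then have "(\<lambda>n. exp (x \<bullet> e - a) ^ n * norm (g x)) \<longlonglongrightarrow> 0 * norm (g x)"
              by (intro tendsto_intros LIMSEQ_realpow_zero) auto
            then show ?thesis by (simp add: exp_of_nat_mult)
          next
            case False then show ?thesis by (simp add: g_def A_def)
          qed
        qed
        show "AE x in lborel. norm (exp (real n * (x \<bullet> e - a)) * norm (g x)) \<le> norm (g x)" for n
          by (rule AE_I2) (auto simp: g_def A_def indicator_def mult_nonneg_nonpos intro!: mult_left_le_one_le)
      qed (use compact_waveD(4)[OF g] in auto)
      then have l0: "(\<lambda>n. LINT x|lborel. exp (real n * (x \<bullet> e - a)) * norm (g x)) \<longlonglongrightarrow> 0" by simp
      have "norm (f 0) \<le> (LINT x|lborel. exp (real n * (x \<bullet> e - a)) * norm (g x))" for n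
      proof -
        let ?z = "\<i> * complex_of_real (real n)"
        let ?I = "LINT x|lborel. complex_phase e p ?z x *s g x"
        have c1: "(2 * pi) powr (- 3 / 2) \<le> 1"
        proof -
          have "(2 * pi) powr (- 3 / 2) \<le> (2 * pi) powr 0" using pi_ge_two by (intro powr_mono) auto
          then show ?thesis by simp
        qed
        have "norm (complex_fourier e g p ?z) \<le> 1 * norm ?I"
          unfolding complex_fourier_def norm_scaleR using c1 by (intro mult_right_mono) auto
        also have "\<dots> \<le> (LINT x|lborel. norm (complex_phase e p ?z x *s g x))"
          unfolding mult_1 by (rule integral_norm_bound)
        also have "\<dots> = (LINT x|lborel. exp (real n * (x \<bullet> e)) * norm (g x))"
          by (simp only: norm_vector_smult norm_complex_phase) simp
        finally have "norm (f ?z) \<le> (LINT x|lborel. exp (real n * (x \<bullet> e)) * norm (g x)) * exp (- a * real n)"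
          using nf[of ?z] by (auto elim!: order_trans intro!: mult_right_mono)
        also have "\<dots> = (LINT x|lborel. exp (real n * (x \<bullet> e)) * norm (g x) * exp (- a * real n))"
          by (rule integral_mult_left_zero[symmetric])
        also have "\<dots> = (LINT x|lborel. exp (real n * (x \<bullet> e - a)) * norm (g x))"
          by (intro Bochner_Integration.integral_cong refl) (simp add: right_diff_distrib exp_diff exp_minus field_simps)
        finally show ?thesis using const[of ?z] by simp
      qed
      then have "norm (f 0) \<le> 0" by (intro LIMSEQ_le_const[OF l0]) auto
      then show ?thesis by (simp add: f_def)
    qed
    then have "complex_fourier e g p (of_real 0) = 0" by (simp add: vec_eq_iff)
    then show ?thesis unfolding complex_fourier_of_real by simp
  qed
  \<comment> \<open>The momenta with pe = 0, about which the hypothesis is silent, form a null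
    set.\<close>
  then have "AE p in lborel. fourier_integral g p = 0"
    using AE_inner_neq[OF e, of 0] by (auto elim!: eventually_mono)
  from compact_wave_fourier_zero[OF g this]
  show ?thesis unfolding vanishes_below_def
    by eventually_elim (auto simp: g_def A_def indicator_def)
qed

section \<open>The symbol and the energy at complex momenta\<close>

definition complex_symbol :: "(3 \<Rightarrow> complex ^ 4 ^ 4) \<Rightarrow> complex ^ 4 ^ 4 \<Rightarrow> real \<Rightarrow> real ^ 3 \<Rightarrow> real ^ 3 \<Rightarrow> complex \<Rightarrow> complex ^ 4 \<Rightarrow> complex ^ 4" where
  "complex_symbol \<alpha> \<beta> m e p z v = dirac_symbol \<alpha> \<beta> m p *v v + z *s (dirac_symbol \<alpha> \<beta> 0 e *v v)"

text \<open>The square of the energy at the momentum p + ze. Unlike the energy itself, it is a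
  polynomial in z.\<close>

definition complex_energy2 :: "real \<Rightarrow> real ^ 3 \<Rightarrow> real ^ 3 \<Rightarrow> complex \<Rightarrow> complex" where
  "complex_energy2 m e p z = complex_of_real ((energy m p)\<^sup>2) + 2 * z * complex_of_real (p \<bullet> e) + z\<^sup>2"

lemma complex_symbol_of_real:
  "complex_symbol \<alpha> \<beta> m e p (of_real r) v = dirac_symbol \<alpha> \<beta> m (p + r *\<^sub>R e) *v v"
  using dirac_symbol_add[of \<alpha> \<beta> m "r * 0" p "r *\<^sub>R e" v] dirac_symbol_scaleR[of \<alpha> \<beta> r 0 e v]
  by (simp add: complex_symbol_def scaleR_eq_smult)

lemma complex_symbol_add: "complex_symbol \<alpha> \<beta> m e p z (v + w) = complex_symbol \<alpha> \<beta> m e p z v + complex_symbol \<alpha> \<beta> m e p z w"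
  by (simp add: complex_symbol_def matrix_vector_right_distrib smult_add)

lemma complex_symbol_smult: "complex_symbol \<alpha> \<beta> m e p z (c *s v) = c *s complex_symbol \<alpha> \<beta> m e p z v"
  by (simp add: complex_symbol_def matrix_vector_mult_smult smult_add smult_smult mult.commute)

lemma complex_symbol_holomorphic:
  fixes F :: "complex \<Rightarrow> complex ^ 4"
  assumes "\<And>j. (\<lambda>z. F z $ j) holomorphic_on S"
  shows "(\<lambda>z. complex_symbol \<alpha> \<beta> m e p z (F z) $ i) holomorphic_on S"
  unfolding complex_symbol_def matrix_vector_mult_def vector_add_component vector_smult_component vec_lambda_beta
  by (intro holomorphic_intros assms)

lemma complex_energy2_holomorphic [holomorphic_intros]: "complex_energy2 m e p holomorphic_on S"
  unfolding complex_energy2_def[abs_def] by (intro holomorphic_intros)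

lemma norm_le_energy: "norm p \<le> energy m p"
  unfolding energy_def by (rule real_le_rsqrt) simp

lemma holomorphic_eq_of_reals:
  assumes "f holomorphic_on S" "g holomorphic_on S" "open S" "connected S" "0 \<in> S"
    and "\<And>r. complex_of_real r \<in> S \<Longrightarrow> f (of_real r) = g (of_real r)" and "z \<in> S"
  shows "f z = g z"
proof -
  have "(\<lambda>z. f z - g z) z = 0"
  proof (rule analytic_continuation[where f="\<lambda>z. f z - g z" and S=S and U="S \<inter> range complex_of_real" and \<xi>=0])
    show "(\<lambda>z. f z - g z) holomorphic_on S" using assms(1,2) by (intro holomorphic_intros)
    show "0 islimpt S \<inter> range complex_of_real"
      unfolding islimpt_approachable
    proof (intro allI impI)
      fix r :: real assume "r > 0"
      obtain d where d: "d > 0" "ball 0 d \<subseteq> S" using assms(3,5) by (meson open_contains_ball)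
      let ?x = "complex_of_real (min r d / 2)"
      have "norm ?x = min r d / 2" using \<open>r > 0\<close> d(1) by (subst norm_of_real) auto
      then have "?x \<in> S" "?x \<noteq> 0" "dist ?x 0 < r" using d \<open>r > 0\<close> by (auto simp: dist_norm simp del: norm_of_real)
      then show "\<exists>x'\<in>S \<inter> range complex_of_real. x' \<noteq> 0 \<and> dist x' 0 < r" by blast
    qed
  qed (use assms in auto)
  then show ?thesis by simp
qed

lemma norm_cos_sin_le:
  fixes u :: complex
  shows "norm (cos u) \<le> exp \<bar>Im u\<bar>" "norm (sin u) \<le> exp \<bar>Im u\<bar>"
proof -
  have n: "norm (exp (\<i> * u)) \<le> exp \<bar>Im u\<bar>" "norm (exp (- (\<i> * u))) \<le> exp \<bar>Im u\<bar>"
    by (auto simp: norm_exp_eq_Re)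
  have "norm (exp (\<i> * u) + exp (- (\<i> * u))) \<le> exp \<bar>Im u\<bar> + exp \<bar>Im u\<bar>"
    by (intro norm_triangle_le add_mono n)
  then show "norm (cos u) \<le> exp \<bar>Im u\<bar>" unfolding cos_exp_eq by (simp add: norm_divide)
  have "norm (exp (\<i> * u) - exp (- (\<i> * u))) \<le> exp \<bar>Im u\<bar> + exp \<bar>Im u\<bar>"
    by (intro norm_triangle_le_diff add_mono n)
  then show "norm (sin u) \<le> exp \<bar>Im u\<bar>" unfolding sin_exp_eq by (simp add: norm_divide norm_mult)
qed

lemma norm_cos_ge:
  fixes u :: complex
  shows "norm (cos u) \<ge> (exp \<bar>Im u\<bar> - 1) / 2"
proof -
  have "\<bar>norm (exp (\<i> * u)) - norm (- exp (- (\<i> * u)))\<bar> \<le> norm (exp (\<i> * u) - (- exp (- (\<i> * u))))"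
    by (rule norm_triangle_ineq3)
  then have "\<bar>exp (- Im u) - exp (Im u)\<bar> \<le> norm (exp (\<i> * u) + exp (- (\<i> * u)))"
    by (simp add: norm_exp_eq_Re)
  moreover have "exp \<bar>Im u\<bar> - 1 \<le> \<bar>exp (- Im u) - exp (Im u)\<bar>"
    by (cases "Im u \<ge> 0") (auto simp: abs_if)
  ultimately show ?thesis unfolding cos_exp_eq by (simp add: norm_divide)
qed

text \<open>Between -S and 0 the general exponential bound for transforms of bounded support is
  absorbed into the constant, so an estimate for large negative s suffices.\<close>

lemma vanishes_below_of_growth_eventually:
  assumes e: "norm e = 1" and \<psi>: "compact_wave R \<psi>"
    and growth: "\<And>p. p \<bullet> e \<noteq> 0 \<Longrightarrow> \<exists>C S. \<forall>s\<le>-S. norm (complex_fourier e \<psi> p (\<i> * of_real s)) \<le> C * exp (a * s)"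
  shows "vanishes_below e a \<psi>"
proof (rule vanishes_below_of_growth[OF e \<psi>])
  fix p :: "real ^ 3" assume "p \<bullet> e \<noteq> 0"
  then obtain C S where C: "\<And>s. s \<le> - S \<Longrightarrow> norm (complex_fourier e \<psi> p (\<i> * of_real s)) \<le> C * exp (a * s)"
    using growth by blast
  let ?N = "LINT x|lborel. norm (\<psi> x)"
  have N0: "?N \<ge> 0" by simp
  have "norm (complex_fourier e \<psi> p (\<i> * of_real s)) \<le> (\<bar>C\<bar> + exp (\<bar>R\<bar> * \<bar>S\<bar>) * ?N * exp (\<bar>a\<bar> * \<bar>S\<bar>)) * exp (a * s)"
    if s: "s \<le> 0" for s
  proof (cases "s \<le> - S")
    case True
    have "C * exp (a * s) \<le> (\<bar>C\<bar> + exp (\<bar>R\<bar> * \<bar>S\<bar>) * ?N * exp (\<bar>a\<bar> * \<bar>S\<bar>)) * exp (a * s)"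
      using N0 by (intro mult_right_mono) (auto intro: order_trans[OF abs_ge_self])
    then show ?thesis using C[OF True] by linarith
  next
    case False
    then have sS: "\<bar>s\<bar> \<le> \<bar>S\<bar>" using s by auto
    have "norm (complex_fourier e \<psi> p (\<i> * of_real s)) \<le> exp (\<bar>R\<bar> * \<bar>s\<bar>) * ?N"
      using complex_fourier_bound_exp[OF e \<psi>, of p "\<i> * of_real s"] by simp
    also have "\<dots> \<le> exp (\<bar>R\<bar> * \<bar>S\<bar>) * ?N"
      using sS N0 by (intro mult_right_mono) (auto intro: mult_left_mono)
    also have "\<dots> \<le> (exp (\<bar>R\<bar> * \<bar>S\<bar>) * ?N * exp (\<bar>a\<bar> * \<bar>S\<bar>)) * exp (a * s)"
    proof -
      have "- (a * s) \<le> \<bar>a\<bar> * \<bar>s\<bar>" by (metis abs_ge_minus_self abs_mult)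
      also have "\<dots> \<le> \<bar>a\<bar> * \<bar>S\<bar>" using sS by (intro mult_left_mono) auto
      finally have "exp (\<bar>a\<bar> * \<bar>S\<bar>) * exp (a * s) \<ge> 1" by (simp flip: exp_add)
      from mult_left_mono[OF this, of "exp (\<bar>R\<bar> * \<bar>S\<bar>) * ?N"] show ?thesis using N0 by (simp add: mult.assoc)
    qed
    also have "\<dots> \<le> (\<bar>C\<bar> + exp (\<bar>R\<bar> * \<bar>S\<bar>) * ?N * exp (\<bar>a\<bar> * \<bar>S\<bar>)) * exp (a * s)"
      by (intro mult_right_mono) auto
    finally show ?thesis .
  qed
  then show "\<exists>C. \<forall>s\<le>0. norm (complex_fourier e \<psi> p (\<i> * of_real s)) \<le> C * exp (a * s)" by blast
qed

context
  fixes \<alpha> :: "3 \<Rightarrow> complex ^ 4 ^ 4" and \<beta> :: "complex ^ 4 ^ 4" and m :: real and e :: "real ^ 3"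
  assumes dm: "dirac_matrices \<alpha> \<beta>" and m: "m > 0" and e: "norm e = 1"
begin

lemma complex_symbol_square:
  "complex_symbol \<alpha> \<beta> m e p z (complex_symbol \<alpha> \<beta> m e p z v) = complex_energy2 m e p z *s v"
proof -
  let ?D = "\<lambda>v. dirac_symbol \<alpha> \<beta> m p *v v" and ?A = "\<lambda>v. dirac_symbol \<alpha> \<beta> 0 e *v v"
  have "complex_symbol \<alpha> \<beta> m e p z (complex_symbol \<alpha> \<beta> m e p z v) = ?D (?D v) + z *s (?D (?A v) + ?A (?D v)) + z\<^sup>2 *s ?A (?A v)"
    by (simp add: complex_symbol_def matrix_vector_right_distrib matrix_vector_mult_smult smult_add smult_smult power2_eq_square)
  also have "?D (?D v) = (energy m p)\<^sup>2 *\<^sub>R v" by (simp add: dirac_symbol_square[OF dm] energy_power2)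
  also have "?D (?A v) + ?A (?D v) = (2 * (p \<bullet> e)) *\<^sub>R v" by (simp add: dirac_symbol_anticommute[OF dm])
  also have "?A (?A v) = v" using e by (simp add: dirac_symbol_square[OF dm])
  also have "(energy m p)\<^sup>2 *\<^sub>R v + z *s ((2 * (p \<bullet> e)) *\<^sub>R v) + z\<^sup>2 *s v = complex_energy2 m e p z *s v"
    by (simp add: complex_energy2_def scaleR_eq_smult smult_smult vec_eq_iff algebra_simps)
  finally show ?thesis .
qed

lemma complex_energy2_of_real: "complex_energy2 m e p (of_real r) = of_real ((energy m (p + r *\<^sub>R e))\<^sup>2)"
proof -
  have "(energy m (p + r *\<^sub>R e))\<^sup>2 = (energy m p)\<^sup>2 + 2 * r * (p \<bullet> e) + r\<^sup>2"
    using e by (simp add: energy_power2 power2_norm_eq_inner inner_add_left inner_add_right inner_commute[of e p] norm_eq_1 power2_eq_square[of r] distrib_left)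
  then show ?thesis by (simp add: complex_energy2_def)
qed

lemma norm_complex_symbol_le: "norm (complex_symbol \<alpha> \<beta> m e p z v) \<le> (energy m p + norm z) * norm v"
proof -
  have "norm (complex_symbol \<alpha> \<beta> m e p z v) \<le> norm (dirac_symbol \<alpha> \<beta> m p *v v) + norm (z *s (dirac_symbol \<alpha> \<beta> 0 e *v v))"
    unfolding complex_symbol_def by (rule norm_triangle_ineq)
  also have "\<dots> = (energy m p + norm z) * norm v"
    using e by (simp add: norm_dirac_symbol[OF dm] energy_def algebra_simps)
  finally show ?thesis .
qed

lemma abs_inner_le_energy: "\<bar>p \<bullet> e\<bar> \<le> energy m p"
  using Cauchy_Schwarz_ineq2[of p e] e norm_le_energy[of p m] by simp

lemma norm_complex_energy2_le: "norm (complex_energy2 m e p z) \<le> (energy m p + norm z)\<^sup>2"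
proof -
  have "norm (complex_energy2 m e p z) \<le> (energy m p)\<^sup>2 + 2 * norm z * \<bar>p \<bullet> e\<bar> + (norm z)\<^sup>2"
    unfolding complex_energy2_def by (intro norm_triangle_le add_mono) (auto simp: norm_mult norm_power)
  also have "\<dots> \<le> (energy m p)\<^sup>2 + 2 * norm z * energy m p + (norm z)\<^sup>2"
    using abs_inner_le_energy[of p] by (intro add_mono mult_left_mono) auto
  also have "\<dots> = (energy m p + norm z)\<^sup>2" by (simp add: power2_eq_square algebra_simps)
  finally show ?thesis .
qed

text \<open>The real part of \<omega>^2 at p + \<i>se is energy^2 - s^2, so s^2 \<le> energy^2 + (Im
  \<omega>)^2. Hence |Im \<omega>| differs from |s| by at most the energy at p, which fixes the
  exponential rate of the trigonometric functions of t\<omega>.\<close>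

lemma csqrt_energy_bounds:
  defines "\<Omega> \<equiv> \<lambda>p s. csqrt (complex_energy2 m e p (\<i> * of_real s))"
  shows "\<bar>s\<bar> - energy m p \<le> \<bar>Im (\<Omega> p s)\<bar>" "norm (\<Omega> p s) \<le> energy m p + \<bar>s\<bar>"
proof -
  let ?E = "energy m p"
  have E: "?E > 0" by (rule energy_pos[OF m])
  have sq: "\<Omega> p s ^ 2 = complex_energy2 m e p (\<i> * of_real s)" unfolding \<Omega>_def by simp
  have "Re (\<Omega> p s ^ 2) = ?E\<^sup>2 - s\<^sup>2"
    unfolding sq complex_energy2_def by (simp add: power_mult_distrib)
  then have "s\<^sup>2 = ?E\<^sup>2 + (Im (\<Omega> p s))\<^sup>2 - (Re (\<Omega> p s))\<^sup>2" by (simp add: power2_eq_square)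
  also have "\<dots> \<le> (?E + \<bar>Im (\<Omega> p s)\<bar>)\<^sup>2"
    using zero_le_power2[of "Re (\<Omega> p s)"] mult_nonneg_nonneg[of ?E "\<bar>Im (\<Omega> p s)\<bar>"] E
    unfolding power2_sum power2_abs mult.assoc by linarith
  finally have "\<bar>s\<bar> \<le> \<bar>?E + \<bar>Im (\<Omega> p s)\<bar>\<bar>" by (simp add: abs_le_square_iff)
  then show "\<bar>s\<bar> - energy m p \<le> \<bar>Im (\<Omega> p s)\<bar>" using E by simp
  have "(norm (\<Omega> p s))\<^sup>2 \<le> (?E + \<bar>s\<bar>)\<^sup>2"
    using norm_complex_energy2_le[of p "\<i> * of_real s"] by (simp add: norm_power[symmetric] sq norm_mult)
  then show "norm (\<Omega> p s) \<le> energy m p + \<bar>s\<bar>" using E by (simp add: power2_le_iff_abs_le)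
qed

section \<open>The motion of the edge under the evolution\<close>

lemma complex_fourier_evolution_of_real:
  assumes \<psi>: "compact_wave R \<psi>"
  shows "complex_fourier e (dirac_evolution \<alpha> \<beta> m t \<psi>) p (of_real r) =
     of_real (cos (t * energy m (p + r *\<^sub>R e))) *s complex_fourier e \<psi> p (of_real r) +
     of_real (sin (t * energy m (p + r *\<^sub>R e)) / energy m (p + r *\<^sub>R e)) *s (\<i> *s complex_symbol \<alpha> \<beta> m e p (of_real r) (complex_fourier e \<psi> p (of_real r)))"
  unfolding complex_fourier_of_real complex_symbol_of_real dirac_evolution_compact_wave(2)[OF dm m \<psi>] free_group_eq[OF dm m]
  by (simp only: scaleR_eq_smult)

text \<open>On a half-plane that meets the real axis but avoids the branch cuts of the complexified
  energy, the evolution formula continues from real to complex momenta.\<close>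

lemma complex_fourier_evolution:
  assumes \<psi>: "compact_wave R \<psi>" and q: "p \<bullet> e \<noteq> 0" and z: "(p \<bullet> e) * (Re z + p \<bullet> e) > 0"
  defines "\<Omega> \<equiv> \<lambda>z. csqrt (complex_energy2 m e p z)"
  shows "complex_fourier e (dirac_evolution \<alpha> \<beta> m t \<psi>) p z =
     cos (of_real t * \<Omega> z) *s complex_fourier e \<psi> p z +
     (sin (of_real t * \<Omega> z) / \<Omega> z) *s (\<i> *s complex_symbol \<alpha> \<beta> m e p z (complex_fourier e \<psi> p z))"
proof -
  note \<psi>t = dirac_evolution_compact_wave(1)[OF dm m \<psi>, of t]
  define q where "q = p \<bullet> e"
  \<comment> \<open>The open side of the line Re z = -q that contains the origin, and with it an
    interval of real points; the factor q treats both signs at once.\<close>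
  define P where "P = {z. q * (Re z + q) > 0}"
  have "q \<noteq> 0" using q by (simp add: q_def)
  have inner: "inner (complex_of_real q) z = q * Re z" for z by (simp add: inner_complex_def)
  have P: "P = {z. inner (complex_of_real q) z > - (q * q)}"
    unfolding P_def inner by (auto simp: algebra_simps)
  have oP: "open P" unfolding P by (rule open_halfspace_gt)
  have cP: "connected P" unfolding P by (intro convex_connected convex_halfspace_gt)
  have zeroP: "0 \<in> P" using \<open>q \<noteq> 0\<close> by (auto simp: P_def zero_less_mult_iff neq_iff)
  have E: "energy m p > 0" by (rule energy_pos[OF m])
  have qE: "q\<^sup>2 < (energy m p)\<^sup>2"
  proof -
    have "\<bar>q\<bar> \<le> norm p" using Cauchy_Schwarz_ineq2[of p e] e by (simp add: q_def)
    then have "q\<^sup>2 \<le> (norm p)\<^sup>2" by (metis abs_le_square_iff abs_norm_cancel)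
    then show ?thesis using zero_less_power[OF m, of 2] unfolding energy_power2 by linarith
  qed
  \<comment> \<open>Here \<omega>^2 = (z + q)^2 + (energy^2 - q^2) with energy^2 > q^2, so it can be
    real and nonpositive only if Re z = -q.\<close>
  have cut: "complex_energy2 m e p z \<notin> \<real>\<^sub>\<le>\<^sub>0" if "z \<in> P" for z
  proof
    assume "complex_energy2 m e p z \<in> \<real>\<^sub>\<le>\<^sub>0"
    then have I: "Im (complex_energy2 m e p z) = 0" and Rl: "Re (complex_energy2 m e p z) \<le> 0"
      by (auto simp: complex_nonpos_Reals_iff)
    have "Im (complex_energy2 m e p z) = 2 * (Re z + q) * Im z"
      by (simp add: complex_energy2_def q_def power2_eq_square algebra_simps)
    moreover have "Re z + q \<noteq> 0" using that by (auto simp: P_def)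
    ultimately have "Im z = 0" using I by simp
    then have "Re (complex_energy2 m e p z) = (energy m p)\<^sup>2 - q\<^sup>2 + (Re z + q)\<^sup>2"
      by (simp add: complex_energy2_def q_def power2_eq_square algebra_simps)
    then show False using Rl qE zero_le_power2[of "Re z + q"] by linarith
  qed
  have \<Omega>0: "\<Omega> z \<noteq> 0" if "z \<in> P" for z using cut[OF that] unfolding \<Omega>_def by auto
  have \<Omega>h: "\<Omega> holomorphic_on P" unfolding \<Omega>_def by (intro holomorphic_intros cut)
  have Fh: "(\<lambda>z. complex_fourier e \<psi> p z $ i) holomorphic_on P" "(\<lambda>z. complex_fourier e (dirac_evolution \<alpha> \<beta> m t \<psi>) p z $ i) holomorphic_on P" for i
    by (rule holomorphic_on_subset[OF complex_fourier_holomorphic[OF e \<psi>] subset_UNIV],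
        rule holomorphic_on_subset[OF complex_fourier_holomorphic[OF e \<psi>t] subset_UNIV])
  show ?thesis
    unfolding vec_eq_iff
  proof
    fix i
    let ?g = "\<lambda>z. cos (of_real t * \<Omega> z) * complex_fourier e \<psi> p z $ i +
         (sin (of_real t * \<Omega> z) / \<Omega> z) * (\<i> * complex_symbol \<alpha> \<beta> m e p z (complex_fourier e \<psi> p z) $ i)"
    have "complex_fourier e (dirac_evolution \<alpha> \<beta> m t \<psi>) p z $ i = ?g z"
    proof (rule holomorphic_eq_of_reals[OF Fh(2) _ oP cP zeroP])
      show "?g holomorphic_on P"
        by (intro holomorphic_intros \<Omega>h \<Omega>0 Fh complex_symbol_holomorphic)
      show "z \<in> P" using z by (simp add: P_def q_def)
      fix r
      have \<Omega>r: "\<Omega> (of_real r) = of_real (energy m (p + r *\<^sub>R e))"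
        unfolding \<Omega>_def complex_energy2_of_real using energy_pos[OF m, of "p + r *\<^sub>R e"] by (subst csqrt_of_real_nonneg) auto
      show "complex_fourier e (dirac_evolution \<alpha> \<beta> m t \<psi>) p (of_real r) $ i = ?g (of_real r)"
        unfolding complex_fourier_evolution_of_real[OF \<psi>] \<Omega>r
        by (simp add: cos_of_real sin_of_real flip: of_real_mult)
    qed
    then show "complex_fourier e (dirac_evolution \<alpha> \<beta> m t \<psi>) p z $ i =
       (cos (of_real t * \<Omega> z) *s complex_fourier e \<psi> p z +
       (sin (of_real t * \<Omega> z) / \<Omega> z) *s (\<i> *s complex_symbol \<alpha> \<beta> m e p z (complex_fourier e \<psi> p z))) $ i"
      by simp
  qed
qed

text \<open>At the momentum p + \<i>se the cosine and sine of t\<omega> are O(e^(|t||s|)), and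
  h/\<omega> stays bounded for large |s|. The decay rate of the transform thus drops by at most |t|,
  which is propagation with speed 1.\<close>

lemma vanishes_below_evolution:
  assumes \<psi>: "compact_wave R \<psi>" and a: "vanishes_below e a \<psi>"
  shows "vanishes_below e (a - \<bar>t\<bar>) (dirac_evolution \<alpha> \<beta> m t \<psi>)"
proof (rule vanishes_below_of_growth_eventually[OF e dirac_evolution_compact_wave(1)[OF dm m \<psi>]])
  fix p :: "real ^ 3" assume q: "p \<bullet> e \<noteq> 0"
  let ?E = "energy m p" and ?N = "LINT x|lborel. norm (\<psi> x)"
  have E: "?E > 0" by (rule energy_pos[OF m])
  \<comment> \<open>For |s| at least twice the energy at p, |\<omega>| \<ge> |s|/2 and energy + |s|
    \<le> (3/2)|s| \<le> 3|\<omega>|. So h/\<omega> has norm at most 3, and cosine and sine term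
    together give the factor 4.\<close>
  have "norm (complex_fourier e (dirac_evolution \<alpha> \<beta> m t \<psi>) p (\<i> * of_real s)) \<le> (4 * exp (\<bar>t\<bar> * ?E) * ?N) * exp ((a - \<bar>t\<bar>) * s)"
    if s: "s \<le> - (2 * ?E)" for s
  proof -
    let ?F = "complex_fourier e \<psi> p (\<i> * of_real s)"
    define \<Omega> where "\<Omega> = csqrt (complex_energy2 m e p (\<i> * of_real s))"
    note \<Omega>_bounds = csqrt_energy_bounds(1)[of s p, folded \<Omega>_def] csqrt_energy_bounds(2)[of p s, folded \<Omega>_def]
    have s0: "s < 0" "\<bar>s\<bar> = - s" using s E by auto
    have I: "\<bar>Im (of_real t * \<Omega>)\<bar> \<le> \<bar>t\<bar> * (?E + \<bar>s\<bar>)"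
    proof -
      have "\<bar>Im \<Omega>\<bar> \<le> ?E + \<bar>s\<bar>" using abs_Im_le_cmod[of \<Omega>] \<Omega>_bounds(2) by linarith
      then show ?thesis by (simp add: abs_mult mult_left_mono)
    qed
    define K where "K = exp (\<bar>t\<bar> * (?E + \<bar>s\<bar>))"
    have cs: "norm (cos (of_real t * \<Omega>)) \<le> K" "norm (sin (of_real t * \<Omega>)) \<le> K"
      unfolding K_def using I by (auto intro!: order_trans[OF norm_cos_sin_le(1)] order_trans[OF norm_cos_sin_le(2)])
    have \<Omega>_ge: "norm \<Omega> \<ge> \<bar>s\<bar> / 2"
      using \<Omega>_bounds(1) abs_Im_le_cmod[of \<Omega>] s s0 by linarith
    then have \<Omega>p: "norm \<Omega> > 0" using s0 by linarith
    have H: "norm (complex_symbol \<alpha> \<beta> m e p (\<i> * of_real s) ?F) \<le> (3 * norm \<Omega>) * norm ?F"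
      using norm_complex_symbol_le[of p "\<i> * of_real s" ?F] \<Omega>_ge s s0
      by (auto simp: norm_mult elim!: order_trans intro!: mult_right_mono)
    have "complex_fourier e (dirac_evolution \<alpha> \<beta> m t \<psi>) p (\<i> * of_real s) =
      cos (of_real t * \<Omega>) *s ?F + (sin (of_real t * \<Omega>) / \<Omega>) *s (\<i> *s complex_symbol \<alpha> \<beta> m e p (\<i> * of_real s) ?F)"
      unfolding \<Omega>_def by (rule complex_fourier_evolution[OF \<psi> q]) (use q in \<open>auto simp: zero_less_mult_iff neq_iff\<close>)
    also have "norm \<dots> \<le> norm (cos (of_real t * \<Omega>)) * norm ?F + (norm (sin (of_real t * \<Omega>)) / norm \<Omega>) * norm (complex_symbol \<alpha> \<beta> m e p (\<i> * of_real s) ?F)"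
      by (rule order_trans[OF norm_triangle_ineq]) (simp add: norm_divide norm_mult)
    also have "\<dots> \<le> K * norm ?F + (K / norm \<Omega>) * ((3 * norm \<Omega>) * norm ?F)"
      using cs H \<Omega>p by (intro add_mono mult_mono divide_right_mono) (auto simp: K_def)
    also have "\<dots> = 4 * K * norm ?F" using \<Omega>p by simp
    also have "\<dots> \<le> 4 * K * (exp (a * s) * ?N)"
      using complex_fourier_bound_below[OF e \<psi> a, of "\<i> * of_real s" p] s0 by (intro mult_left_mono) (auto simp: K_def)
    also have "\<dots> = (4 * exp (\<bar>t\<bar> * ?E) * ?N) * exp ((a - \<bar>t\<bar>) * s)"
      unfolding K_def s0(2) by (simp add: algebra_simps exp_add exp_diff exp_minus field_simps)
    finally show ?thesis .
  qed
  then show "\<exists>C S. \<forall>s\<le>- S. norm (complex_fourier e (dirac_evolution \<alpha> \<beta> m t \<psi>) p (\<i> * of_real s)) \<le> C * exp ((a - \<bar>t\<bar>) * s)"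
    by blast
qed

text \<open>Conversely, $\psi_\tau+\psi_{-\tau}=2\cos(\tau H)\psi$, and the symbol of $\cos(\tau H)$ is a scalar
  that grows like $e^{\tau|s|}$ at the momentum $p+\mathrm{i}se$.\<close>

lemma vanishes_below_of_evolutions:
  assumes \<psi>: "compact_wave R \<psi>" and \<tau>: "\<tau> > 0"
    and b: "vanishes_below e b (dirac_evolution \<alpha> \<beta> m \<tau> \<psi>)" "vanishes_below e b (dirac_evolution \<alpha> \<beta> m (- \<tau>) \<psi>)"
  shows "vanishes_below e (b + \<tau>) \<psi>"
proof (rule vanishes_below_of_growth_eventually[OF e \<psi>])
  fix p :: "real ^ 3" assume q: "p \<bullet> e \<noteq> 0"
  let ?E = "energy m p"
  note \<psi>t = dirac_evolution_compact_wave(1)[OF dm m \<psi>]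
  let ?N = "(LINT x|lborel. norm (dirac_evolution \<alpha> \<beta> m \<tau> \<psi> x)) + (LINT x|lborel. norm (dirac_evolution \<alpha> \<beta> m (- \<tau>) \<psi> x))"
  have E: "?E > 0" by (rule energy_pos[OF m])
  \<comment> \<open>The distance 1/\<tau> beyond the energy gives \<open>X \<ge> 1\<close> below,
    hence e^X \<ge> 2, so that the lower bound (e^X - 1)/2 for the cosine is at least e^X/4.\<close>
  have "norm (complex_fourier e \<psi> p (\<i> * of_real s)) \<le> (2 * ?N * exp (\<tau> * ?E)) * exp ((b + \<tau>) * s)"
    if s: "s \<le> - (?E + 1 / \<tau>)" for s
  proof -
    let ?F = "complex_fourier e \<psi> p (\<i> * of_real s)"
    define \<Omega> where "\<Omega> = csqrt (complex_energy2 m e p (\<i> * of_real s))"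
    note \<Omega>_bounds = csqrt_energy_bounds(1)[of s p, folded \<Omega>_def] csqrt_energy_bounds(2)[of p s, folded \<Omega>_def]
    have "1 / \<tau> > 0" using \<tau> by simp
    then have "s < 0" using s E by linarith
    then have s0: "s < 0" "\<bar>s\<bar> = - s" by auto
    define X where "X = \<tau> * (\<bar>s\<bar> - ?E)"
    have "\<tau> * (1 / \<tau>) \<le> X" unfolding X_def using s s0 \<tau> by (intro mult_left_mono) auto
    then have X1: "1 \<le> X" using \<tau> by simp
    then have X2: "exp X \<ge> 2" using exp_ge_add_one_self[of X] by linarith
    have "X \<le> \<tau> * \<bar>Im \<Omega>\<bar>" unfolding X_def using \<Omega>_bounds(1) \<tau> by (intro mult_left_mono) auto
    also have "\<dots> = \<bar>Im (of_real \<tau> * \<Omega>)\<bar>" using \<tau> by (simp add: abs_mult)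
    finally have "exp X \<le> exp \<bar>Im (of_real \<tau> * \<Omega>)\<bar>" by simp
    then have "(exp X - 1) / 2 \<le> (exp \<bar>Im (of_real \<tau> * \<Omega>)\<bar> - 1) / 2" by simp
    also have "\<dots> \<le> norm (cos (of_real \<tau> * \<Omega>))" by (rule norm_cos_ge)
    finally have c: "norm (cos (of_real \<tau> * \<Omega>)) \<ge> exp X / 4" using X2 by simp
    have "complex_fourier e (dirac_evolution \<alpha> \<beta> m t \<psi>) p (\<i> * of_real s) =
      cos (of_real t * \<Omega>) *s ?F + (sin (of_real t * \<Omega>) / \<Omega>) *s (\<i> *s complex_symbol \<alpha> \<beta> m e p (\<i> * of_real s) ?F)" for t
      unfolding \<Omega>_def by (rule complex_fourier_evolution[OF \<psi> q]) (use q in \<open>auto simp: zero_less_mult_iff neq_iff\<close>)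
    from this[of \<tau>] this[of "- \<tau>"]
    have "complex_fourier e (dirac_evolution \<alpha> \<beta> m \<tau> \<psi>) p (\<i> * of_real s) + complex_fourier e (dirac_evolution \<alpha> \<beta> m (- \<tau>) \<psi>) p (\<i> * of_real s)
       = (2 * cos (of_real \<tau> * \<Omega>)) *s ?F"
      by (simp add: vec_eq_iff algebra_simps)
    then have "2 * norm (cos (of_real \<tau> * \<Omega>)) * norm ?F = norm (complex_fourier e (dirac_evolution \<alpha> \<beta> m \<tau> \<psi>) p (\<i> * of_real s) + complex_fourier e (dirac_evolution \<alpha> \<beta> m (- \<tau>) \<psi>) p (\<i> * of_real s))"
      by (simp add: norm_mult)
    also have "\<dots> \<le> exp (b * s) * ?N"
      unfolding distrib_left
      using complex_fourier_bound_below[OF e \<psi>t b(1), of "\<i> * of_real s" p] complex_fourier_bound_below[OF e \<psi>t b(2), of "\<i> * of_real s" p] s0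
      by (intro norm_triangle_le add_mono) auto
    finally have u: "2 * norm (cos (of_real \<tau> * \<Omega>)) * norm ?F \<le> exp (b * s) * ?N" .
    have "(exp X / 2) * norm ?F \<le> 2 * norm (cos (of_real \<tau> * \<Omega>)) * norm ?F"
      using c by (intro mult_right_mono) auto
    with u have "(exp X / 2) * norm ?F \<le> exp (b * s) * ?N" by linarith
    then have "norm ?F \<le> 2 * (exp (b * s) * ?N) * exp (- X)" by (simp add: exp_minus field_simps)
    also have "\<dots> = (2 * ?N * exp (\<tau> * ?E)) * exp ((b + \<tau>) * s)"
    proof -
      have e1: "exp (b * s) * exp (- X) = exp (\<tau> * ?E) * exp ((b + \<tau>) * s)"
        unfolding X_def s0(2) by (simp add: algebra_simps flip: exp_add)
      have r: "2 * (u * N) * x = 2 * N * (u * x)" for u N x :: real by simp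
      show ?thesis unfolding r e1 by (simp only: mult.assoc)
    qed
    finally show ?thesis .
  qed
  then show "\<exists>C S. \<forall>s\<le>- S. norm (complex_fourier e \<psi> p (\<i> * of_real s)) \<le> C * exp ((b + \<tau>) * s)"
    by blast
qed

end

section \<open>A conserved entire quadratic form\<close>

text \<open>The quadratic form $\omega^2 F\otimes F-hF\otimes hF=2\omega^2(F_+\otimes F_-+F_-\otimes F_+)$, where
  $F_\pm$ are the components of $F=\hat\psi$ of positive and negative energy. In contrast to
  $F_\pm$ it is entire, and it is a constant of the motion.\<close>

definition energy_form :: "(3 \<Rightarrow> complex ^ 4 ^ 4) \<Rightarrow> complex ^ 4 ^ 4 \<Rightarrow> real \<Rightarrow> real ^ 3 \<Rightarrow> (real ^ 3 \<Rightarrow> complex ^ 4) \<Rightarrow> real ^ 3 \<Rightarrow> 4 \<Rightarrow> 4 \<Rightarrow> complex \<Rightarrow> complex" where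
  "energy_form \<alpha> \<beta> m e \<psi> p i j z =
     complex_energy2 m e p z * (complex_fourier e \<psi> p z $ i * complex_fourier e \<psi> p z $ j) -
     complex_symbol \<alpha> \<beta> m e p z (complex_fourier e \<psi> p z) $ i * complex_symbol \<alpha> \<beta> m e p z (complex_fourier e \<psi> p z) $ j"

context
  fixes \<alpha> :: "3 \<Rightarrow> complex ^ 4 ^ 4" and \<beta> :: "complex ^ 4 ^ 4" and m :: real and e :: "real ^ 3"
  assumes dm: "dirac_matrices \<alpha> \<beta>" and m: "m > 0" and e: "norm e = 1"
begin

lemma energy_form_holomorphic:
  assumes "compact_wave R \<psi>"
  shows "energy_form \<alpha> \<beta> m e \<psi> p i j holomorphic_on UNIV"
  unfolding energy_form_def[abs_def]
  by (intro holomorphic_intros complex_fourier_holomorphic[OF e assms] complex_symbol_holomorphic)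

text \<open>At real z the evolution sends (F, hF) to (cF + s hF, c hF + s\<omega>^2 F) with c^2 -
  s^2\<omega>^2 = cos^2 + sin^2 = 1. This is a complex hyperbolic rotation, and such rotations
  preserve the form. The identity theorem extends the equality to all z.\<close>

lemma energy_form_evolution:
  assumes \<psi>: "compact_wave R \<psi>"
  shows "energy_form \<alpha> \<beta> m e (dirac_evolution \<alpha> \<beta> m t \<psi>) p i j z = energy_form \<alpha> \<beta> m e \<psi> p i j z"
proof (rule holomorphic_eq_of_reals[where S=UNIV and f="energy_form \<alpha> \<beta> m e (dirac_evolution \<alpha> \<beta> m t \<psi>) p i j"
      and g="energy_form \<alpha> \<beta> m e \<psi> p i j"])
  fix r
  define \<omega> where "\<omega> = energy m (p + r *\<^sub>R e)"
  define c s where "c = complex_of_real (cos (t * \<omega>))" and "s = complex_of_real (sin (t * \<omega>) / \<omega>) * \<i>"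
  define F where "F = complex_fourier e \<psi> p (of_real r)"
  define H where "H = complex_symbol \<alpha> \<beta> m e p (of_real r) F"
  define W where "W = complex_of_real (\<omega>\<^sup>2)"
  have W: "complex_energy2 m e p (of_real r) = W" by (simp add: complex_energy2_of_real[OF dm m e] W_def \<omega>_def)
  have \<omega>: "\<omega> \<noteq> 0" using energy_pos[OF m, of "p + r *\<^sub>R e"] by (simp add: \<omega>_def)
  have Ft: "complex_fourier e (dirac_evolution \<alpha> \<beta> m t \<psi>) p (of_real r) = c *s F + s *s H"
    unfolding complex_fourier_evolution_of_real[OF dm m e \<psi>] c_def s_def F_def H_def \<omega>_def by (simp add: smult_smult)
  have Ht: "complex_symbol \<alpha> \<beta> m e p (of_real r) (c *s F + s *s H) = c *s H + (s * W) *s F"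
    unfolding complex_symbol_add complex_symbol_smult H_def complex_symbol_square[OF dm m e] W smult_smult ..
  have "(complex_of_real (cos (t * \<omega>)))\<^sup>2 + (complex_of_real (sin (t * \<omega>)))\<^sup>2 = of_real ((cos (t * \<omega>))\<^sup>2 + (sin (t * \<omega>))\<^sup>2)"
    by (simp only: of_real_add of_real_power)
  then have "(complex_of_real (cos (t * \<omega>)))\<^sup>2 + (complex_of_real (sin (t * \<omega>)))\<^sup>2 = 1" by simp
  then have cs: "c\<^sup>2 - s\<^sup>2 * W = 1"
    using \<omega> by (simp add: c_def s_def W_def power_mult_distrib power_divide)
  have "W * ((c * F $ i + s * H $ i) * (c * F $ j + s * H $ j)) - (c * H $ i + s * W * F $ i) * (c * H $ j + s * W * F $ j)
      = (c\<^sup>2 - s\<^sup>2 * W) * (W * (F $ i * F $ j) - H $ i * H $ j)"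
    by algebra
  then show "energy_form \<alpha> \<beta> m e (dirac_evolution \<alpha> \<beta> m t \<psi>) p i j (of_real r) = energy_form \<alpha> \<beta> m e \<psi> p i j (of_real r)"
    unfolding energy_form_def Ft Ht W F_def[symmetric] H_def[symmetric] cs by simp
qed (auto intro: energy_form_holomorphic[OF \<psi>] energy_form_holomorphic[OF dirac_evolution_compact_wave(1)[OF dm m \<psi>]])

lemma norm_energy_form_le:
  assumes "norm (complex_fourier e \<psi> p z) \<le> N"
  shows "norm (energy_form \<alpha> \<beta> m e \<psi> p i j z) \<le> 2 * ((energy m p + norm z) * N)\<^sup>2"
proof -
  let ?F = "complex_fourier e \<psi> p z" and ?E = "energy m p + norm z"
  have E: "?E \<ge> 0" using energy_pos[OF m, of p] by (simp add: less_imp_le add_nonneg_nonneg)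
  have N: "N \<ge> 0" using order_trans[OF norm_ge_zero assms] .
  have F: "norm (?F $ k) \<le> N" for k using Finite_Cartesian_Product.norm_nth_le[of ?F k] assms by linarith
  have H: "norm (complex_symbol \<alpha> \<beta> m e p z ?F $ k) \<le> ?E * N" for k
  proof -
    have "norm (complex_symbol \<alpha> \<beta> m e p z ?F $ k) \<le> norm (complex_symbol \<alpha> \<beta> m e p z ?F)"
      by (rule Finite_Cartesian_Product.norm_nth_le)
    also have "\<dots> \<le> ?E * norm ?F" by (rule norm_complex_symbol_le[OF dm m e])
    also have "\<dots> \<le> ?E * N" using assms E by (intro mult_left_mono)
    finally show ?thesis .
  qed
  have "norm (energy_form \<alpha> \<beta> m e \<psi> p i j z) \<le> ?E\<^sup>2 * (N * N) + (?E * N) * (?E * N)"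
    unfolding energy_form_def using E N
    by (intro norm_triangle_le_diff add_mono) (auto simp: norm_mult intro!: mult_mono F H norm_complex_energy2_le[OF dm m e])
  then show ?thesis by (simp add: power2_eq_square algebra_simps)
qed

text \<open>The zeros are -pe + \<i>\<kappa> and -pe - \<i>\<kappa> with \<kappa>^2 = |p|^2 - (pe)^2
  + m^2; the positive mass keeps them apart.\<close>

lemma complex_energy2_roots:
  obtains z1 z2 where "z1 \<noteq> z2" "\<And>z. complex_energy2 m e p z = (z - z1) * (z - z2)"
proof -
  define q where "q = p \<bullet> e"
  define \<kappa> where "\<kappa> = sqrt ((energy m p)\<^sup>2 - q\<^sup>2)"
  have "\<bar>q\<bar> \<le> norm p" using Cauchy_Schwarz_ineq2[of p e] e by (simp add: q_def)
  then have "q\<^sup>2 \<le> (norm p)\<^sup>2" by (metis abs_le_square_iff abs_norm_cancel)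
  then have k: "(energy m p)\<^sup>2 - q\<^sup>2 > 0"
    using zero_less_power[OF m, of 2] unfolding energy_power2 by linarith
  then have k2: "\<kappa>\<^sup>2 = (energy m p)\<^sup>2 - q\<^sup>2" and k0: "\<kappa> > 0" by (simp_all add: \<kappa>_def)
  show ?thesis
  proof (rule that[of "Complex (- q) \<kappa>" "Complex (- q) (- \<kappa>)"])
    show "Complex (- q) \<kappa> \<noteq> Complex (- q) (- \<kappa>)" using k0 by simp
    fix z
    have c: "Complex (- q) \<kappa> = - of_real q + \<i> * of_real \<kappa>" "Complex (- q) (- \<kappa>) = - of_real q - \<i> * of_real \<kappa>"
      by (simp_all add: complex_eq_iff)
    have "(z - Complex (- q) \<kappa>) * (z - Complex (- q) (- \<kappa>)) = (z + of_real q)\<^sup>2 + of_real (\<kappa>\<^sup>2)"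
      unfolding c by (simp add: power2_eq_square algebra_simps)
    also have "\<dots> = complex_energy2 m e p z"
      unfolding k2 complex_energy2_def q_def by (simp add: power2_eq_square algebra_simps)
    finally show "complex_energy2 m e p z = (z - Complex (- q) \<kappa>) * (z - Complex (- q) (- \<kappa>))" ..
  qed
qed

text \<open>If the form vanished, then $hF/F$ would be an entire square root of $\omega^2$, which has simple zeros.\<close>

lemma energy_form_nonzero:
  assumes \<psi>: "compact_wave R \<psi>" and nz: "\<not> (AE x in lborel. \<psi> x = 0)"
  shows "\<exists>p i z. energy_form \<alpha> \<beta> m e \<psi> p i i z \<noteq> 0"
proof (rule ccontr)
  assume "\<not> ?thesis"
  then have z: "energy_form \<alpha> \<beta> m e \<psi> p i i z = 0" for p i z by blast
  have "complex_fourier e \<psi> p z $ i = 0" for p z i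
  proof -
    obtain z1 z2 where r: "z1 \<noteq> z2" "\<And>z. complex_energy2 m e p z = (z - z1) * (z - z2)"
      by (rule complex_energy2_roots[where p=p], rule that)
    show ?thesis
    proof (rule entire_square_branch_zero[OF complex_fourier_holomorphic[OF e \<psi>] complex_symbol_holomorphic[OF complex_fourier_holomorphic[OF e \<psi>]] r(1)])
      show "(z - z1) * (z - z2) * (complex_fourier e \<psi> p z $ i)\<^sup>2 = (complex_symbol \<alpha> \<beta> m e p z (complex_fourier e \<psi> p z) $ i)\<^sup>2" for z
        using z[of p i z] by (simp add: energy_form_def r(2) power2_eq_square)
    qed
  qed
  then have "complex_fourier e \<psi> p (of_real 0) = 0" for p by (simp add: vec_eq_iff)
  then have "fourier_integral \<psi> p = 0" for p unfolding complex_fourier_of_real by simp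
  then have "AE p in lborel. fourier_integral \<psi> p = 0" by simp
  from compact_wave_fourier_zero[OF \<psi> this] nz show False by blast
qed

text \<open>By conservation the form may be computed from the wavefunction at time t on the negative
  imaginary axis and from that at time t' on the positive one. Being quadratic, it is there of size
  e^(2ay) and e^(-2by), up to polynomials; the twist by e^(\<i>(a-b)z) turns both into
  e^(-(a+b)|y|). On the real axis \<psi> itself gives a polynomial bound.\<close>

lemma energy_form_twisted_bounds:
  assumes \<psi>: "compact_wave R \<psi>"
    and a: "vanishes_below e a (dirac_evolution \<alpha> \<beta> m t \<psi>)"
    and b: "vanishes_below (- e) b (dirac_evolution \<alpha> \<beta> m t' \<psi>)"
  obtains K B M N where
    "\<And>z. norm (energy_form \<alpha> \<beta> m e \<psi> p i j z * exp (\<i> * of_real (a - b) * z)) \<le> K * exp (B * norm z)"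
    "\<And>x. norm (energy_form \<alpha> \<beta> m e \<psi> p i j (of_real x) * exp (\<i> * of_real (a - b) * of_real x)) \<le> M * (1 + \<bar>x\<bar>) ^ 2"
    "\<And>y. norm (energy_form \<alpha> \<beta> m e \<psi> p i j (\<i> * of_real y) * exp (\<i> * of_real (a - b) * (\<i> * of_real y)))
        \<le> N * (1 + \<bar>y\<bar>) ^ 2 * exp (- (a + b) * \<bar>y\<bar>)" "M \<ge> 0" "N \<ge> 0"
proof -
  note \<psi>t = dirac_evolution_compact_wave(1)[OF dm m \<psi>]
  let ?G = "energy_form \<alpha> \<beta> m e \<psi> p i j"
  let ?N0 = "LINT x|lborel. norm (\<psi> x)" and ?N1 = "LINT x|lborel. norm (dirac_evolution \<alpha> \<beta> m t \<psi> x)"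
    and ?N2 = "LINT x|lborel. norm (dirac_evolution \<alpha> \<beta> m t' \<psi> x)"
  define E where "E = energy m p"
  have E: "E > 0" unfolding E_def by (rule energy_pos[OF m])
  have E1: "E + r \<le> (E + 1) * (1 + r)" "E + r \<ge> 0" if "r \<ge> 0" for r
    using E that by (simp_all add: algebra_simps)
  have Nn: "?N0 \<ge> 0" "?N1 \<ge> 0" "?N2 \<ge> 0" by simp_all
  have sq: "2 * ((E + r) * n)\<^sup>2 \<le> (2 * ((E + 1) * n)\<^sup>2) * (1 + r)\<^sup>2" if "r \<ge> 0" "n \<ge> 0" for r n
  proof -
    have "((E + r) * n)\<^sup>2 \<le> ((E + 1) * (1 + r) * n)\<^sup>2"
      using E1[OF that(1)] that by (intro power_mono mult_right_mono mult_nonneg_nonneg) auto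
    also have "\<dots> = ((E + 1) * n)\<^sup>2 * (1 + r)\<^sup>2" by (simp add: power_mult_distrib mult_ac)
    finally show ?thesis by simp
  qed
  show ?thesis
  proof (rule that[of "2 * ((E + 1) * ?N0)\<^sup>2" "2 + 2 * \<bar>R\<bar> + \<bar>a - b\<bar>" "2 * ((E + 1) * ?N0)\<^sup>2" "2 * ((E + 1) * max ?N1 ?N2)\<^sup>2"])
    fix z :: complex
    let ?r = "norm z"
    have F: "norm (complex_fourier e \<psi> p z) \<le> exp (\<bar>R\<bar> * ?r) * ?N0"
    proof (rule order_trans[OF complex_fourier_bound_exp[OF e \<psi>]])
      show "exp (\<bar>R\<bar> * \<bar>Im z\<bar>) * ?N0 \<le> exp (\<bar>R\<bar> * ?r) * ?N0"
        using abs_Im_le_cmod[of z] Nn by (intro mult_right_mono) (auto intro: mult_left_mono)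
    qed
    have "norm (?G z) \<le> 2 * ((E + ?r) * (exp (\<bar>R\<bar> * ?r) * ?N0))\<^sup>2"
      unfolding E_def by (rule norm_energy_form_le[OF F])
    also have "\<dots> \<le> 2 * (((E + 1) * exp ?r) * (exp (\<bar>R\<bar> * ?r) * ?N0))\<^sup>2"
    proof -
      have "E + ?r \<le> (E + 1) * (1 + ?r)" by (rule E1) simp
      also have "\<dots> \<le> (E + 1) * exp ?r" using E by (intro mult_left_mono exp_ge_add_one_self) auto
      finally show ?thesis using E Nn by (intro mult_left_mono power_mono mult_right_mono mult_nonneg_nonneg) auto
    qed
    finally have G: "norm (?G z) \<le> 2 * (((E + 1) * exp ?r) * (exp (\<bar>R\<bar> * ?r) * ?N0))\<^sup>2" .
    have X: "norm (exp (\<i> * of_real (a - b) * z)) \<le> exp (\<bar>a - b\<bar> * ?r)"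
    proof -
      have "- ((a - b) * Im z) \<le> \<bar>a - b\<bar> * \<bar>Im z\<bar>" by (metis abs_ge_minus_self abs_mult)
      also have "\<dots> \<le> \<bar>a - b\<bar> * ?r" using abs_Im_le_cmod[of z] by (intro mult_left_mono) auto
      finally show ?thesis by (simp add: norm_exp_eq_Re algebra_simps)
    qed
    have "norm (?G z * exp (\<i> * of_real (a - b) * z)) \<le> 2 * (((E + 1) * exp ?r) * (exp (\<bar>R\<bar> * ?r) * ?N0))\<^sup>2 * exp (\<bar>a - b\<bar> * ?r)"
      unfolding norm_mult by (intro mult_mono G X) auto
    also have "\<dots> = 2 * ((E + 1) * ?N0)\<^sup>2 * (exp ?r ^ 2 * exp (\<bar>R\<bar> * ?r) ^ 2 * exp (\<bar>a - b\<bar> * ?r))"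
      by (simp add: power_mult_distrib mult_ac)
    also have "exp ?r ^ 2 * exp (\<bar>R\<bar> * ?r) ^ 2 * exp (\<bar>a - b\<bar> * ?r) = exp ((2 + 2 * \<bar>R\<bar> + \<bar>a - b\<bar>) * ?r)"
      by (simp add: power2_eq_square distrib_right flip: exp_add)
    finally show "norm (?G z * exp (\<i> * of_real (a - b) * z)) \<le> 2 * ((E + 1) * ?N0)\<^sup>2 * exp ((2 + 2 * \<bar>R\<bar> + \<bar>a - b\<bar>) * ?r)" .
  next
    fix x :: real
    have F: "norm (complex_fourier e \<psi> p (of_real x)) \<le> ?N0"
      using complex_fourier_bound_exp[OF e \<psi>, of p "of_real x"] by simp
    have "norm (exp (\<i> * of_real (a - b) * of_real x)) = 1" by (simp add: norm_exp_eq_Re)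
    then have "norm (?G (of_real x) * exp (\<i> * of_real (a - b) * of_real x)) = norm (?G (of_real x))"
      by (simp only: norm_mult mult_1_right)
    also have "\<dots> \<le> 2 * ((E + \<bar>x\<bar>) * ?N0)\<^sup>2"
      using norm_energy_form_le[OF F, of i j] by (simp add: E_def)
    also have "\<dots> \<le> (2 * ((E + 1) * ?N0)\<^sup>2) * (1 + \<bar>x\<bar>)\<^sup>2" by (rule sq) (use Nn in auto)
    finally show "norm (?G (of_real x) * exp (\<i> * of_real (a - b) * of_real x)) \<le> (2 * ((E + 1) * ?N0)\<^sup>2) * (1 + \<bar>x\<bar>)\<^sup>2" .
  next
    fix y :: real
    let ?z = "\<i> * complex_of_real y" and ?N = "max ?N1 ?N2"
    have X: "norm (exp (\<i> * of_real (a - b) * ?z)) = exp (- (a - b) * y)" by (simp add: norm_exp_eq_Re algebra_simps)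
    have N0: "?N \<ge> 0" using Nn by (simp add: le_max_iff_disj)
    \<comment> \<open>\<open>u\<close> is the exponent in the bound of the transform,
      \<open>a * y\<close> below and \<open>- b * y\<close> above the real axis; in both cases the
      twist produces the same rate.\<close>
    have fin: "2 * ((E + \<bar>y\<bar>) * (exp u * ?N))\<^sup>2 * exp (- (a - b) * y) \<le> 2 * ((E + 1) * ?N)\<^sup>2 * (1 + \<bar>y\<bar>) ^ 2 * exp (- (a + b) * \<bar>y\<bar>)"
      if "2 * u - (a - b) * y = - (a + b) * \<bar>y\<bar>" for u
    proof -
      have "2 * ((E + \<bar>y\<bar>) * (exp u * ?N))\<^sup>2 * exp (- (a - b) * y) = 2 * ((E + \<bar>y\<bar>) * ?N)\<^sup>2 * (exp u ^ 2 * exp (- (a - b) * y))"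
        by (simp add: power_mult_distrib mult_ac)
      also have "exp u ^ 2 * exp (- (a - b) * y) = exp (2 * u - (a - b) * y)"
        by (simp add: power2_eq_square algebra_simps flip: exp_add)
      also have "2 * ((E + \<bar>y\<bar>) * ?N)\<^sup>2 * exp (2 * u - (a - b) * y) \<le> (2 * ((E + 1) * ?N)\<^sup>2 * (1 + \<bar>y\<bar>)\<^sup>2) * exp (2 * u - (a - b) * y)"
        by (intro mult_right_mono sq) (use N0 in auto)
      finally show ?thesis unfolding that .
    qed
    show "norm (?G ?z * exp (\<i> * of_real (a - b) * ?z)) \<le> 2 * ((E + 1) * ?N)\<^sup>2 * (1 + \<bar>y\<bar>) ^ 2 * exp (- (a + b) * \<bar>y\<bar>)"
    proof (cases "y \<le> 0")
      case True
      have "norm (complex_fourier e (dirac_evolution \<alpha> \<beta> m t \<psi>) p ?z) \<le> exp (a * y) * ?N1"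
        using complex_fourier_bound_below[OF e \<psi>t a, of ?z p] True by simp
      also have "\<dots> \<le> exp (a * y) * ?N" by (intro mult_left_mono) auto
      finally have F: "norm (complex_fourier e (dirac_evolution \<alpha> \<beta> m t \<psi>) p ?z) \<le> exp (a * y) * ?N" .
      have "norm (?G ?z) \<le> 2 * ((E + \<bar>y\<bar>) * (exp (a * y) * ?N))\<^sup>2"
        using norm_energy_form_le[OF F, of i j] by (simp add: E_def energy_form_evolution[OF \<psi>] norm_mult)
      then have "norm (?G ?z * exp (\<i> * of_real (a - b) * ?z)) \<le> 2 * ((E + \<bar>y\<bar>) * (exp (a * y) * ?N))\<^sup>2 * exp (- (a - b) * y)"
        unfolding norm_mult X by (intro mult_right_mono) auto
      also have "\<dots> \<le> 2 * ((E + 1) * ?N)\<^sup>2 * (1 + \<bar>y\<bar>) ^ 2 * exp (- (a + b) * \<bar>y\<bar>)"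
        by (rule fin) (use True in \<open>simp add: algebra_simps\<close>)
      finally show ?thesis .
    next
      case False
      have ne: "norm (- e) = 1" using e by simp
      have "norm (complex_fourier (- e) (dirac_evolution \<alpha> \<beta> m t' \<psi>) p (- ?z)) \<le> exp (- b * y) * ?N2"
        using complex_fourier_bound_below[OF ne \<psi>t b, of "- ?z" p] False by simp
      also have "\<dots> \<le> exp (- b * y) * ?N" by (intro mult_left_mono) auto
      finally have F: "norm (complex_fourier e (dirac_evolution \<alpha> \<beta> m t' \<psi>) p ?z) \<le> exp (- b * y) * ?N"
        unfolding complex_fourier_minus .
      have "norm (?G ?z) \<le> 2 * ((E + \<bar>y\<bar>) * (exp (- b * y) * ?N))\<^sup>2"
        using norm_energy_form_le[OF F, of i j] by (simp add: E_def energy_form_evolution[OF \<psi>] norm_mult)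
      then have "norm (?G ?z * exp (\<i> * of_real (a - b) * ?z)) \<le> 2 * ((E + \<bar>y\<bar>) * (exp (- b * y) * ?N))\<^sup>2 * exp (- (a - b) * y)"
        unfolding norm_mult X by (intro mult_right_mono) auto
      also have "\<dots> \<le> 2 * ((E + 1) * ?N)\<^sup>2 * (1 + \<bar>y\<bar>) ^ 2 * exp (- (a + b) * \<bar>y\<bar>)"
        by (rule fin) (use False in \<open>simp add: algebra_simps\<close>)
      finally show ?thesis .
    qed
  qed auto
qed

text \<open>If a + b were positive, the twisted form would decay along the imaginary axis. Being
  polynomially bounded on both axes it would be constant, hence zero for all p and all diagonal
  entries, which a nonzero \<psi> excludes.\<close>

theorem support_width_nonneg:
  assumes \<psi>: "compact_wave R \<psi>" and nz: "\<not> (AE x in lborel. \<psi> x = 0)"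
    and a: "vanishes_below e a (dirac_evolution \<alpha> \<beta> m t \<psi>)"
    and b: "vanishes_below (- e) b (dirac_evolution \<alpha> \<beta> m t' \<psi>)"
  shows "a + b \<le> 0"
proof (rule ccontr)
  assume "\<not> a + b \<le> 0"
  then have d: "a + b > 0" by simp
  have "energy_form \<alpha> \<beta> m e \<psi> p i i z = 0" for p i z
  proof -
    define f where "f z = energy_form \<alpha> \<beta> m e \<psi> p i i z * exp (\<i> * of_real (a - b) * z)" for z
    obtain K B M N where K: "\<And>z. norm (f z) \<le> K * exp (B * norm z)"
      and M: "\<And>x. norm (f (of_real x)) \<le> M * (1 + \<bar>x\<bar>) ^ 2"
      and N: "\<And>y. norm (f (\<i> * of_real y)) \<le> N * (1 + \<bar>y\<bar>) ^ 2 * exp (- (a + b) * \<bar>y\<bar>)"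
      and M0: "M \<ge> 0" and N0: "N \<ge> 0"
      unfolding f_def by (rule energy_form_twisted_bounds[OF \<psi> a b, of p i i]) blast
    have hol: "f holomorphic_on UNIV"
      unfolding f_def by (intro holomorphic_intros energy_form_holomorphic[OF \<psi>])
    have lim: "((\<lambda>y. N * (1 + y) ^ 2 * exp (- (a + b) * y)) \<longlongrightarrow> 0) at_top"
      using d by real_asymp
    have N': "norm (f (\<i> * of_real y)) \<le> N * (1 + y) ^ 2 * exp (- (a + b) * y)" if "y \<ge> 0" for y
      using N[of y] that by simp
    have "\<forall>\<^sub>F y in at_top. N * (1 + y) ^ 2 * exp (- (a + b) * y) < 1"
      using lim by (intro order_tendstoD(2)) auto
    then obtain y0 where y0: "\<And>y. y \<ge> y0 \<Longrightarrow> N * (1 + y) ^ 2 * exp (- (a + b) * y) < 1"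
      unfolding eventually_at_top_linorder by blast
    have const: "f z = f 0" for z
    proof (rule entire_exponential_type_constant[OF hol K, where k=2 and M="max M N" and c=\<i> and xmin="max 0 y0" and b=1])
      show "norm (f (of_real x)) \<le> max M N * (1 + \<bar>x\<bar>) ^ 2" for x
        by (rule order_trans[OF M]) (intro mult_right_mono, auto)
      show "norm (f (\<i> * of_real y)) \<le> max M N * (1 + \<bar>y\<bar>) ^ 2" for y
      proof (rule order_trans[OF N])
        have "- (a + b) * \<bar>y\<bar> \<le> 0" using d by (intro mult_nonpos_nonneg) auto
          then have "exp (- (a + b) * \<bar>y\<bar>) \<le> 1" by (simp only: exp_le_one_iff)
        then have "N * (1 + \<bar>y\<bar>) ^ 2 * exp (- (a + b) * \<bar>y\<bar>) \<le> N * (1 + \<bar>y\<bar>) ^ 2"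
          using N0 by (intro mult_left_le) auto
        also have "\<dots> \<le> max M N * (1 + \<bar>y\<bar>) ^ 2" by (intro mult_right_mono) auto
        finally show "N * (1 + \<bar>y\<bar>) ^ 2 * exp (- (a + b) * \<bar>y\<bar>) \<le> max M N * (1 + \<bar>y\<bar>) ^ 2" .
      qed
      show "norm (f (\<i> * of_real y)) \<le> 1" if "y \<ge> max 0 y0" for y
        using N'[of y] y0[of y] that by simp
    qed auto
    have "norm (f 0) \<le> 0"
    proof (rule tendsto_lowerbound[OF lim])
      show "\<forall>\<^sub>F y in at_top. norm (f 0) \<le> N * (1 + y) ^ 2 * exp (- (a + b) * y)"
        using eventually_ge_at_top[of 0]
      proof eventually_elim
        case (elim y)
        then show ?case using N'[of y] const[of "\<i> * of_real y"] by simp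
      qed
    qed simp
    then show ?thesis using const[of z] by (simp add: f_def)
  qed
  then show False using energy_form_nonzero[OF \<psi> nz] by blast
qed

text \<open>If a + b = 0, the imaginary axis yields a polynomial bound but no decay, and boundedness
  on a ray has to come from the real axis. There |hF| = \<omega>|F|, so one bound L for hF controls
  both terms of the form, by L^2 each.\<close>

theorem support_width_pos:
  assumes \<psi>: "compact_wave R \<psi>" and nz: "\<not> (AE x in lborel. \<psi> x = 0)"
    and a: "vanishes_below e a (dirac_evolution \<alpha> \<beta> m t \<psi>)"
    and b: "vanishes_below (- e) b (dirac_evolution \<alpha> \<beta> m t' \<psi>)"
    and bd: "bounded (range (\<lambda>p. dirac_symbol \<alpha> \<beta> m p *v fourier_integral \<psi> p))"
  shows "a + b < 0"
proof (rule ccontr)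
  assume "\<not> a + b < 0"
  then have d: "a + b \<ge> 0" by simp
  obtain L where L: "\<And>p. norm (dirac_symbol \<alpha> \<beta> m p *v fourier_integral \<psi> p) \<le> L"
    using bd unfolding bounded_iff by blast
  have L0: "L \<ge> 0" using order_trans[OF norm_ge_zero L] .
  define c where "c = a - b"
  have "energy_form \<alpha> \<beta> m e \<psi> p i j z = 0" for p i j z
  proof -
    define G where "G j z = energy_form \<alpha> \<beta> m e \<psi> p i j z" for j z
    have const: "G j z * exp (\<i> * of_real c * z) = G j 0" for j z
    proof -
      define f where "f z = G j z * exp (\<i> * of_real c * z)" for z
      obtain K B M N where K: "\<And>z. norm (f z) \<le> K * exp (B * norm z)"
        and M: "\<And>x. norm (f (of_real x)) \<le> M * (1 + \<bar>x\<bar>) ^ 2"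
        and N: "\<And>y. norm (f (\<i> * of_real y)) \<le> N * (1 + \<bar>y\<bar>) ^ 2 * exp (- (a + b) * \<bar>y\<bar>)"
        and M0: "M \<ge> 0" and N0: "N \<ge> 0"
        unfolding f_def G_def c_def by (rule energy_form_twisted_bounds[OF \<psi> a b, of p i j]) blast
      have hol: "f holomorphic_on UNIV"
        unfolding f_def G_def by (intro holomorphic_intros energy_form_holomorphic[OF \<psi>])
      have "f z = f 0"
      proof (rule entire_exponential_type_constant[OF hol K, where k=2 and M="max M N" and c=1 and xmin=0 and b="2 * L\<^sup>2"])
        show "norm (f (of_real x)) \<le> max M N * (1 + \<bar>x\<bar>) ^ 2" for x
          by (rule order_trans[OF M]) (intro mult_right_mono, auto)
        show "norm (f (\<i> * of_real y)) \<le> max M N * (1 + \<bar>y\<bar>) ^ 2" for y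
        proof (rule order_trans[OF N])
          have "- (a + b) * \<bar>y\<bar> \<le> 0" using d by (intro mult_nonpos_nonneg) auto
          then have "exp (- (a + b) * \<bar>y\<bar>) \<le> 1" by (simp only: exp_le_one_iff)
          then have "N * (1 + \<bar>y\<bar>) ^ 2 * exp (- (a + b) * \<bar>y\<bar>) \<le> N * (1 + \<bar>y\<bar>) ^ 2"
            using N0 by (intro mult_left_le) auto
          also have "\<dots> \<le> max M N * (1 + \<bar>y\<bar>) ^ 2" by (intro mult_right_mono) auto
          finally show "N * (1 + \<bar>y\<bar>) ^ 2 * exp (- (a + b) * \<bar>y\<bar>) \<le> max M N * (1 + \<bar>y\<bar>) ^ 2" .
        qed
        fix x :: real
        let ?F = "fourier_integral \<psi> (p + x *\<^sub>R e)"
        let ?H = "dirac_symbol \<alpha> \<beta> m (p + x *\<^sub>R e) *v ?F" and ?\<omega> = "energy m (p + x *\<^sub>R e)"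
        have nF: "?\<omega> * norm (?F $ k) \<le> L" for k
        proof -
          have "?\<omega> * norm (?F $ k) \<le> ?\<omega> * norm ?F"
            using energy_pos[OF m, of "p + x *\<^sub>R e"] by (intro mult_left_mono Finite_Cartesian_Product.norm_nth_le) auto
          also have "\<dots> = norm ?H" by (rule norm_dirac_symbol[OF dm, symmetric])
          finally show ?thesis using L[of "p + x *\<^sub>R e"] by linarith
        qed
        have nH: "norm (?H $ k) \<le> L" for k
          using Finite_Cartesian_Product.norm_nth_le[of ?H k] L[of "p + x *\<^sub>R e"] by linarith
        have "norm (f (of_real x)) = norm (G j (of_real x))"
          by (simp add: f_def norm_mult norm_exp_eq_Re)
        also have "\<dots> = norm (of_real (?\<omega>\<^sup>2) * (?F $ i * ?F $ j) - ?H $ i * ?H $ j)"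
          by (simp only: G_def energy_form_def complex_fourier_of_real complex_symbol_of_real complex_energy2_of_real[OF dm m e])
        also have "\<dots> \<le> (?\<omega> * norm (?F $ i)) * (?\<omega> * norm (?F $ j)) + norm (?H $ i) * norm (?H $ j)"
          by (rule order_trans[OF norm_triangle_ineq4]) (simp add: norm_mult norm_power power2_eq_square)
        also have "\<dots> \<le> L * L + L * L"
          using L0 energy_pos[OF m, of "p + x *\<^sub>R e"] by (intro add_mono mult_mono nF nH) auto
        finally show "norm (f (1 * of_real x)) \<le> 2 * L\<^sup>2" by (simp add: power2_eq_square)
      qed auto
      then show ?thesis by (simp add: f_def)
    qed
    \<comment> \<open>One row of the constant tensor: the first index i stays fixed.\<close>
    define C :: "complex ^ 4" where "C = (\<chi> j. G j 0)"
    have root: "complex_symbol \<alpha> \<beta> m e p z C = 0" if z: "complex_energy2 m e p z = 0" for z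
    proof -
      let ?H = "complex_symbol \<alpha> \<beta> m e p z (complex_fourier e \<psi> p z)"
      \<comment> \<open>At a zero of \<omega>^2 only the term -hF \<otimes> hF survives, so every
        row is a multiple of hF, and h sends hF to \<omega>^2 F = 0.\<close>
      have "C = (- (?H $ i) * exp (\<i> * of_real c * z)) *s ?H"
        by (simp add: vec_eq_iff C_def const[of _ z, symmetric]) (simp add: G_def energy_form_def z)
      then have "complex_symbol \<alpha> \<beta> m e p z C = (- (?H $ i) * exp (\<i> * of_real c * z)) *s complex_symbol \<alpha> \<beta> m e p z ?H"
        by (simp only: complex_symbol_smult)
      then show ?thesis by (simp add: complex_symbol_square[OF dm m e] z)
    qed
    obtain z1 z2 where r: "z1 \<noteq> z2" "\<And>z. complex_energy2 m e p z = (z - z1) * (z - z2)"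
      by (rule complex_energy2_roots[where p=p], rule that)
    let ?A = "\<lambda>v. dirac_symbol \<alpha> \<beta> 0 e *v v"
    \<comment> \<open>The two symbols differ by (z1 - z2) e\<alpha>, so being annihilated by both
      means being annihilated by e\<alpha>, which is invertible.\<close>
    have "complex_symbol \<alpha> \<beta> m e p z1 C - complex_symbol \<alpha> \<beta> m e p z2 C = (z1 - z2) *s ?A C"
      by (simp add: complex_symbol_def vec_eq_iff algebra_simps)
    then have "(z1 - z2) *s ?A C = 0" using root[of z1] root[of z2] r(2) by simp
    then have "?A C = 0" using r(1) by (simp add: vec_eq_iff)
    then have "?A (?A C) = 0" by simp
    then have "C = 0" using e by (simp add: dirac_symbol_square[OF dm])
    then have "G j 0 = 0" for j by (simp add: C_def vec_eq_iff)
    then have "G j z = 0" using const[of j z] by simp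
    then show ?thesis by (simp add: G_def)
  qed
  then show False using energy_form_nonzero[OF \<psi> nz] by blast
qed

end

section \<open>Edges\<close>

text \<open>The two hypotheses leave at each t only two possibilities: either the graph has slope 1
  at all earlier times (\<open>lft\<close>), or slope -1 at all later ones (\<open>rgt\<close>). The
  upper bound prevents one of them from holding everywhere, so both occur, and E is the minimum of a
  rising and a falling line.\<close>

lemma tent_function:
  fixes E :: "real \<Rightarrow> real"
  assumes lip: "\<And>t s. E t - \<bar>s\<bar> \<le> E (t + s)"
    and fork: "\<And>t s. s > 0 \<Longrightarrow> E (t + s) \<le> E t - s \<or> E (t - s) \<le> E t - s"
    and bdd: "\<And>t. E t \<le> K"
  obtains T where "\<And>t. E t = E 0 + \<bar>T\<bar> - \<bar>t - T\<bar>"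
proof -
  have lip': "E t \<le> E u + \<bar>t - u\<bar>" for t u using lip[of t "u - t"] by (simp add: abs_minus_commute)
  define lft where "lft t \<longleftrightarrow> (\<forall>u\<le>t. E u = E t - (t - u))" for t
  define rgt where "rgt t \<longleftrightarrow> (\<forall>u\<ge>t. E u = E t - (u - t))" for t
  have lr: "lft t \<or> rgt t" for t
  proof (rule ccontr)
    assume n: "\<not> (lft t \<or> rgt t)"
    then obtain u where u: "u \<ge> t" "E u \<noteq> E t - (u - t)" by (auto simp: rgt_def)
    then have u1: "E u > E t - (u - t)" using lip'[of t u] by auto
    obtain v where v: "v \<le> t" "E v \<noteq> E t - (t - v)" using n by (auto simp: lft_def)
    then have v1: "E v > E t - (t - v)" using lip'[of t v] by auto
    \<comment> \<open>If \<open>rgt\<close> fails at distance u - t and \<open>lft\<close> at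
      distance t - v, the Lipschitz bound carries both strict inequalities on to the larger of the
      two distances, where they contradict \<open>fork\<close>.\<close>
    define s where "s = max (u - t) (t - v)"
    have s0: "s > 0" using u1 u(1) by (cases "u = t") (auto simp: s_def)
    have "E (t + s) > E t - s" using lip'[of u "t + s"] u1 by (simp add: s_def max_def split: if_splits)
    moreover have "E (t - s) > E t - s" using lip'[of v "t - s"] v1 by (simp add: s_def max_def split: if_splits)
    ultimately show False using fork[OF s0, of t] by linarith
  qed
  have "\<exists>t. \<not> rgt t"
  proof (rule ccontr)
    assume "\<not> ?thesis"
    then have r: "rgt t" for t by blast
    have "E 0 = E t + t" if "t \<le> 0" for t
      using r[of t, unfolded rgt_def, rule_format, OF that] by linarith
    then have "E 0 = E (- (\<bar>K - E 0\<bar> + 1)) + - (\<bar>K - E 0\<bar> + 1)" by simp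
    then show False using bdd[of "- (\<bar>K - E 0\<bar> + 1)"] abs_ge_self[of "K - E 0"] by linarith
  qed
  then obtain t1 where t1: "lft t1" using lr by blast
  have "\<exists>t. \<not> lft t"
  proof (rule ccontr)
    assume "\<not> ?thesis"
    then have r: "lft t" for t by blast
    have "E 0 = E t - t" if "t \<ge> 0" for t
      using r[of t, unfolded lft_def, rule_format, OF that] by linarith
    then have "E 0 = E (\<bar>K - E 0\<bar> + 1) - (\<bar>K - E 0\<bar> + 1)" by simp
    then show False using bdd[of "\<bar>K - E 0\<bar> + 1"] abs_ge_self[of "K - E 0"] by linarith
  qed
  then obtain t2 where t2: "rgt t2" using lr by blast
  \<comment> \<open>The intercepts of the rising and the falling line; the lines meet at (b - a)/2,
    the peak of the tent.\<close>
  define a b where "a = E t1 - t1" and "b = E t2 + t2"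
  have E: "E t = min (a + t) (b - t)" for t
  proof -
    have u: "E (min t t1) = a + min t t1" using t1[unfolded lft_def, rule_format, of "min t t1"] unfolding a_def by linarith
    have v: "E (max t t2) = b - max t t2" using t2[unfolded rgt_def, rule_format, of "max t t2"] unfolding b_def by linarith
    have "E t \<le> a + t" using lip'[of t "min t t1"] u by auto
    moreover have "E t \<le> b - t" using lip'[of t "max t t2"] v by auto
    moreover have "E t = a + t \<or> E t = b - t"
    proof (cases "lft t")
      case True
      then have "E (min t t1) = E t - (t - min t t1)" unfolding lft_def by (rule allE[of _ "min t t1"]) simp
      then show ?thesis using u by simp
    next
      case False
      then have "rgt t" using lr by blast
      then have "E (max t t2) = E t - (max t t2 - t)" unfolding rgt_def by (rule allE[of _ "max t t2"]) simp
      then show ?thesis using v by simp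
    qed
    ultimately show ?thesis by linarith
  qed
  show ?thesis
  proof (rule that[of "(b - a) / 2"])
    fix t show "E t = E 0 + \<bar>(b - a) / 2\<bar> - \<bar>t - (b - a) / 2\<bar>"
      unfolding E by (simp add: min_def abs_if field_simps)
  qed
qed

lemma vanishes_below_mono: "vanishes_below e a \<psi> \<Longrightarrow> b \<le> a \<Longrightarrow> vanishes_below e b \<psi>"
  unfolding vanishes_below_def by (auto elim!: eventually_mono)

lemma vanishes_below_AE_cong:
  assumes "AE x in lborel. \<phi> x = \<psi> x"
  shows "vanishes_below e a \<phi> \<longleftrightarrow> vanishes_below e a \<psi>"
  unfolding vanishes_below_def using assms by (intro iffI) (auto elim: eventually_elim2)

text \<open>Bounded support puts -|R| among the admissible b, and a nonzero \<psi> bounds them by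
  |R|, so the supremum is finite. It is attained: x e < a already means x e < a - 1/(n+1) for some
  n, and the countably many exceptional null sets combine.\<close>

lemma edge_exists:
  assumes e: "norm e = 1" and \<psi>: "compact_wave R \<psi>" and nz: "\<not> (AE x in lborel. \<psi> x = 0)"
  obtains a where "\<And>b. vanishes_below e b \<psi> \<longleftrightarrow> b \<le> a" "edge e \<psi> = ereal a"
proof -
  define S where "S = {b. vanishes_below e b \<psi>}"
  define a where "a = Sup S"
  have low: "- \<bar>R\<bar> \<in> S"
    unfolding S_def vanishes_below_def mem_Collect_eq
    using AE_norm_inner_le[OF e \<psi>] by eventually_elim auto
  have up: "b \<le> \<bar>R\<bar>" if "b \<in> S" for b
  proof (rule ccontr)
    assume "\<not> b \<le> \<bar>R\<bar>"
    have "AE x in lborel. \<psi> x = 0"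
      using AE_norm_inner_le[OF e \<psi>] that[unfolded S_def vanishes_below_def mem_Collect_eq]
      by eventually_elim (use \<open>\<not> b \<le> \<bar>R\<bar>\<close> in force)
    with nz show False by blast
  qed
  have bdd: "bdd_above S" using up by (auto simp: bdd_above_def)
  have below: "vanishes_below e b \<psi>" if "b < a" for b
  proof -
    have "S \<noteq> {}" using low by blast
    from less_cSupD[OF this that[unfolded a_def]] obtain c where "c \<in> S" "b < c" by blast
    then show ?thesis using vanishes_below_mono[of e c \<psi> b] by (simp add: S_def)
  qed
  have aS: "vanishes_below e a \<psi>"
  proof -
    have "AE x in lborel. x \<bullet> e < a - 1 / real (Suc n) \<longrightarrow> \<psi> x = 0" for n
      using below[of "a - 1 / real (Suc n)"] by (simp add: vanishes_below_def)
    then have "AE x in lborel. \<forall>n. x \<bullet> e < a - 1 / real (Suc n) \<longrightarrow> \<psi> x = 0"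
      by (simp only: AE_all_countable) simp
    then show ?thesis
      unfolding vanishes_below_def
    proof eventually_elim
      case (elim x)
      show ?case
      proof
        assume "x \<bullet> e < a"
        then obtain n where "inverse (real (Suc n)) < a - x \<bullet> e" using reals_Archimedean[of "a - x \<bullet> e"] by auto
        then show "\<psi> x = 0" using elim by (auto simp: inverse_eq_divide algebra_simps)
      qed
    qed
  qed
  have iff: "vanishes_below e b \<psi> \<longleftrightarrow> b \<le> a" for b
  proof
    assume "vanishes_below e b \<psi>"
    then show "b \<le> a" unfolding a_def using bdd by (intro cSup_upper) (auto simp: S_def)
  next
    assume "b \<le> a" then show "vanishes_below e b \<psi>" using aS vanishes_below_mono by blast
  qed
  let ?Q = "\<lambda>A. AE x in lborel. indicat_real {x. ereal (x \<bullet> e) \<le> A} x *\<^sub>R \<psi> x = 0"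
  \<comment> \<open>\<open>edge\<close> uses the closed half-space and \<open>vanishes_below\<close>
    the open one; they differ by a null hyperplane.\<close>
  have Q: "?Q (ereal b) \<longleftrightarrow> vanishes_below e b \<psi>" for b
  proof
    assume "?Q (ereal b)"
    then show "vanishes_below e b \<psi>" unfolding vanishes_below_def by eventually_elim (auto simp: indicator_def)
  next
    assume "vanishes_below e b \<psi>"
    then show "?Q (ereal b)" using AE_inner_neq[OF e, of b] unfolding vanishes_below_def
      by eventually_elim (auto simp: indicator_def)
  qed
  have "edge e \<psi> = ereal a"
    unfolding edge_def
  proof (rule Greatest_equality)
    show "?Q (ereal a)" using Q aS by blast
    fix A assume A: "?Q A"
    show "A \<le> ereal a"
    proof (cases A)
      case (real b)
      then show ?thesis using A Q iff by auto
    next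
      case PInf
      then have "AE x in lborel. \<psi> x = 0" using A by simp
      then show ?thesis using nz by blast
    qed simp
  qed
  with iff show ?thesis by (rule that)
qed

text \<open>If a + b \<ge> 0, the half-spaces xe < a and -xe < b cover everything outside the null
  hyperplane xe = a, so \<psi> would vanish. This is the source of the strict inequality when both
  peaks occur at one time.\<close>

lemma support_width_pos_same_time:
  assumes e: "norm e = 1" and nz: "\<not> (AE x in lborel. \<psi> x = 0)"
    and "vanishes_below e a \<psi>" "vanishes_below (- e) b \<psi>"
  shows "a + b < 0"
proof (rule ccontr)
  assume n: "\<not> a + b < 0"
  have "AE x in lborel. \<psi> x = 0"
    using assms(3,4) AE_inner_neq[OF e, of a] unfolding vanishes_below_def
  proof eventually_elim
    case (elim x)
    show ?case
    proof (cases "x \<bullet> e < a")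
      case False
      then have "x \<bullet> (- e) < b" using elim(3) n by simp
      then show ?thesis using elim(2) by blast
    qed (use elim in blast)
  qed
  with nz show False by blast
qed

lemma compact_wave_fourier_unique:
  assumes "compact_wave R \<phi>" "compact_wave S \<psi>" "\<And>p. fourier_integral \<phi> p = fourier_integral \<psi> p"
  shows "AE x in lborel. \<phi> x = \<psi> x"
proof -
  note c = compact_wave_mono[OF assms(1) max.cobounded1[of R S]] compact_wave_mono[OF assms(2) max.cobounded2[of S R]]
  have "AE x in lborel. \<phi> x - \<psi> x = 0"
    by (rule compact_wave_fourier_zero[OF compact_wave_diff[OF c]])
       (simp add: fourier_integral_diff[OF compact_waveD(4)[OF assms(1)] compact_waveD(4)[OF assms(2)]] assms(3))
  then show ?thesis by simp
qed

text \<open>The group laws of the evolution hold only almost everywhere, as its values are chosen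
  representatives; this lemma transports edges along them.\<close>

lemma edge_AE_cong:
  assumes "AE x in lborel. \<phi> x = \<psi> x"
  shows "edge e \<phi> = edge e \<psi>"
proof -
  have "(AE x in lborel. indicat_real A x *\<^sub>R \<phi> x = 0) \<longleftrightarrow> (AE x in lborel. indicat_real A x *\<^sub>R \<psi> x = 0)" for A
    using assms by (intro iffI) (auto elim: eventually_elim2)
  then show ?thesis unfolding edge_def by simp
qed

section \<open>The tent law for the edge\<close>

context
  fixes \<alpha> :: "3 \<Rightarrow> complex ^ 4 ^ 4" and \<beta> :: "complex ^ 4 ^ 4" and m :: real
  assumes dm: "dirac_matrices \<alpha> \<beta>" and m: "m > 0"
begin

lemma dirac_evolution_0:
  assumes "compact_wave R \<psi>"
  shows "AE x in lborel. dirac_evolution \<alpha> \<beta> m 0 \<psi> x = \<psi> x"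
  by (rule compact_wave_fourier_unique[OF dirac_evolution_compact_wave(1)[OF dm m assms] assms])
     (simp add: dirac_evolution_compact_wave(2)[OF dm m assms] free_group_def)

lemma dirac_evolution_add:
  assumes "compact_wave R \<psi>"
  shows "AE x in lborel. dirac_evolution \<alpha> \<beta> m s (dirac_evolution \<alpha> \<beta> m t \<psi>) x = dirac_evolution \<alpha> \<beta> m (s + t) \<psi> x"
proof -
  note t = dirac_evolution_compact_wave[OF dm m assms]
  show ?thesis
    by (rule compact_wave_fourier_unique[OF dirac_evolution_compact_wave(1)[OF dm m t(1)] t(1)])
       (simp add: dirac_evolution_compact_wave(2)[OF dm m t(1)] t(2) free_group_add[OF dm m])
qed

lemma dirac_evolution_nonzero:
  assumes \<psi>: "compact_wave R \<psi>" and nz: "\<not> (AE x in lborel. \<psi> x = 0)"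
  shows "\<not> (AE x in lborel. dirac_evolution \<alpha> \<beta> m t \<psi> x = 0)"
proof
  note t = dirac_evolution_compact_wave[OF dm m \<psi>]
  assume z: "AE x in lborel. dirac_evolution \<alpha> \<beta> m t \<psi> x = 0"
  have "fourier_integral (dirac_evolution \<alpha> \<beta> m t \<psi>) p = fourier_integral (\<lambda>x. 0) p" for p
    by (rule fourier_integral_AE_cong[OF compact_waveD(1)[OF t(1)] _ z]) simp
  then have "norm (fourier_integral (dirac_evolution \<alpha> \<beta> m t \<psi>) p) = 0" for p
    by (simp add: fourier_integral_def)
  then have "AE p in lborel. fourier_integral \<psi> p = 0"
    by (simp add: t(2) norm_free_group[OF dm m])
  from compact_wave_fourier_zero[OF \<psi> this] nz show False by blast
qed

text \<open>Replaces extended real edges by a real function E of time and the definite description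
  in \<open>edge_time\<close> by usable facts: the tent law, and the criterion that any T with the
  tent law is the edge time.\<close>

lemma edge_evolution:
  assumes e: "norm e = 1" and \<psi>: "compact_wave R \<psi>" and nz: "\<not> (AE x in lborel. \<psi> x = 0)"
  obtains E where "\<And>t. edge e (dirac_evolution \<alpha> \<beta> m t \<psi>) = ereal (E t)"
    "\<And>t. vanishes_below e (E t) (dirac_evolution \<alpha> \<beta> m t \<psi>)"
    "edge e \<psi> = ereal (E 0)"
    "\<And>t. E t = E 0 + \<bar>edge_time \<alpha> \<beta> m e \<psi>\<bar> - \<bar>t - edge_time \<alpha> \<beta> m e \<psi>\<bar>"
    "\<And>T. (\<And>t. E t = E 0 + \<bar>T\<bar> - \<bar>t - T\<bar>) \<Longrightarrow> edge_time \<alpha> \<beta> m e \<psi> = T"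
proof -
  let ?U = "\<lambda>t. dirac_evolution \<alpha> \<beta> m t \<psi>"
  note U = dirac_evolution_compact_wave(1)[OF dm m \<psi>]
  have ne: "norm (- e) = 1" using e by simp
  have "\<exists>a. (\<forall>b. vanishes_below e b (?U t) \<longleftrightarrow> b \<le> a) \<and> edge e (?U t) = ereal a" for t
    using edge_exists[OF e U dirac_evolution_nonzero[OF \<psi> nz], of t] by metis
  then obtain E where V: "\<And>t b. vanishes_below e b (?U t) \<longleftrightarrow> b \<le> E t" and ed: "\<And>t. edge e (?U t) = ereal (E t)"
    by metis
  have ed0: "edge e \<psi> = ereal (E 0)"
    using edge_AE_cong[OF dirac_evolution_0[OF \<psi>], of e] ed[of 0] by simp
  obtain c where c: "\<And>b. vanishes_below (- e) b (?U 0) \<longleftrightarrow> b \<le> c"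
    by (rule edge_exists[OF ne U dirac_evolution_nonzero[OF \<psi> nz], of 0], rule that)
  have VV: "vanishes_below e b (dirac_evolution \<alpha> \<beta> m s (?U t)) \<longleftrightarrow> b \<le> E (t + s)" for b s t
    unfolding vanishes_below_AE_cong[OF dirac_evolution_add[OF \<psi>]] V by (simp add: add.commute)
  obtain T where T: "\<And>t. E t = E 0 + \<bar>T\<bar> - \<bar>t - T\<bar>"
  proof (rule tent_function[of E "- c"])
    fix t s
    show "E t - \<bar>s\<bar> \<le> E (t + s)"
      using vanishes_below_evolution[OF dm m e U, of "E t" t s] by (simp add: V VV)
    \<comment> \<open>The width inequality allows different times for the two edges. Keeping the
      opposite one at time 0 bounds E uniformly in t.\<close>
    show "E t \<le> - c"
      using support_width_nonneg[OF dm m e \<psi> nz, of "E t" t c 0] by (simp add: V c)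
  next
    fix t s :: real assume s: "s > 0"
    \<comment> \<open>The minimum of the two edges is a common bound for both evolved waves, so the
      edge at time t is at least this minimum plus s.\<close>
    show "E (t + s) \<le> E t - s \<or> E (t - s) \<le> E t - s"
      using vanishes_below_of_evolutions[OF dm m e U s, of "min (E (t + s)) (E (t - s))" t] VV[of _ t "- s"]
      by (simp add: V VV) linarith
  qed (use that in blast)
  have law: "(\<forall>t. edge e (?U t) = edge e \<psi> + ereal \<bar>s\<bar> - ereal \<bar>t - s\<bar>) \<longleftrightarrow> (\<forall>t. E t = E 0 + \<bar>s\<bar> - \<bar>t - s\<bar>)" for s
    by (simp add: ed ed0)
  \<comment> \<open>Evaluating both laws at both peaks s and s' forces |s - s'| = 0.\<close>
  have uniq: "s = s'" if "\<forall>t. E t = E 0 + \<bar>s\<bar> - \<bar>t - s\<bar>" "\<forall>t. E t = E 0 + \<bar>s'\<bar> - \<bar>t - s'\<bar>" for s s'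
    using that(1)[rule_format, of s] that(2)[rule_format, of s] that(1)[rule_format, of s'] that(2)[rule_format, of s'] by linarith
  have et: "edge_time \<alpha> \<beta> m e \<psi> = S" if "\<And>t. E t = E 0 + \<bar>S\<bar> - \<bar>t - S\<bar>" for S
    unfolding edge_time_def law by (rule the_equality) (use that uniq in blast)+
  show ?thesis
  proof (rule that[OF ed _ ed0])
    show "vanishes_below e (E t) (?U t)" for t using V by simp
    show "E t = E 0 + \<bar>edge_time \<alpha> \<beta> m e \<psi>\<bar> - \<bar>t - edge_time \<alpha> \<beta> m e \<psi>\<bar>" for t
      unfolding et[OF T] by (rule T)
  qed (rule et)
qed

end

theorem mainTheorem2:
  fixes m :: real
    and \<alpha> :: "3 \<Rightarrow> complex ^ 4 ^ 4" and \<beta> :: "complex ^ 4 ^ 4"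
    and \<psi> :: "real ^ 3 \<Rightarrow> complex ^ 4" and e :: "real ^ 3"
  assumes "m > 0"
    and "dirac_matrices \<alpha> \<beta>"
    and "dirac_wavefunction \<psi>"
    and "\<not> (AE x in lborel. \<psi> x = 0)"
    and "\<exists>\<Delta>. \<Delta> \<in> sets lebesgue \<and> bounded \<Delta> \<and> localized_in \<psi> \<Delta>"
    and "norm e = 1"
  shows
    "(\<forall>t. edge e (dirac_evolution \<alpha> \<beta> m t \<psi>)
            \<le> - edge (- e) \<psi> - ereal \<bar>t - edge_time \<alpha> \<beta> m e \<psi>\<bar>) \<and>
     ereal (\<bar>edge_time \<alpha> \<beta> m e \<psi>\<bar> + \<bar>edge_time \<alpha> \<beta> m (- e) \<psi>\<bar>)
       \<le> - edge (- e) \<psi> - edge e \<psi> \<and>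
     (edge_time \<alpha> \<beta> m e \<psi> = edge_time \<alpha> \<beta> m (- e) \<psi> \<longrightarrow>
        ereal (2 * \<bar>edge_time \<alpha> \<beta> m e \<psi>\<bar>) < - edge (- e) \<psi> - edge e \<psi>) \<and>
     (\<forall>t. edge_time \<alpha> \<beta> m e (dirac_evolution \<alpha> \<beta> m t \<psi>) = edge_time \<alpha> \<beta> m e \<psi> - t) \<and>
     (bounded (range (\<lambda>p. dirac_symbol \<alpha> \<beta> m p *v fourier \<psi> p)) \<longrightarrow>
        (\<forall>t. edge e (dirac_evolution \<alpha> \<beta> m t \<psi>)
               < - edge (- e) \<psi> - ereal \<bar>t - edge_time \<alpha> \<beta> m e \<psi>\<bar>) \<and>
        ereal (\<bar>edge_time \<alpha> \<beta> m e \<psi>\<bar> + \<bar>edge_time \<alpha> \<beta> m (- e) \<psi>\<bar>)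
          < - edge (- e) \<psi> - edge e \<psi>)"
proof -
  note m = assms(1) and dm = assms(2) and nz = assms(4) and e = assms(6)
  have ne: "norm (- e) = 1" using e by simp
  obtain \<Delta> R where \<Delta>: "localized_in \<psi> \<Delta>" and R: "\<And>x. x \<in> \<Delta> \<Longrightarrow> norm x \<le> R"
    using assms(5) unfolding bounded_iff by blast
  have "AE x in lborel. norm x > R \<longrightarrow> \<psi> x = 0"
    using \<Delta> unfolding localized_in_def
  proof eventually_elim
    case (elim x)
    then show ?case using R[of x] by (cases "x \<in> \<Delta>") auto
  qed
  then have \<psi>: "compact_wave R \<psi>" using assms(3) by (simp add: compact_wave_def)
  note \<psi>t = dirac_evolution_compact_wave(1)[OF dm m \<psi>]
  let ?U = "\<lambda>t. dirac_evolution \<alpha> \<beta> m t \<psi>"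
  define T T' where "T = edge_time \<alpha> \<beta> m e \<psi>" and "T' = edge_time \<alpha> \<beta> m (- e) \<psi>"
  obtain E where E: "\<And>t. edge e (?U t) = ereal (E t)" "\<And>t. vanishes_below e (E t) (?U t)"
      "edge e \<psi> = ereal (E 0)" "\<And>t. E t = E 0 + \<bar>T\<bar> - \<bar>t - T\<bar>"
    unfolding T_def by (rule edge_evolution[OF dm m e \<psi> nz]) blast
  obtain E' where E': "\<And>t. vanishes_below (- e) (E' t) (?U t)"
      "edge (- e) \<psi> = ereal (E' 0)" "\<And>t. E' t = E' 0 + \<bar>T'\<bar> - \<bar>t - T'\<bar>"
    unfolding T'_def by (rule edge_evolution[OF dm m ne \<psi> nz]) blast
  have ET: "E T = E 0 + \<bar>T\<bar>" "E' T' = E' 0 + \<bar>T'\<bar>" using E(4)[of T] E'(3)[of T'] by simp_all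
  \<comment> \<open>The two tents are compared at their own peaks, which in general lie at different
    times; this brings |T| and |T'| into one inequality.\<close>
  have b: "E T + E' T' \<le> 0"
    by (rule support_width_nonneg[OF dm m e \<psi> nz E(2) E'(1)])
  \<comment> \<open>Here both edges are taken at the single time T; this is the comparison of the
    peaks as soon as T = T'.\<close>
  have c: "E T + E' T < 0"
    by (rule support_width_pos_same_time[OF e dirac_evolution_nonzero[OF dm m \<psi> nz] E(2) E'(1)])
  have s: "E T + E' T' < 0" if "bounded (range (\<lambda>p. dirac_symbol \<alpha> \<beta> m p *v fourier \<psi> p))"
    by (rule support_width_pos[OF dm m e \<psi> nz E(2) E'(1)]) (use that in \<open>simp add: fourier_compact_wave[OF \<psi>]\<close>)
  have d: "edge_time \<alpha> \<beta> m e (?U t) = T - t" for t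
  proof -
    obtain F where F: "\<And>r. edge e (dirac_evolution \<alpha> \<beta> m r (?U t)) = ereal (F r)"
      "\<And>S. (\<And>r. F r = F 0 + \<bar>S\<bar> - \<bar>r - S\<bar>) \<Longrightarrow> edge_time \<alpha> \<beta> m e (?U t) = S"
      by (rule edge_evolution[OF dm m e \<psi>t dirac_evolution_nonzero[OF dm m \<psi> nz], of t]) blast
    \<comment> \<open>By the group law the edge curve of the evolved wave is the original one
      shifted by t, so its peak sits at T - t.\<close>
    have FE: "F r = E (r + t)" for r
      using F(1)[of r] E(1)[of "r + t"] edge_AE_cong[OF dirac_evolution_add[OF dm m \<psi>, of r t], of e] by simp
    show ?thesis
    proof (rule F(2))
      fix r
      have "E (r + t) = E 0 + \<bar>T\<bar> - \<bar>r - (T - t)\<bar>" using E(4)[of "r + t"] by (simp add: algebra_simps)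
      moreover have "E t = E 0 + \<bar>T\<bar> - \<bar>T - t\<bar>" using E(4)[of t] by (simp add: abs_minus_commute)
      ultimately show "F r = F 0 + \<bar>T - t\<bar> - \<bar>r - (T - t)\<bar>" unfolding FE by simp
    qed
  qed
  have a: "edge e (?U t) = ereal (E T - \<bar>t - T\<bar>)" for t
    using E(1)[of t] E(4)[of t] ET(1) by simp
  show ?thesis
    unfolding a E(3) E'(2) d T_def[symmetric] T'_def[symmetric]
  proof (intro conjI allI impI)
    fix t
    \<comment> \<open>Dropping |T'| from the width inequality bounds the peak by the opposite edge
      at time 0; the tent law then subtracts |t - T| on both sides.\<close>
    have "E T \<le> - E' 0" using b ET abs_ge_zero[of T'] by linarith
    then show "ereal (E T - \<bar>t - T\<bar>) \<le> - ereal (E' 0) - ereal \<bar>t - T\<bar>" by simp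
    have "\<bar>T\<bar> + \<bar>T'\<bar> \<le> - E' 0 - E 0" using b ET by linarith
    then show "ereal (\<bar>T\<bar> + \<bar>T'\<bar>) \<le> - ereal (E' 0) - ereal (E 0)" by simp
    show "T - t = T - t" ..
  next
    assume "T = T'"
    then have "E' T = E' 0 + \<bar>T\<bar>" using ET(2) by simp
    then have "2 * \<bar>T\<bar> < - E' 0 - E 0" using c ET(1) by linarith
    then show "ereal (2 * \<bar>T\<bar>) < - ereal (E' 0) - ereal (E 0)" by simp
  next
    fix t
    assume bd: "bounded (range (\<lambda>p. dirac_symbol \<alpha> \<beta> m p *v fourier \<psi> p))"
    have "E T < - E' 0" using s[OF bd] ET abs_ge_zero[of T'] by linarith
    then show "ereal (E T - \<bar>t - T\<bar>) < - ereal (E' 0) - ereal \<bar>t - T\<bar>" by simp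
    have "\<bar>T\<bar> + \<bar>T'\<bar> < - E' 0 - E 0" using s[OF bd] ET by linarith
    then show "ereal (\<bar>T\<bar> + \<bar>T'\<bar>) < - ereal (E' 0) - ereal (E 0)" by simp
  qed
qed

end
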